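(* Let $\varepsilon_n=\sqrt{\ln(p)/n}$ and suppose the following hold. (1) $b_j\in\Gamma$ for all $j$, and for every $\alpha\in\Gamma$ and $\varepsilon>0$ there are $p$ and $\rho\in\mathbb{R}^p$ with $\mathrm{E}[\{\alpha(X)-\sum_{j=1}^p\rho_jb_j(X)\}^2]<\varepsilon$. (2) There exist $C>1$, $\xi>0$ such that for each positive integer $s\le C\varepsilon_n^{-2/(2\xi+1)}$ there is $\bar\rho\in\mathbb{R}^p$ with $s$ nonzero elements such that $\Vert\bar\alpha-b'\bar\rho\Vert\le Cs^{-\xi}$. (3) $G$ has largest eigenvalue bounded uniformly in $n$, and there are $C,c>0$ such that for each $\ell$ and all integers $s=s_n\approx C\varepsilon_n^{-2}$ (i.e. $s_n\varepsilon_n^2\to C$), with probability approaching one, $$\min_{J\subset\{1,\dots,p\},\,|J|\le s}\ \min_{\Vert\rho_{J^c}\Vert_1\le3\Vert\rho_J\Vert_1,\ \rho_J\ne0}\frac{\rho'\hat G_\ell\rho}{\rho_J'\rho_J}\ge c.$$ (4) There is $C>0$ such that with probability one $\sup_j|b_j(X)|\le C$. (5) $\varepsilon_n=o(r)$, $r=o(n^c\varepsilon_n)$ for all $c>0$, and there exists $C>0$ such that $p\le Cn^C$. (6) There is $C>0$ such that with probability one $\max_{j\le p}|m(W,b_j)|\le C$. (7) $\mathrm{E}[\{Y-\bar\gamma(X)\}^2|X]$ and $\bar\alpha(X)$ are bounded. (8) $\mathrm{E}[m(W,\bar\gamma)^2]<\infty$ and, for each $\ell$, $\int[m(w,\hat\gamma_\ell)-m(w,\bar\gamma)]^2F_W(dw)\overset{p}{\to}0$.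 (9) With probability approaching one $\hat\gamma_\ell\in\Gamma$, and there is $d_\gamma>0$ such that $\Vert\hat\gamma_\ell-\bar\gamma\Vert=O_p(n^{-d_\gamma})$ for each $\ell$, and either (2) and (3) are satisfied with $\frac{\xi}{2\xi+1}+d_\gamma>\frac12$, or $d_\gamma>1/4$ and the following holds: $\bar\alpha(X)=\sum_{j=1}^\infty\rho_{j0}b_j(X)$, $\sum_{j=1}^\infty|\rho_{j0}|<\infty$, and for some $C>0$ and $\bar s=C\sqrt n$ the $b_j(x)$ corresponding to the largest $\bar s$ values of $|\rho_{j0}|$ are included in $b(x)$. (10) There is $C>0$ with $\mathrm{E}[m(W,\gamma)^2]\le C\Vert\gamma\Vert^2$ for all $\gamma\in\Gamma$, and $\bar\alpha(X)\neq0$ (i.e. $\bar\alpha$ is not the zero element of $\Gamma$). Then $\sqrt n(\tilde\theta-\bar\theta)\overset{d}{\to}N(0,V)$.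
   Context: $W_1,\dots,W_n$ are i.i.d. copies of a data observation $W$ that includes a scalar $Y$ with $\mathrm{E}[Y^2]<\infty$ and a covariate vector $X$. $\Gamma$ is a closed linear subspace of the space of functions $\gamma(X)$ with $\mathrm{E}[\gamma(X)^2]<\infty$. $m(w,\gamma)$ is a functional of functions $\gamma$ of $x$, linear in $\gamma$, and there is $\alpha_0(X)$ with $\mathrm{E}[\alpha_0(X)^2]<\infty$ and $\mathrm{E}[m(W,\gamma)]=\mathrm{E}[\alpha_0(X)\gamma(X)]$ for all $\gamma$ with $\mathrm{E}[\gamma(X)^2]<\infty$. $\bar\alpha=\arg\min_{\alpha\in\Gamma}\mathrm{E}[\{\alpha_0(X)-\alpha(X)\}^2]$, $\bar\gamma=\arg\min_{\gamma\in\Gamma}\mathrm{E}[\{Y-\gamma(X)\}^2]$, and $$\bar\theta=\mathrm{E}[m(W,\bar\gamma)],\quad \psi(w)=m(w,\bar\gamma)-\bar\theta+\bar\alpha(x)[y-\bar\gamma(x)],\quad V=\mathrm{E}[\psi(W)^2].$$ $(b_j)_{j\ge1}$ is a sequence of functions of $x$; for each $n$, $b(x)=(b_1(x),\dots,b_p(x))'$ with $p=p_n\ge2$; $m(w,b)=(m(w,b_1),\dots,m(w,b_p))'$; $G=\mathrm{E}[b(X)b(X)']$. Cross-fitting: $L\ge2$ is fixed and $I_1,\dots,I_L$ is a partition of $\{1,\dots,n\}$ into sets of about equal size, with $n_\ell=|I_\ell|$. For each $\ell$, $\hat\gamma_\ell$ is a regression learner computed only from observations not in $I_\ell$. With $r=r_n>0$,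 $$\hat M_\ell=\frac1{n-n_\ell}\sum_{i\notin I_\ell}m(W_i,b),\quad \hat G_\ell=\frac1{n-n_\ell}\sum_{i\notin I_\ell}b(X_i)b(X_i)',$$ $$\hat\rho_\ell\in\arg\min_{\rho\in\mathbb{R}^p}\{-2\hat M_\ell'\rho+\rho'\hat G_\ell\rho+2r\Vert\rho\Vert_1\},\quad \hat\alpha_\ell(x)=b(x)'\hat\rho_\ell .$$ The Auto-TML estimator is $$\tilde\theta=\frac1n\sum_{\ell=1}^L\sum_{i\in I_\ell}m(W_i,\tilde\gamma_\ell),\qquad \tilde\gamma_\ell(x)=\hat\gamma_\ell(x)+\frac{\sum_{i\in I_\ell}\hat\alpha_\ell(X_i)[Y_i-\hat\gamma_\ell(X_i)]}{\sum_{i\in I_\ell}\hat\alpha_\ell(X_i)^2}\,\hat\alpha_\ell(x).$$ $\Vert a\Vert=\sqrt{\mathrm{E}[a(W)^2]}$, where for an estimated function the expectation is over a $W$ independent of the data with the estimate held fixed. $\Vert\cdot\Vert_1$ is the sum of absolute values of the entries. $\rho_J$ is the subvector of $\rho$ with indices in $J$, $\rho_{J^c}$ the remaining subvector. $F_W$ is the distribution of $W$. Limits are as $n\to\infty$. *)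

theory Defs
  imports "HOL-Probability.Probability" "HOL-Library.Landau_Symbols"
    "Jordan_Normal_Form.Spectral_Radius"
begin

text \<open>
  Events defined through estimated functions (such as membership in a function class) need not be
  measurable, and \<^const>\<open>measure\<close> is 0 on non-measurable sets. The following notions therefore use
  measurable subevents (inner probability); on measurable events they are the usual notions.
\<close>

definition wpa1 :: "'a measure \<Rightarrow> (nat \<Rightarrow> 'a \<Rightarrow> bool) \<Rightarrow> bool" where
  "wpa1 M P \<longleftrightarrow> (\<exists>A. (\<forall>n. A n \<in> sets M \<and> (\<forall>\<omega>\<in>A n. P n \<omega>)) \<and> (\<lambda>n. measure M (A n)) \<longlonglongrightarrow> 1)"

definition tendsto_0_in_prob :: "'a measure \<Rightarrow> (nat \<Rightarrow> 'a \<Rightarrow> ennreal) \<Rightarrow> bool" where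
  "tendsto_0_in_prob M Z \<longleftrightarrow> (\<forall>e>0. wpa1 M (\<lambda>n \<omega>. Z n \<omega> \<le> ennreal e))"

definition bigO_in_prob :: "'a measure \<Rightarrow> (nat \<Rightarrow> 'a \<Rightarrow> ennreal) \<Rightarrow> (nat \<Rightarrow> real) \<Rightarrow> bool" where
  "bigO_in_prob M Z a \<longleftrightarrow>
     (\<forall>\<delta>>0. \<exists>K>0. \<forall>\<^sub>F n in sequentially.
        \<exists>A\<in>sets M. measure M A \<ge> 1 - \<delta> \<and> (\<forall>\<omega>\<in>A. Z n \<omega> \<le> ennreal (K * a n)))"

text \<open>The law of \<open>sqrt V\<close> times a standard normal variable; for \<open>V = 0\<close> it is the point mass at 0.\<close>

definition centered_normal :: "real \<Rightarrow> real measure" where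
  "centered_normal V = distr std_normal_distribution borel (\<lambda>z. sqrt V * z)"

text \<open>The norm is extended-valued, so that it is infinite (not 0) outside the mean-square space.\<close>

definition ms_norm :: "'w measure \<Rightarrow> ('w \<Rightarrow> real) \<Rightarrow> ennreal" where
  "ms_norm F a =
     (let I = (\<integral>\<^sup>+ w. ennreal ((a w)\<^sup>2) \<partial>F)
      in if I = \<top> then \<top> else ennreal (sqrt (enn2real I)))"

definition sq_integrable_funs ::
    "'w measure \<Rightarrow> 'x measure \<Rightarrow> ('w \<Rightarrow> 'x) \<Rightarrow> ('x \<Rightarrow> real) set" where
  "sq_integrable_funs F MX X =
     {\<gamma>. \<gamma> \<in> borel_measurable MX \<and> integrable F (\<lambda>w. (\<gamma> (X w))\<^sup>2)}"

text \<open>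
  Elements are functions, not classes modulo null sets; closedness makes such a set saturated under
  almost sure equality.
\<close>

definition closed_linear_subspace ::
    "'w measure \<Rightarrow> 'x measure \<Rightarrow> ('w \<Rightarrow> 'x) \<Rightarrow> ('x \<Rightarrow> real) set \<Rightarrow> bool" where
  "closed_linear_subspace F MX X \<Gamma> \<longleftrightarrow>
     \<Gamma> \<subseteq> sq_integrable_funs F MX X \<and>
     (\<lambda>_. 0) \<in> \<Gamma> \<and>
     (\<forall>g\<in>\<Gamma>. \<forall>h\<in>\<Gamma>. \<forall>a c. (\<lambda>x. a * g x + c * h x) \<in> \<Gamma>) \<and>
     (\<forall>g h. (\<forall>k. g k \<in> \<Gamma>) \<and> h \<in> sq_integrable_funs F MX X \<and>
        (\<lambda>k::nat. LINT w|F. (g k (X w) - h (X w))\<^sup>2) \<longlonglongrightarrow> 0 \<longrightarrow> h \<in> \<Gamma>)"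

definition linear_functional_on :: "('x \<Rightarrow> real) set \<Rightarrow> (('x \<Rightarrow> real) \<Rightarrow> real) \<Rightarrow> bool" where
  "linear_functional_on D \<phi> \<longleftrightarrow>
     (\<forall>g\<in>D. \<forall>h\<in>D. \<forall>a c. \<phi> (\<lambda>x. a * g x + c * h x) = a * \<phi> g + c * \<phi> h)"

text \<open>
  Observations and dictionary functions are indexed from 0: the sample of size \<open>n\<close> is indexed by
  \<open>{..<n}\<close>, and a vector in \<open>p\<close>-dimensional space is a function whose values on \<open>{..<p}\<close> are used.
\<close>

definition eps :: "(nat \<Rightarrow> nat) \<Rightarrow> nat \<Rightarrow> real" where
  "eps p n = sqrt (ln (real (p n)) / real n)"

definition lin_comb :: "(nat \<Rightarrow> 'x \<Rightarrow> real) \<Rightarrow> nat \<Rightarrow> (nat \<Rightarrow> real) \<Rightarrow> 'x \<Rightarrow> real" where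
  "lin_comb b p \<rho> x = (\<Sum>j<p. \<rho> j * b j x)"

definition quad_form :: "nat \<Rightarrow> (nat \<Rightarrow> nat \<Rightarrow> real) \<Rightarrow> (nat \<Rightarrow> real) \<Rightarrow> real" where
  "quad_form p A \<rho> = (\<Sum>j<p. \<Sum>k<p. \<rho> j * A j k * \<rho> k)"

definition gram :: "'w measure \<Rightarrow> ('w \<Rightarrow> 'x) \<Rightarrow> (nat \<Rightarrow> 'x \<Rightarrow> real) \<Rightarrow> nat \<Rightarrow> real mat" where
  "gram F X b p = mat p p (\<lambda>(j, k). LINT w|F. b j (X w) * b k (X w))"

definition out_fold :: "(nat \<Rightarrow> nat \<Rightarrow> nat set) \<Rightarrow> nat \<Rightarrow> nat \<Rightarrow> nat set" where
  "out_fold I n l = {..<n} - I n l"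

definition M_hat ::
    "('w \<Rightarrow> ('x \<Rightarrow> real) \<Rightarrow> real) \<Rightarrow> (nat \<Rightarrow> 'x \<Rightarrow> real) \<Rightarrow> nat set \<Rightarrow> (nat \<Rightarrow> 'w) \<Rightarrow> nat \<Rightarrow> real" where
  "M_hat m b N d j = (\<Sum>i\<in>N. m (d i) (b j)) / real (card N)"

definition G_hat ::
    "('w \<Rightarrow> 'x) \<Rightarrow> (nat \<Rightarrow> 'x \<Rightarrow> real) \<Rightarrow> nat set \<Rightarrow> (nat \<Rightarrow> 'w) \<Rightarrow> nat \<Rightarrow> nat \<Rightarrow> real" where
  "G_hat X b N d j k = (\<Sum>i\<in>N. b j (X (d i)) * b k (X (d i))) / real (card N)"

definition lasso_objective ::
    "nat \<Rightarrow> real \<Rightarrow> (nat \<Rightarrow> real) \<Rightarrow> (nat \<Rightarrow> nat \<Rightarrow> real) \<Rightarrow> (nat \<Rightarrow> real) \<Rightarrow> real" where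
  "lasso_objective p r mh gh \<rho> =
     - 2 * (\<Sum>j<p. mh j * \<rho> j) + quad_form p gh \<rho> + 2 * r * (\<Sum>j<p. \<bar>\<rho> j\<bar>)"

definition restricted_eigenvalue_ge ::
    "nat \<Rightarrow> nat \<Rightarrow> real \<Rightarrow> (nat \<Rightarrow> nat \<Rightarrow> real) \<Rightarrow> bool" where
  "restricted_eigenvalue_ge p s c gh \<longleftrightarrow>
     (\<forall>J \<rho>. J \<subseteq> {..<p} \<and> card J \<le> s \<and>
        (\<Sum>j\<in>{..<p} - J. \<bar>\<rho> j\<bar>) \<le> 3 * (\<Sum>j\<in>J. \<bar>\<rho> j\<bar>) \<and> (\<exists>j\<in>J. \<rho> j \<noteq> 0) \<longrightarrow>
        quad_form p gh \<rho> / (\<Sum>j\<in>J. (\<rho> j)\<^sup>2) \<ge> c)"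

definition gamma_tilde ::
    "('w \<Rightarrow> 'x) \<Rightarrow> ('w \<Rightarrow> real) \<Rightarrow> nat set \<Rightarrow> ('x \<Rightarrow> real) \<Rightarrow> ('x \<Rightarrow> real) \<Rightarrow> (nat \<Rightarrow> 'w) \<Rightarrow> 'x \<Rightarrow> real"
  where
  "gamma_tilde X Y J g a d x =
     g x + (\<Sum>i\<in>J. a (X (d i)) * (Y (d i) - g (X (d i)))) / (\<Sum>i\<in>J. (a (X (d i)))\<^sup>2) * a x"

text \<open>
  A learner \<open>gh n l\<close> (likewise the coefficients \<open>rh n l\<close>) maps training data to its output and only
  ever receives the data restricted to the complement of fold \<open>l\<close>.
\<close>

definition theta_tilde ::
    "('w \<Rightarrow> ('x \<Rightarrow> real) \<Rightarrow> real) \<Rightarrow> ('w \<Rightarrow> 'x) \<Rightarrow> ('w \<Rightarrow> real) \<Rightarrow> (nat \<Rightarrow> 'x \<Rightarrow> real) \<Rightarrow> (nat \<Rightarrow> nat) \<Rightarrow>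
     nat \<Rightarrow> (nat \<Rightarrow> nat \<Rightarrow> nat set) \<Rightarrow>
     (nat \<Rightarrow> nat \<Rightarrow> (nat \<Rightarrow> 'w) \<Rightarrow> 'x \<Rightarrow> real) \<Rightarrow> (nat \<Rightarrow> nat \<Rightarrow> (nat \<Rightarrow> 'w) \<Rightarrow> nat \<Rightarrow> real) \<Rightarrow>
     nat \<Rightarrow> (nat \<Rightarrow> 'w) \<Rightarrow> real" where
  "theta_tilde m X Y b p L I gh rh n d =
     (\<Sum>l<L. \<Sum>i\<in>I n l.
        m (d i)
          (gamma_tilde X Y (I n l)
             (gh n l (restrict d (out_fold I n l)))
             (lin_comb b (p n) (rh n l (restrict d (out_fold I n l)))) d)) / real n"

end

theory Submission
  imports Defs "HOL-Real_Asymp.Real_Asymp"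
begin

text \<open>
  \<^emph>\<open>Rate of the Riesz learner.\<close> Let \<open>\<rho>\<^sup>*\<close> nearly minimize the population criterion
  \<open>\<parallel>\<alpha> - b'\<rho>\<parallel>\<^sup>2 + \<epsilon>\<^sup>2 \<parallel>\<rho>\<parallel>\<^sub>0\<close>. Perturbing one coordinate shows that the residual has correlation
  \<open>O(\<epsilon>)\<close> with every dictionary function, and a comparison with the given approximations bounds both the
  residual and the sparsity of \<open>\<rho>\<^sup>*\<close>. Restricted eigenvalues bound \<open>\<parallel>\<rho>\<^sup>*\<parallel>\<^sub>1\<close> by \<open>O(1/\<epsilon>)\<close>, so a Bernstein
  bound gives \<open>\<parallel>M - G \<rho>\<^sup>*\<parallel>\<^sub>\<infinity> \<le> r/2\<close> for the sample moments, and the usual lasso argument bounds the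
  \<open>\<ell>\<^sub>2\<close> distance of the lasso solution to \<open>\<rho>\<^sup>*\<close>, hence by the eigenvalue bound its mean-square error.

  \<^emph>\<open>Asymptotic normality.\<close> By the targeting step the plug-in sum over a fold equals the sum of
  \<open>m(W, \<gamma>) + \<alpha>(X)(Y - \<gamma>(X))\<close> plus five remainders. Given the observations outside the fold, three of
  them are sums of independent centred variables with vanishing variance (or multiplied by the vanishing
  targeting coefficient), and two are products of the two estimation errors. The central limit theorem
  applies to the leading term.
\<close>

section \<open>Independent samples and sample splitting\<close>

text \<open>The sparse approximations in the hypotheses are close to the target only in mean square.
  Cauchy--Schwarz then bounds their residual correlations by the approximation error, which is of
  larger order than \<epsilon>, while the lasso comparison needs order \<epsilon> in the maximum
  norm; this is why another approximation is built. Its coefficients are not controlled a priori,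
  and no lower eigenvalue bound is assumed for the population Gram matrix, so their size is
  extracted from the sample condition at one favourable outcome. The absolute sum may still diverge
  like 1/\<epsilon> while the second moment of the fitted function stays bounded: a bound by the
  range alone would be too weak, a variance bound is not. The factor r/\<epsilon> and the logarithm
  of p cost arbitrarily small powers of n, absorbed by the strict inequalities between the rates.
  The projection being nonzero keeps the targeting denominator of order n.\<close>

context prob_space
begin

text \<open>Up to an event of probability at most \<open>q\<close>; the exact set where \<open>P\<close> fails need not be measurable.\<close>

definition whp :: "real \<Rightarrow> ('a \<Rightarrow> bool) \<Rightarrow> bool" where
  "whp q P \<longleftrightarrow> (\<exists>E\<in>sets M. prob E \<le> q \<and> (\<forall>\<omega>\<in>space M - E. P \<omega>))"

lemma whp_mono:
  assumes "whp q P" "q \<le> q'" "\<And>\<omega>. \<omega> \<in> space M \<Longrightarrow> P \<omega> \<Longrightarrow> Q \<omega>"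
  shows "whp q' Q"
  using assms unfolding whp_def by (meson DiffD1 order_trans)

lemma whp_conj:
  assumes "whp q P" "whp q' Q"
  shows "whp (q + q') (\<lambda>\<omega>. P \<omega> \<and> Q \<omega>)"
proof -
  obtain D E where D: "D \<in> sets M" "prob D \<le> q" "\<forall>\<omega>\<in>space M - D. P \<omega>"
    and E: "E \<in> sets M" "prob E \<le> q'" "\<forall>\<omega>\<in>space M - E. Q \<omega>"
    using assms unfolding whp_def by blast
  have "prob (D \<union> E) \<le> q + q'" using measure_Un_le[OF D(1) E(1)] D E by linarith
  then show ?thesis unfolding whp_def using D E by (intro bexI[of _ "D \<union> E"]) auto
qed

lemma whp_ball:
  assumes "finite A" "\<And>l. l \<in> A \<Longrightarrow> whp q (P l)"
  shows "whp (real (card A) * q) (\<lambda>\<omega>. \<forall>l\<in>A. P l \<omega>)"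
  using assms
proof (induction A rule: finite_induct)
  case empty
  then show ?case unfolding whp_def by (intro bexI[of _ "{}"]) auto
next
  case (insert l A)
  then have "whp (q + real (card A) * q) (\<lambda>\<omega>. P l \<omega> \<and> (\<forall>l\<in>A. P l \<omega>))" by (intro whp_conj) auto
  then show ?case by (rule whp_mono) (use insert in \<open>auto simp: algebra_simps\<close>)
qed

lemma whp_of_prob:
  assumes "A \<in> sets M" "prob A \<ge> 1 - q" "\<And>\<omega>. \<omega> \<in> A \<Longrightarrow> P \<omega>"
  shows "whp q P"
  unfolding whp_def using assms prob_compl[OF assms(1)] by (intro bexI[of _ "space M - A"]) auto

lemma prob_le_of_whp:
  assumes "whp q P" "A \<subseteq> {\<omega>\<in>space M. \<not> P \<omega>}"
  shows "prob A \<le> q"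
proof -
  obtain E where E: "E \<in> sets M" "prob E \<le> q" "\<forall>\<omega>\<in>space M - E. P \<omega>" using assms(1) unfolding whp_def by blast
  have "prob A \<le> prob E" by (rule finite_measure_mono) (use assms E in auto)
  then show ?thesis using E by linarith
qed

lemma eventually_whp_of_wpa1:
  assumes "wpa1 M P" "\<delta> > 0"
  shows "\<forall>\<^sub>F n in sequentially. whp \<delta> (P n)"
proof -
  obtain A where A: "\<And>n. A n \<in> sets M" "\<And>n \<omega>. \<omega> \<in> A n \<Longrightarrow> P n \<omega>" "(\<lambda>n. prob (A n)) \<longlonglongrightarrow> 1"
    using assms(1) unfolding wpa1_def by blast
  have "\<forall>\<^sub>F n in sequentially. prob (A n) > 1 - \<delta>" using order_tendstoD(1)[OF A(3), of "1 - \<delta>"] assms(2) by simp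
  then show ?thesis by eventually_elim (rule whp_of_prob[OF A(1) less_imp_le A(2)])
qed

end

section \<open>Moments and tail bounds for sums over an i.i.d. sample\<close>

locale iid_sample = prob_space M for M :: "'a measure" +
  fixes F :: "'w measure" and W :: "nat \<Rightarrow> 'a \<Rightarrow> 'w"
  assumes indep: "indep_vars (\<lambda>_. F) W UNIV"
    and ident: "\<And>i. distr M F (W i) = F"
begin

lemma W_measurable [measurable]: "W i \<in> measurable M F"
  using indep by (auto simp: indep_vars_def)

lemma prob_space_F: "prob_space F"
  using prob_space_distr[OF W_measurable[of 0]] ident[of 0] by simp

lemma integral_W:
  fixes f :: "'w \<Rightarrow> real"
  assumes "f \<in> borel_measurable F"
  shows "(LINT \<omega>|M. f (W i \<omega>)) = (LINT w|F. f w)"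
  using integral_distr[OF W_measurable assms, of i] by (simp add: ident)

lemma integrable_W:
  fixes f :: "'w \<Rightarrow> real"
  assumes "integrable F f"
  shows "integrable M (\<lambda>\<omega>. f (W i \<omega>))"
  using integrable_distr[OF W_measurable, of i f] assms by (simp add: ident)

lemma AE_W:
  assumes "AE w in F. P w"
  shows "AE \<omega> in M. P (W i \<omega>)"
  by (rule AE_distrD[OF W_measurable]) (use assms in \<open>simp only: ident\<close>)

lemma indep_W_compose:
  fixes f :: "'w \<Rightarrow> real"
  assumes "f \<in> borel_measurable F"
  shows "indep_vars (\<lambda>_. borel) (\<lambda>i \<omega>. f (W i \<omega>)) J"
  by (rule indep_vars_compose2[OF indep_vars_subset[OF indep]]) (use assms in auto)

lemma integral_mult_W:
  fixes f :: "'w \<Rightarrow> real"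
  assumes "integrable F f" "i \<noteq> j"
  shows "(LINT \<omega>|M. f (W i \<omega>) * f (W j \<omega>)) = (LINT w|F. f w)\<^sup>2"
    and "integrable M (\<lambda>\<omega>. f (W i \<omega>) * f (W j \<omega>))"
proof -
  have m: "f \<in> borel_measurable F" using assms by auto
  have iv: "indep_vars (\<lambda>_. borel) (\<lambda>i \<omega>. f (W i \<omega>)) {i, j}" by (rule indep_W_compose[OF m])
  have int: "\<And>k. k \<in> {i,j} \<Longrightarrow> integrable M (\<lambda>\<omega>. f (W k \<omega>))" using integrable_W[OF assms(1)] by auto
  show "(LINT \<omega>|M. f (W i \<omega>) * f (W j \<omega>)) = (LINT w|F. f w)\<^sup>2"
    using indep_vars_lebesgue_integral[OF _ iv int] assms(2)
    by (simp add: integral_W[OF m] power2_eq_square)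
  show "integrable M (\<lambda>\<omega>. f (W i \<omega>) * f (W j \<omega>))"
    using indep_vars_integrable[OF _ iv int] assms(2) by simp
qed

text \<open>By independence every off-diagonal product has mean \<open>(E f)\<^sup>2 = 0\<close>, so
  only the diagonal survives.\<close>

lemma second_moment_sum:
  fixes f :: "'w \<Rightarrow> real"
  assumes "f \<in> borel_measurable F" "integrable F (\<lambda>w. (f w)\<^sup>2)" "(LINT w|F. f w) = 0" "finite J"
  shows "integrable M (\<lambda>\<omega>. (\<Sum>i\<in>J. f (W i \<omega>))\<^sup>2)"
    and "(LINT \<omega>|M. (\<Sum>i\<in>J. f (W i \<omega>))\<^sup>2) = real (card J) * (LINT w|F. (f w)\<^sup>2)"
proof -
  interpret F: prob_space F by (rule prob_space_F)
  have int: "integrable F f"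
    by (rule F.square_integrable_imp_integrable[OF assms(1,2)])
  have sq: "(\<Sum>i\<in>J. f (W i \<omega>))\<^sup>2 = (\<Sum>i\<in>J. \<Sum>j\<in>J. f (W i \<omega>) * f (W j \<omega>))" for \<omega>
    by (simp add: power2_eq_square sum_product)
  have intij: "integrable M (\<lambda>\<omega>. f (W i \<omega>) * f (W j \<omega>))" for i j
    using integral_mult_W(2)[OF int, of i j] integrable_W[OF assms(2), of i]
    by (cases "i = j") (auto simp: power2_eq_square)
  show "integrable M (\<lambda>\<omega>. (\<Sum>i\<in>J. f (W i \<omega>))\<^sup>2)" unfolding sq using intij by auto
  have e: "(LINT \<omega>|M. f (W i \<omega>) * f (W j \<omega>)) = (if i = j then (LINT w|F. (f w)\<^sup>2) else 0)" for i j
    using integral_mult_W(1)[OF int, of i j] integral_W[of "\<lambda>w. (f w)\<^sup>2" i] assms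
    by (auto simp: power2_eq_square)
  show "(LINT \<omega>|M. (\<Sum>i\<in>J. f (W i \<omega>))\<^sup>2) = real (card J) * (LINT w|F. (f w)\<^sup>2)"
    unfolding sq using intij e assms(4)
    by (simp add: sum.delta)
qed

lemma prob_sum_chebyshev:
  fixes f :: "'w \<Rightarrow> real"
  assumes [measurable]: "f \<in> borel_measurable F"
    and "integrable F (\<lambda>w. (f w)\<^sup>2)" "(LINT w|F. f w) = 0" "finite J" "t > 0"
  shows "prob {\<omega>\<in>space M. \<bar>\<Sum>i\<in>J. f (W i \<omega>)\<bar> \<ge> t} \<le> real (card J) * (LINT w|F. (f w)\<^sup>2) / t\<^sup>2"
proof -
  have "prob {\<omega>\<in>space M. \<bar>\<Sum>i\<in>J. f (W i \<omega>)\<bar> \<ge> t} = prob {\<omega>\<in>space M. (\<Sum>i\<in>J. f (W i \<omega>))\<^sup>2 \<ge> t\<^sup>2}"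
    using assms(5) by (intro arg_cong[where f=prob] Collect_cong) (auto simp: abs_le_square_iff[symmetric])
  also have "\<dots> \<le> (LINT \<omega>|M. (\<Sum>i\<in>J. f (W i \<omega>))\<^sup>2) / t\<^sup>2"
    by (rule integral_Markov_inequality_measure[where A="{}"])
       (use assms second_moment_sum[of f J] in auto)
  finally show ?thesis using second_moment_sum(2)[of f J] assms by simp
qed

lemma prob_sum_markov:
  fixes f :: "'w \<Rightarrow> real"
  assumes [measurable]: "integrable F f"
    and "\<And>w. f w \<ge> 0" "finite J" "t > 0"
  shows "prob {\<omega>\<in>space M. (\<Sum>i\<in>J. f (W i \<omega>)) \<ge> t} \<le> real (card J) * (LINT w|F. f w) / t"
proof -
  have [measurable]: "f \<in> borel_measurable F" using assms by auto
  have "prob {\<omega>\<in>space M. (\<Sum>i\<in>J. f (W i \<omega>)) \<ge> t} \<le> (LINT \<omega>|M. (\<Sum>i\<in>J. f (W i \<omega>))) / t"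
    by (rule integral_Markov_inequality_measure[where A="{}"])
       (use assms integrable_W[OF assms(1)] in \<open>auto intro!: sum_nonneg\<close>)
  also have "(LINT \<omega>|M. (\<Sum>i\<in>J. f (W i \<omega>))) = real (card J) * (LINT w|F. f w)"
    using integrable_W[OF assms(1)] by (subst Bochner_Integration.integral_sum) (auto simp: integral_W)
  finally show ?thesis .
qed

section \<open>Conditioning on the training observations\<close>

abbreviation obs :: "nat set \<Rightarrow> 'a \<Rightarrow> nat \<Rightarrow> 'w" where
  "obs N \<omega> \<equiv> restrict (\<lambda>i. W i \<omega>) N"

lemma obs_measurable [measurable]: "obs N \<in> measurable M (PiM N (\<lambda>_. F))"
  by (rule measurable_restrict) auto

text \<open>Disjoint blocks of an independent sample have a product law, so the joint probability is
  the integral over \<open>d\<close> of the probability with the training data frozen at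
  \<open>d\<close>. A bound uniform in \<open>d\<close> survives this integration; conditional
  distributions are avoided altogether.\<close>

lemma prob_conditional_le:
  assumes disj: "N \<inter> J = {}"
    and Q [measurable]: "Q \<in> sets (PiM N (\<lambda>_. F) \<Otimes>\<^sub>M PiM J (\<lambda>_. F))"
    and B [measurable]: "B \<in> sets (PiM N (\<lambda>_. F))"
    and le: "\<And>d. d \<in> B \<Longrightarrow> prob {\<omega>\<in>space M. (d, obs J \<omega>) \<in> Q} \<le> \<eta>"
    and "\<eta> \<ge> 0"
  shows "prob {\<omega>\<in>space M. obs N \<omega> \<in> B \<and>
            (obs N \<omega>, obs J \<omega>) \<in> Q} \<le> \<eta>"
proof -
  let ?T = "obs N" and ?R = "obs J"
  let ?P = "PiM N (\<lambda>_. F)" and ?PJ = "PiM J (\<lambda>_. F)"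
  \<comment> \<open>Cutting down to \<open>B\<close> makes the sections at \<open>d\<close> outside
    \<open>B\<close> empty, so the bound is only asked for \<open>d\<close> in
    \<open>B\<close>.\<close>
  define Q' where "Q' = Q \<inter> (B \<times> space ?PJ)"
  have [measurable]: "Q' \<in> sets (?P \<Otimes>\<^sub>M ?PJ)" unfolding Q'_def by measurable
  have "indep_var ?P ?T ?PJ ?R" by (rule indep_var_restrict[OF indep disj]) auto
  then have d: "distr M ?P ?T \<Otimes>\<^sub>M distr M ?PJ ?R = distr M (?P \<Otimes>\<^sub>M ?PJ) (\<lambda>\<omega>. (?T \<omega>, ?R \<omega>))"
    using indep_var_distribution_eq by blast
  interpret T: prob_space "distr M ?P ?T" by (rule prob_space_distr) measurable
  interpret R: prob_space "distr M ?PJ ?R" by (rule prob_space_distr) measurable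
  have sR: "?R \<omega> \<in> space ?PJ" if "\<omega> \<in> space M" for \<omega>
    using measurable_space[OF obs_measurable that] .
  have "emeasure M {\<omega>\<in>space M. ?T \<omega> \<in> B \<and> (?T \<omega>, ?R \<omega>) \<in> Q} = emeasure (distr M (?P \<Otimes>\<^sub>M ?PJ) (\<lambda>\<omega>. (?T \<omega>, ?R \<omega>))) Q'"
    by (subst emeasure_distr) (auto simp: Q'_def sR intro!: arg_cong[where f="emeasure M"])
  also have "\<dots> = emeasure (distr M ?P ?T \<Otimes>\<^sub>M distr M ?PJ ?R) Q'" by (simp add: d)
  also have "\<dots> = (\<integral>\<^sup>+d. emeasure (distr M ?PJ ?R) (Pair d -` Q') \<partial>distr M ?P ?T)"
    by (rule R.emeasure_pair_measure_alt) simp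
  also have "\<dots> \<le> (\<integral>\<^sup>+d. ennreal \<eta> \<partial>distr M ?P ?T)"
  proof (rule nn_integral_mono)
    fix d assume "d \<in> space (distr M ?P ?T)"
    show "emeasure (distr M ?PJ ?R) (Pair d -` Q') \<le> ennreal \<eta>"
    proof (cases "d \<in> B")
      case True
      have "Pair d -` Q' \<in> sets ?PJ" by (rule sets_Pair1[OF \<open>Q' \<in> sets (?P \<Otimes>\<^sub>M ?PJ)\<close>])
      then have "emeasure (distr M ?PJ ?R) (Pair d -` Q') = emeasure M (?R -` (Pair d -` Q') \<inter> space M)"
        by (rule emeasure_distr[rotated]) simp
      also have "?R -` (Pair d -` Q') \<inter> space M = {\<omega>\<in>space M. (d, ?R \<omega>) \<in> Q}"
        using True by (auto simp: Q'_def sR)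
      finally show ?thesis using ennreal_leI[OF le[OF True]] by (simp only: emeasure_eq_measure)
    qed (auto simp: Q'_def)
  qed
  also have "\<dots> = ennreal \<eta>" using T.emeasure_space_1 by simp
  finally show ?thesis using \<open>\<eta> \<ge> 0\<close> by (simp add: emeasure_eq_measure)
qed

lemma measurable_obs_pair:
  fixes f :: "(nat \<Rightarrow> 'w) \<Rightarrow> 'w \<Rightarrow> real"
  assumes "(\<lambda>(d, w). f d w) \<in> borel_measurable (PiM N (\<lambda>_. F) \<Otimes>\<^sub>M F)"
  shows "i \<in> J \<Longrightarrow> (\<lambda>x. f (fst x) (snd x i)) \<in> borel_measurable (PiM N (\<lambda>_. F) \<Otimes>\<^sub>M PiM J (\<lambda>_. F))"
    and "(\<lambda>\<omega>. f (obs N \<omega>) (W i \<omega>)) \<in> borel_measurable M"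
    and "d \<in> space (PiM N (\<lambda>_. F)) \<Longrightarrow> f d \<in> borel_measurable F"
proof -
  show "(\<lambda>x. f (fst x) (snd x i)) \<in> borel_measurable (PiM N (\<lambda>_. F) \<Otimes>\<^sub>M PiM J (\<lambda>_. F))" if "i \<in> J"
  proof -
    have "(\<lambda>x. (fst x, snd x i)) \<in> measurable (PiM N (\<lambda>_. F) \<Otimes>\<^sub>M PiM J (\<lambda>_. F)) (PiM N (\<lambda>_. F) \<Otimes>\<^sub>M F)"
      using that by measurable
    from measurable_compose[OF this assms] show ?thesis by simp
  qed
  have "(\<lambda>\<omega>. (obs N \<omega>, W i \<omega>)) \<in> measurable M (PiM N (\<lambda>_. F) \<Otimes>\<^sub>M F)"
    by (intro measurable_Pair obs_measurable W_measurable)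
  from measurable_compose[OF this assms] show "(\<lambda>\<omega>. f (obs N \<omega>) (W i \<omega>)) \<in> borel_measurable M" by simp
  show "f d \<in> borel_measurable F" if "d \<in> space (PiM N (\<lambda>_. F))"
    using measurable_Pair2[OF assms that] by simp
qed

text \<open>The form in which freezing is applied: \<open>f\<close> may depend on the training data
  as long as these lie in a set \<open>B\<close> of good data. The implication lets the probability
  of bad data be charged separately.\<close>

lemma whp_conditional:
  fixes f :: "(nat \<Rightarrow> 'w) \<Rightarrow> 'w \<Rightarrow> real"
  assumes disj: "N \<inter> J = {}" and f: "(\<lambda>(d, w). f d w) \<in> borel_measurable (PiM N (\<lambda>_. F) \<Otimes>\<^sub>M F)"
    and B: "B \<in> sets (PiM N (\<lambda>_. F))" and q: "q \<ge> 0"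
    and le: "\<And>d. d \<in> B \<Longrightarrow> prob {\<omega>\<in>space M. \<bar>\<Sum>i\<in>J. f d (W i \<omega>)\<bar> \<ge> t} \<le> q"
  shows "whp q (\<lambda>\<omega>. obs N \<omega> \<in> B \<longrightarrow> \<bar>\<Sum>i\<in>J. f (obs N \<omega>) (W i \<omega>)\<bar> < t)"
proof -
  let ?P = "PiM N (\<lambda>_. F)" and ?PJ = "PiM J (\<lambda>_. F)"
  define Q where "Q = {x \<in> space (?P \<Otimes>\<^sub>M ?PJ). \<bar>\<Sum>i\<in>J. f (fst x) (snd x i)\<bar> \<ge> t}"
  have Q: "Q \<in> sets (?P \<Otimes>\<^sub>M ?PJ)" unfolding Q_def using measurable_obs_pair(1)[OF f] by measurable
  have sR: "obs K \<omega> \<in> space (PiM K (\<lambda>_. F))" if "\<omega> \<in> space M" for \<omega> K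
    using measurable_space[OF obs_measurable that] .
  let ?E = "{\<omega>\<in>space M. obs N \<omega> \<in> B \<and> \<bar>\<Sum>i\<in>J. f (obs N \<omega>) (W i \<omega>)\<bar> \<ge> t}"
  have "?E = {\<omega>\<in>space M. obs N \<omega> \<in> B \<and> (obs N \<omega>, obs J \<omega>) \<in> Q}"
    using sR by (auto simp: Q_def space_pair_measure)
  also have "prob \<dots> \<le> q"
  proof (rule prob_conditional_le[OF disj Q B _ q])
    fix d assume d: "d \<in> B"
    then have "{\<omega> \<in> space M. (d, obs J \<omega>) \<in> Q} = {\<omega>\<in>space M. \<bar>\<Sum>i\<in>J. f d (W i \<omega>)\<bar> \<ge> t}"
      using sets.sets_into_space[OF B] sR[of _ J] by (auto simp: Q_def space_pair_measure)
    then show "prob {\<omega> \<in> space M. (d, obs J \<omega>) \<in> Q} \<le> q" using le[OF d] by simp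
  qed
  finally have "prob ?E \<le> q" .
  moreover have "?E \<in> sets M"
    using B measurable_obs_pair(2)[OF f] by measurable
  ultimately show ?thesis unfolding whp_def by (intro bexI[of _ ?E]) auto
qed

lemma whp_conditional_chebyshev:
  fixes f :: "(nat \<Rightarrow> 'w) \<Rightarrow> 'w \<Rightarrow> real"
  assumes disj: "N \<inter> J = {}" "finite J"
    and f: "(\<lambda>(d, w). f d w) \<in> borel_measurable (PiM N (\<lambda>_. F) \<Otimes>\<^sub>M F)" and B: "B \<in> sets (PiM N (\<lambda>_. F))"
    and le: "\<And>d. d \<in> B \<Longrightarrow> integrable F (\<lambda>w. (f d w)\<^sup>2) \<and> (LINT w|F. f d w) = 0 \<and> (LINT w|F. (f d w)\<^sup>2) \<le> v"
    and "v \<ge> 0" "t > 0" and q: "real (card J) * v / t\<^sup>2 \<le> q"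
  shows "whp q (\<lambda>\<omega>. obs N \<omega> \<in> B \<longrightarrow> \<bar>\<Sum>i\<in>J. f (obs N \<omega>) (W i \<omega>)\<bar> < t)"
proof (rule whp_conditional[OF disj(1) f B])
  have "0 \<le> real (card J) * v / t\<^sup>2" using assms by simp
  then show "q \<ge> 0" using q by linarith
  fix d assume d: "d \<in> B"
  then have "f d \<in> borel_measurable F" using sets.sets_into_space[OF B] by (intro measurable_obs_pair(3)[OF f]) auto
  then have "prob {\<omega>\<in>space M. \<bar>\<Sum>i\<in>J. f d (W i \<omega>)\<bar> \<ge> t} \<le> real (card J) * (LINT w|F. (f d w)\<^sup>2) / t\<^sup>2"
    by (rule prob_sum_chebyshev) (use le[OF d] assms in auto)
  also have "\<dots> \<le> real (card J) * v / t\<^sup>2" using le[OF d] by (intro divide_right_mono mult_left_mono) auto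
  finally show "prob {\<omega>\<in>space M. \<bar>\<Sum>i\<in>J. f d (W i \<omega>)\<bar> \<ge> t} \<le> q" using q by linarith
qed

lemma whp_conditional_markov:
  fixes f :: "(nat \<Rightarrow> 'w) \<Rightarrow> 'w \<Rightarrow> real"
  assumes disj: "N \<inter> J = {}" "finite J"
    and f: "(\<lambda>(d, w). f d w) \<in> borel_measurable (PiM N (\<lambda>_. F) \<Otimes>\<^sub>M F)" and B: "B \<in> sets (PiM N (\<lambda>_. F))"
    and nonneg: "\<And>d w. f d w \<ge> 0"
    and le: "\<And>d. d \<in> B \<Longrightarrow> integrable F (f d) \<and> (LINT w|F. f d w) \<le> v"
    and "v \<ge> 0" "t > 0" and q: "real (card J) * v / t \<le> q"
  shows "whp q (\<lambda>\<omega>. obs N \<omega> \<in> B \<longrightarrow> \<bar>\<Sum>i\<in>J. f (obs N \<omega>) (W i \<omega>)\<bar> < t)"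
proof (rule whp_conditional[OF disj(1) f B])
  have "0 \<le> real (card J) * v / t" using assms by simp
  then show "q \<ge> 0" using q by linarith
  fix d assume d: "d \<in> B"
  have "prob {\<omega>\<in>space M. \<bar>\<Sum>i\<in>J. f d (W i \<omega>)\<bar> \<ge> t} \<le> real (card J) * (LINT w|F. f d w) / t"
    using prob_sum_markov[of "f d" J t] le[OF d] assms by (simp add: sum_nonneg)
  also have "\<dots> \<le> real (card J) * v / t" using le[OF d] \<open>t > 0\<close> by (intro divide_right_mono mult_left_mono) auto
  finally show "prob {\<omega>\<in>space M. \<bar>\<Sum>i\<in>J. f d (W i \<omega>)\<bar> \<ge> t} \<le> q" using q by linarith
qed

text \<open>For \<open>\<bar>x\<bar> \<le> 1\<close>, \<open>exp x \<le> 1 + x + x\<^sup>2\<close>; this turns a variance bound into a Bernstein bound.\<close>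

lemma prob_sum_bernstein:
  fixes f :: "'w \<Rightarrow> real"
  assumes [measurable]: "f \<in> borel_measurable F"
    and bd: "AE w in F. \<bar>c * f w\<bar> \<le> 1"
    and "integrable F (\<lambda>w. (f w)\<^sup>2)" "(LINT w|F. f w) = 0" "(LINT w|F. (f w)\<^sup>2) \<le> v"
    and "finite J" "c > 0"
  shows "prob {\<omega>\<in>space M. (\<Sum>i\<in>J. f (W i \<omega>)) \<ge> t} \<le> exp (real (card J) * c\<^sup>2 * v - c * t)"
proof -
  interpret F: prob_space F by (rule prob_space_F)
  have int: "integrable F f"
    by (rule F.square_integrable_imp_integrable[OF assms(1,3)])
  have inte: "integrable F (\<lambda>w. exp (c * f w))"
  proof (rule F.integrable_const_bound[where B="exp 1"])
    show "AE x in F. norm (exp (c * f x)) \<le> exp 1" using bd by eventually_elim auto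
  qed measurable
  have "(LINT w|F. exp (c * f w)) \<le> (LINT w|F. 1 + c * f w + c\<^sup>2 * (f w)\<^sup>2)"
  proof (rule integral_mono_AE[OF inte])
    show "integrable F (\<lambda>w. 1 + c * f w + c\<^sup>2 * (f w)\<^sup>2)" using int assms by auto
    show "AE w in F. exp (c * f w) \<le> 1 + c * f w + c\<^sup>2 * (f w)\<^sup>2"
      using bd
    proof eventually_elim
      case (elim w)
      have "exp x \<le> 1 + x + x\<^sup>2" if "\<bar>x\<bar> \<le> 1" for x :: real
        using exp_bound[of x] exp_bound_lemma[of x] that
      proof (cases "x \<ge> 0")
        case False
        then have "exp x \<le> 1 / (1 - x)" using exp_ge_add_one_self[of "-x"]
          by (simp add: exp_minus field_simps)
        also have "\<dots> \<le> 1 + x + x\<^sup>2"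
        proof -
          have "x^3 \<le> 0" using False by (simp add: power3_eq_cube mult_nonneg_nonpos mult_nonpos_nonpos zero_le_mult_iff mult_le_0_iff)
          then have "1 \<le> (1 + x + x\<^sup>2) * (1 - x)" by (simp add: field_simps power2_eq_square power3_eq_cube)
          then show ?thesis using False by (simp add: pos_divide_le_eq)
        qed
        finally show ?thesis .
      qed (auto simp: exp_bound)
      from this[OF elim] show ?case by (simp add: power_mult_distrib)
    qed
  qed
  also have "\<dots> = 1 + c\<^sup>2 * (LINT w|F. (f w)\<^sup>2)"
    using int assms by (simp add: F.prob_space)
  also have "\<dots> \<le> 1 + c\<^sup>2 * v" using assms by (simp add: mult_left_mono)
  also have "\<dots> \<le> exp (c\<^sup>2 * v)" by (rule exp_ge_add_one_self)
  finally have mgf: "(LINT w|F. exp (c * f w)) \<le> exp (c\<^sup>2 * v)" .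
  have iv: "indep_vars (\<lambda>_. borel) (\<lambda>i \<omega>. exp (c * f (W i \<omega>))) J"
    by (rule indep_W_compose[of "\<lambda>w. exp (c * f w)"]) measurable
  have inti: "\<And>i. i \<in> J \<Longrightarrow> integrable M (\<lambda>\<omega>. exp (c * f (W i \<omega>)))" using integrable_W[OF inte] by auto
  have ex: "exp (c * (\<Sum>i\<in>J. f (W i \<omega>))) = (\<Prod>i\<in>J. exp (c * f (W i \<omega>)))" for \<omega>
    using \<open>finite J\<close> by (simp add: sum_distrib_left exp_sum)
  have "prob {\<omega>\<in>space M. (\<Sum>i\<in>J. f (W i \<omega>)) \<ge> t} =
      prob {\<omega>\<in>space M. exp (c * (\<Sum>i\<in>J. f (W i \<omega>))) \<ge> exp (c * t)}"
    using \<open>c > 0\<close> by simp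
  also have "\<dots> \<le> (LINT \<omega>|M. exp (c * (\<Sum>i\<in>J. f (W i \<omega>)))) / exp (c * t)"
    by (rule integral_Markov_inequality_measure[where A="{}"])
       (use indep_vars_integrable[OF \<open>finite J\<close> iv inti] in \<open>auto simp: ex intro!: AE_I2 prod_nonneg\<close>)
  also have "(LINT \<omega>|M. exp (c * (\<Sum>i\<in>J. f (W i \<omega>)))) = (\<Prod>i\<in>J. LINT w|F. exp (c * f w))"
    unfolding ex by (subst indep_vars_lebesgue_integral[OF \<open>finite J\<close> iv inti])
      (auto simp: integral_W[of "\<lambda>w. exp (c * f w)"])
  also have "\<dots> / exp (c * t) \<le> exp (c\<^sup>2 * v) ^ card J / exp (c * t)"
    using mgf by (intro divide_right_mono) (auto intro!: power_mono integral_nonneg_AE)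
  also have "\<dots> = exp (real (card J) * c\<^sup>2 * v - c * t)"
    by (simp add: exp_diff exp_of_nat_mult[symmetric] mult.assoc)
  finally show ?thesis .
qed

lemma prob_abs_sum_bernstein:
  fixes f :: "'w \<Rightarrow> real"
  assumes [measurable]: "f \<in> borel_measurable F"
    and bd: "AE w in F. \<bar>c * f w\<bar> \<le> 1"
    and "integrable F (\<lambda>w. (f w)\<^sup>2)" "(LINT w|F. f w) = 0" "(LINT w|F. (f w)\<^sup>2) \<le> v"
    and "finite J" "c > 0"
  shows "prob {\<omega>\<in>space M. \<bar>\<Sum>i\<in>J. f (W i \<omega>)\<bar> \<ge> t} \<le> 2 * exp (real (card J) * c\<^sup>2 * v - c * t)"
proof -
  have 1: "prob {\<omega>\<in>space M. (\<Sum>i\<in>J. f (W i \<omega>)) \<ge> t} \<le> exp (real (card J) * c\<^sup>2 * v - c * t)"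
    by (rule prob_sum_bernstein) (use assms in auto)
  have 2: "prob {\<omega>\<in>space M. (\<Sum>i\<in>J. (\<lambda>w. - f w) (W i \<omega>)) \<ge> t} \<le> exp (real (card J) * c\<^sup>2 * v - c * t)"
    by (rule prob_sum_bernstein) (use assms in auto)
  have "prob {\<omega>\<in>space M. \<bar>\<Sum>i\<in>J. f (W i \<omega>)\<bar> \<ge> t} \<le>
    prob ({\<omega>\<in>space M. (\<Sum>i\<in>J. f (W i \<omega>)) \<ge> t} \<union> {\<omega>\<in>space M. (\<Sum>i\<in>J. (\<lambda>w. - f w) (W i \<omega>)) \<ge> t})"
    by (rule finite_measure_mono) (auto simp: sum_negf abs_real_def split: if_splits)
  also have "\<dots> \<le> prob {\<omega>\<in>space M. (\<Sum>i\<in>J. f (W i \<omega>)) \<ge> t} + prob {\<omega>\<in>space M. (\<Sum>i\<in>J. (\<lambda>w. - f w) (W i \<omega>)) \<ge> t}"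
    by (rule measure_Un_le) auto
  finally show ?thesis using 1 2 by simp
qed

text \<open>Slutsky's theorem through characteristic functions. Where \<open>T n\<close> and the
  normalized sum differ by at most \<open>e\<close>, their complex exponentials differ by at most
  \<open>\<bar>t\<bar> * e\<close>; on the remaining event, of vanishing probability, by at most
  2.\<close>

lemma clt_perturbed:
  fixes f :: "'w \<Rightarrow> real" and T :: "nat \<Rightarrow> 'a \<Rightarrow> real"
  assumes f: "f \<in> borel_measurable F" "integrable F (\<lambda>w. (f w)\<^sup>2)" "(LINT w|F. f w) = 0"
    and V: "V = (LINT w|F. (f w)\<^sup>2)"
    and T [measurable]: "\<And>n. T n \<in> borel_measurable M"
    and close: "\<And>e. e > 0 \<Longrightarrow> (\<lambda>n. prob {\<omega>\<in>space M. \<bar>T n \<omega> - (\<Sum>i<n. f (W i \<omega>)) / sqrt (real n)\<bar> > e}) \<longlonglongrightarrow> 0"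
  shows "weak_conv_m (\<lambda>n. distr M borel (T n)) (centered_normal V)"
proof (rule levy_continuity)
  have std: "real_distribution std_normal_distribution" by (rule real_dist_normal_dist)
  show "real_distribution (distr M borel (T n))" for n by (rule real_distribution_distr) simp
  have "prob_space (centered_normal V)" unfolding centered_normal_def
    using std by (intro prob_space.prob_space_distr) (auto simp: real_distribution_def)
  then show "real_distribution (centered_normal V)"
    by (auto simp: real_distribution_def real_distribution_axioms_def centered_normal_def)
  fix t :: real
  note [measurable] = f(1)
  have V0: "V \<ge> 0" unfolding V by simp
  define S where "S n \<omega> = (\<Sum>i<n. f (W i \<omega>)) / sqrt (real n)" for n \<omega>
  have [measurable]: "S n \<in> borel_measurable M" for n unfolding S_def by measurable
  have cT: "char (distr M borel G) u = (CLINT \<omega>|M. iexp (u * G \<omega>))" if [measurable]: "G \<in> borel_measurable M" for G u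
    unfolding char_def by (subst integral_distr) auto
  have cN: "char (centered_normal V) t = char std_normal_distribution (sqrt V * t)"
    unfolding char_def centered_normal_def
    by (subst integral_distr) (auto simp: mult_ac)
  have char_S: "(\<lambda>n. char (distr M borel (S n)) t) \<longlonglongrightarrow> char (centered_normal V) t"
  \<comment> \<open>The central limit theorem requires positive variance. For \<open>V = 0\<close>
    the sums vanish almost surely and both characteristic functions are 1.\<close>
  proof (cases "V = 0")
    case True
    have "AE w in F. (f w)\<^sup>2 = 0"
      using integral_nonneg_eq_0_iff_AE[OF f(2)] True V by auto
    then have "AE \<omega> in M. f (W i \<omega>) = 0" for i using AE_W[of "\<lambda>w. f w = 0" i] by auto
    then have "AE \<omega> in M. \<forall>i. f (W i \<omega>) = 0" by (simp add: AE_all_countable)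
    then have S0: "AE \<omega> in M. S n \<omega> = 0" for n by eventually_elim (auto simp: S_def)
    have "char (distr M borel (S n)) t = (CLINT \<omega>|M. 1)" for n
      by (subst cT, simp, intro integral_cong_AE) (use S0[of n] in auto)
    then have "char (distr M borel (S n)) t = 1" for n by (simp add: prob_space)
    then show ?thesis using cN True real_distribution.char_zero[OF std] by simp
  next
    case False
    then have Vp: "V > 0" using V0 by simp
    have "weak_conv_m (\<lambda>n. distr M borel (\<lambda>x. (\<Sum>i<n. f (W i x)) / sqrt (n * (sqrt V)\<^sup>2))) std_normal_distribution"
    proof (rule central_limit_theorem_zero_mean[where \<mu>="distr F borel f"])
      show "indep_vars (\<lambda>i. borel) (\<lambda>i x. f (W i x)) UNIV" by (rule indep_W_compose[OF f(1)])
      show "expectation (\<lambda>x. f (W n x)) = 0" for n using f by (simp add: integral_W)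
      then show "variance (\<lambda>x. f (W n x)) = (sqrt V)\<^sup>2" for n
        using integral_W[of "\<lambda>w. (f w)\<^sup>2" n] f V0 by (simp add: V)
      show "integrable M (\<lambda>x. (f (W n x))\<^sup>2)" for n by (rule integrable_W[OF f(2)])
      show "distr M borel (\<lambda>x. f (W n x)) = distr F borel f" for n
        using distr_distr[OF f(1) W_measurable, of n] by (simp add: ident comp_def)
      show "sqrt V > 0" using Vp by simp
    qed
    \<comment> \<open>Evaluating at \<open>sqrt V * t\<close> undoes the standardization by
      \<open>sqrt V\<close>.\<close>
    from levy_continuity1[OF _ std this, of "sqrt V * t"]
    have "(\<lambda>n. char (distr M borel (\<lambda>x. (\<Sum>i<n. f (W i x)) / sqrt (n * (sqrt V)\<^sup>2))) (sqrt V * t)) \<longlonglongrightarrow> char (centered_normal V) t"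
      unfolding cN by (auto intro!: real_distribution_distr)
    moreover have "char (distr M borel (\<lambda>x. (\<Sum>i<n. f (W i x)) / sqrt (n * (sqrt V)\<^sup>2))) (sqrt V * t) = char (distr M borel (S n)) t" for n
    proof -
      have "sqrt V * t * ((\<Sum>i<n. f (W i x)) / sqrt (n * (sqrt V)\<^sup>2)) = t * S n x" for x
        using Vp V0 by (simp add: S_def real_sqrt_mult)
      then show ?thesis by (subst (1 2) cT) (auto simp: of_real_mult[symmetric] simp del: of_real_mult)
    qed
    ultimately show ?thesis by simp
  qed
  have diff: "norm (char (distr M borel (T n)) t - char (distr M borel (S n)) t) \<le> \<bar>t\<bar> * e + 2 * prob {\<omega>\<in>space M. \<bar>T n \<omega> - S n \<omega>\<bar> > e}"
    if e: "e > 0" for n e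
  proof -
    let ?A = "{\<omega>\<in>space M. \<bar>T n \<omega> - S n \<omega>\<bar> > e}"
    have iT: "integrable M (\<lambda>\<omega>. iexp (t * T n \<omega>))" "integrable M (\<lambda>\<omega>. iexp (t * S n \<omega>))"
      by (auto intro!: integrable_const_bound[where B=1])
    have "norm (char (distr M borel (T n)) t - char (distr M borel (S n)) t) = norm (CLINT \<omega>|M. iexp (t * T n \<omega>) - iexp (t * S n \<omega>))"
      by (subst cT, simp, subst cT, simp, subst Bochner_Integration.integral_diff[OF iT]) (rule refl)
    also have "\<dots> \<le> (LINT \<omega>|M. norm (iexp (t * T n \<omega>) - iexp (t * S n \<omega>)))"
      by (rule integral_norm_bound)
    also have "\<dots> \<le> (LINT \<omega>|M. \<bar>t\<bar> * e + 2 * indicator ?A \<omega>)"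
    proof (rule integral_mono)
      show "integrable M (\<lambda>\<omega>. norm (iexp (t * T n \<omega>) - iexp (t * S n \<omega>)))" using iT by auto
      show "integrable M (\<lambda>\<omega>. \<bar>t\<bar> * e + 2 * indicator ?A \<omega>)"
        by (intro Bochner_Integration.integrable_add integrable_mult_right integrable_const integrable_real_indicator)
          (auto simp: less_top[symmetric])
      fix \<omega> assume w: "\<omega> \<in> space M"
      show "norm (iexp (t * T n \<omega>) - iexp (t * S n \<omega>)) \<le> \<bar>t\<bar> * e + 2 * indicator ?A \<omega>"
      proof (cases "\<omega> \<in> ?A")
        case True
        have "norm (iexp (t * T n \<omega>) - iexp (t * S n \<omega>)) \<le> norm (iexp (t * T n \<omega>)) + norm (iexp (t * S n \<omega>))"
          by (rule norm_triangle_ineq4)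
        also have "\<dots> \<le> 2" by simp
        finally show ?thesis using True e by (simp add: add_increasing)
      next
        case False
        have "iexp (t * T n \<omega>) - iexp (t * S n \<omega>) = iexp (t * S n \<omega>) * (iexp (t * (T n \<omega> - S n \<omega>)) - 1)"
          by (simp add: algebra_simps exp_add[symmetric])
        then have "norm (iexp (t * T n \<omega>) - iexp (t * S n \<omega>)) = norm (iexp (t * (T n \<omega> - S n \<omega>)) - 1)"
          by (simp add: norm_mult)
        also have "\<dots> \<le> \<bar>t * (T n \<omega> - S n \<omega>)\<bar>"
          using iexp_approx1[of "t * (T n \<omega> - S n \<omega>)" 0] by simp
        also have "\<dots> \<le> \<bar>t\<bar> * e" using False w by (auto simp: abs_mult intro!: mult_left_mono)
        finally show ?thesis using False by simp
      qed
    qed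
    also have "\<dots> = \<bar>t\<bar> * e + 2 * prob ?A" 
      by (subst Bochner_Integration.integral_add)
        (auto simp: prob_space less_top[symmetric] intro!: integrable_mult_right integrable_real_indicator)
    finally show ?thesis .
  qed
  have "(\<lambda>n. char (distr M borel (T n)) t - char (distr M borel (S n)) t) \<longlonglongrightarrow> 0"
  proof (rule tendstoI)
    fix \<epsilon> :: real assume eps: "\<epsilon> > 0"
    \<comment> \<open>The added 1 keeps the quotient meaningful at \<open>t = 0\<close>.\<close>
    define e where "e = \<epsilon> / (2 * (\<bar>t\<bar> + 1))"
    have e: "e > 0" using eps by (auto simp: e_def intro!: divide_pos_pos)
    have te: "\<bar>t\<bar> * e \<le> \<epsilon> / 2" using eps by (simp add: e_def field_simps)
    have "\<forall>\<^sub>F n in sequentially. prob {\<omega>\<in>space M. \<bar>T n \<omega> - S n \<omega>\<bar> > e} < \<epsilon> / 4"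
      using close[OF e] eps unfolding S_def by (intro order_tendstoD) auto
    then show "\<forall>\<^sub>F n in sequentially. dist (char (distr M borel (T n)) t - char (distr M borel (S n)) t) 0 < \<epsilon>"
    proof eventually_elim
      case (elim n) then show ?case using diff[OF e, of n] te by simp
    qed
  qed
  from tendsto_add[OF this char_S] show "(\<lambda>n. char (distr M borel (T n)) t) \<longlonglongrightarrow> char (centered_normal V) t" by simp
qed

end

section \<open>The lasso for a fixed sample\<close>

text \<open>Coefficient vectors are functions on all naturals, so minimization takes place in an
  infinite product. Fixing the coordinates from \<open>p\<close> on at 0 makes the box compact by
  Tychonoff's theorem.\<close>

lemma box_attains_min:
  fixes f :: "(nat \<Rightarrow> real) \<Rightarrow> real"
  assumes "continuous_on UNIV f" "closed S" "x0 \<in> S"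
    and "S \<subseteq> {\<rho>. (\<forall>j<p. \<bar>\<rho> j\<bar> \<le> B) \<and> (\<forall>j\<ge>p. \<rho> j = 0)}"
  obtains x where "x \<in> S" "\<And>y. y \<in> S \<Longrightarrow> f x \<le> f y"
proof -
  let ?K = "PiE UNIV (\<lambda>j. if j < p then {-B..B} else {0::real})"
  have "compactin (product_topology (\<lambda>_::nat. euclidean) UNIV) ?K"
    by (subst compactin_PiE) auto
  then have K: "compact ?K" by (simp add: euclidean_product_topology)
  have "S = ?K \<inter> S" using assms(4) by (fastforce simp: PiE_def Pi_def abs_le_iff split: if_splits)
  then have "compact S" using compact_Int_closed[OF K assms(2)] by simp
  then obtain x where "x \<in> S" "\<And>y. y \<in> S \<Longrightarrow> f x \<le> f y"
    using continuous_attains_inf[of S f] assms(1,3) continuous_on_subset by blast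
  then show ?thesis using that by blast
qed

section \<open>The lasso criterion: expansion, existence of a minimizer, basic inequality\<close>

lemma quad_form_add:
  assumes "\<And>j k. j < p \<Longrightarrow> k < p \<Longrightarrow> A j k = A k j"
  shows "quad_form p A (\<lambda>j. x j + t * y j) =
    quad_form p A x + 2 * t * (\<Sum>j<p. (\<Sum>k<p. A j k * x k) * y j) + t\<^sup>2 * quad_form p A y"
proof -
  have sw: "(\<Sum>j<p. \<Sum>k<p. x j * A j k * y k) = (\<Sum>j<p. (\<Sum>k<p. A j k * x k) * y j)"
    by (subst sum.swap) (intro sum.cong, auto simp: sum_distrib_right sum_distrib_left assms mult_ac)
  have sw': "(\<Sum>j<p. \<Sum>k<p. y j * A j k * x k) = (\<Sum>j<p. (\<Sum>k<p. A j k * x k) * y j)"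
    by (intro sum.cong) (auto simp: sum_distrib_right sum_distrib_left mult_ac)
  have "quad_form p A (\<lambda>j. x j + t * y j) = quad_form p A x
      + t * (\<Sum>j<p. \<Sum>k<p. x j * A j k * y k) + t * (\<Sum>j<p. \<Sum>k<p. y j * A j k * x k)
      + t\<^sup>2 * quad_form p A y"
  proof -
    have "quad_form p A (\<lambda>j. x j + t * y j) = (\<Sum>j<p. \<Sum>k<p. x j * A j k * x k
        + t * (x j * A j k * y k) + t * (y j * A j k * x k) + t\<^sup>2 * (y j * A j k * y k))"
      unfolding quad_form_def by (intro sum.cong refl) (simp add: algebra_simps power2_eq_square)
    then show ?thesis by (simp add: sum.distrib sum_distrib_left[symmetric] quad_form_def)
  qed
  then show ?thesis unfolding sw sw' by simp
qed

lemma quad_form_cong: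
  assumes "\<And>j. j < p \<Longrightarrow> x j = y j"
  shows "quad_form p A x = quad_form p A y"
  unfolding quad_form_def by (intro sum.cong refl) (simp add: assms)

lemma lasso_objective_cong:
  assumes "\<And>j. j < p \<Longrightarrow> x j = y j"
  shows "lasso_objective p r mh A x = lasso_objective p r mh A y"
proof -
  have "quad_form p A x = quad_form p A y" by (rule quad_form_cong[OF assms])
  moreover have "(\<Sum>j<p. mh j * x j) = (\<Sum>j<p. mh j * y j)" "(\<Sum>j<p. \<bar>x j\<bar>) = (\<Sum>j<p. \<bar>y j\<bar>)"
    by (intro sum.cong refl; simp add: assms)+
  ultimately show ?thesis by (simp add: lasso_objective_def)
qed

lemma lasso_objective_diff:
  assumes "\<And>j k. j < p \<Longrightarrow> k < p \<Longrightarrow> A j k = A k j"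
  shows "lasso_objective p r mh A y - lasso_objective p r mh A x =
    quad_form p A (\<lambda>j. y j - x j) - 2 * (\<Sum>j<p. (mh j - (\<Sum>k<p. A j k * x k)) * (y j - x j))
    + 2 * r * ((\<Sum>j<p. \<bar>y j\<bar>) - (\<Sum>j<p. \<bar>x j\<bar>))"
proof -
  have "quad_form p A y = quad_form p A (\<lambda>j. x j + 1 * (y j - x j))" by simp
  also have "\<dots> = quad_form p A x + 2 * (\<Sum>j<p. (\<Sum>k<p. A j k * x k) * (y j - x j)) + quad_form p A (\<lambda>j. y j - x j)"
    by (subst quad_form_add[OF assms]) auto
  finally have q: "quad_form p A y = \<dots>" .
  have "(\<Sum>j<p. (mh j - (\<Sum>k<p. A j k * x k)) * (y j - x j)) =
    (\<Sum>j<p. mh j * y j) - (\<Sum>j<p. mh j * x j) - (\<Sum>j<p. (\<Sum>k<p. A j k * x k) * (y j - x j))"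
    by (simp add: left_diff_distrib right_diff_distrib sum_subtractf)
  then show ?thesis unfolding lasso_objective_def q by (simp add: algebra_simps)
qed

lemma continuous_on_lasso_objective:
  "continuous_on UNIV (lasso_objective p r mh A)"
proof -
  have cc: "continuous_on UNIV (\<lambda>\<rho>::nat\<Rightarrow>real. \<rho> j)" for j by (rule continuous_on_product_coordinates)
  show ?thesis unfolding lasso_objective_def[abs_def] quad_form_def by (intro continuous_intros cc)
qed

text \<open>The lasso coefficients are assumed to minimize only when a minimizer exists, so
  existence has to be proved. A point \<open>x\<close> where the gradient of the smooth part is
  below \<open>r\<close> makes the criterion coercive: the penalty outweighs the linear term at rate
  \<open>r - q\<close>, and the quadratic part is nonnegative.\<close>

lemma lasso_minimizer_exists:
  assumes sym: "\<And>j k. j < p \<Longrightarrow> k < p \<Longrightarrow> A j k = A k j"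
    and psd: "\<And>x. quad_form p A x \<ge> 0"
    and le: "\<And>j. j < p \<Longrightarrow> \<bar>mh j - (\<Sum>k<p. A j k * x k)\<bar> \<le> q" and "q < r"
  shows "\<exists>\<rho>. is_arg_min (lasso_objective p r mh A) (\<lambda>_. True) \<rho>"
proof -
  let ?O = "lasso_objective p r mh A"
  have coercive: "?O y \<ge> ?O x - 2 * (q + r) * (\<Sum>j<p. \<bar>x j\<bar>) + 2 * (r - q) * (\<Sum>j<p. \<bar>y j\<bar>)" for y
  proof -
    have "(mh j - (\<Sum>k<p. A j k * x k)) * (y j - x j) \<le> q * \<bar>y j\<bar> + q * \<bar>x j\<bar>" if "j < p" for j
    proof -
      have "(mh j - (\<Sum>k<p. A j k * x k)) * (y j - x j) \<le> \<bar>mh j - (\<Sum>k<p. A j k * x k)\<bar> * \<bar>y j - x j\<bar>"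
        by (metis abs_ge_self abs_mult)
      also have "\<dots> \<le> q * (\<bar>y j\<bar> + \<bar>x j\<bar>)" by (intro mult_mono le that) (use le[OF that] in auto)
      finally show ?thesis by (simp add: algebra_simps)
    qed
    then have "(\<Sum>j<p. (mh j - (\<Sum>k<p. A j k * x k)) * (y j - x j)) \<le> (\<Sum>j<p. q * \<bar>y j\<bar> + q * \<bar>x j\<bar>)"
      by (intro sum_mono) auto
    also have "\<dots> = q * (\<Sum>j<p. \<bar>y j\<bar>) + q * (\<Sum>j<p. \<bar>x j\<bar>)" by (simp add: sum.distrib sum_distrib_left)
    finally have *: "(\<Sum>j<p. (mh j - (\<Sum>k<p. A j k * x k)) * (y j - x j)) \<le> q * (\<Sum>j<p. \<bar>y j\<bar>) + q * (\<Sum>j<p. \<bar>x j\<bar>)" .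
    define Z where "Z = (\<Sum>j<p. (mh j - (\<Sum>k<p. A j k * x k)) * (y j - x j))"
    have "?O y - ?O x = quad_form p A (\<lambda>j. y j - x j) - 2 * Z + 2 * r * ((\<Sum>j<p. \<bar>y j\<bar>) - (\<Sum>j<p. \<bar>x j\<bar>))"
      unfolding Z_def by (rule lasso_objective_diff[where p=p and A=A and r=r and mh=mh and y=y and x=x, OF sym])
    then show ?thesis
      using * psd[of "\<lambda>j. y j - x j"] unfolding Z_def[symmetric] by (simp add: algebra_simps)
  qed
  \<comment> \<open>Outside the box of radius \<open>B\<close> the growth term is at least
    \<open>2 * D\<close>, so the criterion is nonnegative there and cannot beat the zero vector,
    which lies in the box.\<close>
  define D where "D = \<bar>?O x\<bar> + \<bar>2 * (q + r) * (\<Sum>j<p. \<bar>x j\<bar>)\<bar>"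
  define B where "B = D / (r - q)"
  have D0: "D \<ge> 0" unfolding D_def by simp
  have B0: "B \<ge> 0" using D0 \<open>q < r\<close> unfolding B_def by simp
  let ?S = "{\<rho>. (\<forall>j<p. \<bar>\<rho> j\<bar> \<le> B) \<and> (\<forall>j\<ge>p. \<rho> j = (0::real))}"
  have cc: "continuous_on UNIV (\<lambda>\<rho>::nat\<Rightarrow>real. \<rho> j)" for j by (rule continuous_on_product_coordinates)
  have "?S = (\<Inter>j\<in>{..<p}. {\<rho>. \<bar>\<rho> j\<bar> \<le> B}) \<inter> (\<Inter>j\<in>{p..}. {\<rho>. \<rho> j = (0::real)})" by auto
  moreover have "closed \<dots>"
    by (intro closed_Int closed_INT ballI closed_Collect_le closed_Collect_eq continuous_intros cc)
  ultimately have cl: "closed ?S" by simp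
  have z: "(\<lambda>_. 0) \<in> ?S" using B0 by auto
  obtain z where z1: "z \<in> ?S" and z2: "\<And>y. y \<in> ?S \<Longrightarrow> ?O z \<le> ?O y"
    by (rule box_attains_min[OF continuous_on_lasso_objective[of p r mh A] cl z, of p B]) blast+
  have "?O z \<le> ?O y" for y
  proof (cases "\<forall>j<p. \<bar>y j\<bar> \<le> B")
    case True
    have "?O y = ?O (\<lambda>j. if j < p then y j else 0)" by (rule lasso_objective_cong) simp
    moreover have "?O z \<le> \<dots>" by (rule z2) (use True in auto)
    ultimately show ?thesis by simp
  next
    case False
    then obtain j where j: "j < p" "\<bar>y j\<bar> > B" by auto
    have "\<bar>y j\<bar> \<le> (\<Sum>j<p. \<bar>y j\<bar>)" using j by (intro member_le_sum) auto
    then have "(r - q) * B \<le> (r - q) * (\<Sum>j<p. \<bar>y j\<bar>)" using j \<open>q < r\<close> by (intro mult_left_mono) auto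
    then have "D \<le> (r - q) * (\<Sum>j<p. \<bar>y j\<bar>)" using \<open>q < r\<close> by (simp add: B_def)
    then have "?O y \<ge> 0" using coercive[of y] D0 unfolding D_def by linarith
    moreover have "?O z \<le> ?O (\<lambda>_. 0)" by (rule z2[OF z])
    moreover have "?O (\<lambda>_. 0) = 0" by (simp add: lasso_objective_def quad_form_def)
    ultimately show ?thesis by simp
  qed
  then show ?thesis by (auto simp: is_arg_min_def not_less intro!: exI[of _ z])
qed

text \<open>The noise costs \<open>r\<close> times the total absolute deviation. The penalty
  difference costs at most \<open>2 * r\<close> per unit on the support \<open>J\<close> of
  \<open>x\<close> and gains \<open>2 * r\<close> off it, where \<open>x\<close> vanishes. The
  balance of \<open>3 * r\<close> against \<open>r\<close> is the source of the factor 3 in the cone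
  condition.\<close>

lemma lasso_basic_inequality:
  assumes sym: "\<And>j k. j < p \<Longrightarrow> k < p \<Longrightarrow> A j k = A k j"
    and le: "\<And>j. j < p \<Longrightarrow> \<bar>mh j - (\<Sum>k<p. A j k * x k)\<bar> \<le> r / 2"
    and opt: "lasso_objective p r mh A y \<le> lasso_objective p r mh A x"
    and J: "J = {j. j < p \<and> x j \<noteq> 0}"
  shows "quad_form p A (\<lambda>j. y j - x j) \<le>
    3 * r * (\<Sum>j\<in>J. \<bar>y j - x j\<bar>) - r * (\<Sum>j\<in>{..<p} - J. \<bar>y j - x j\<bar>)"
\<comment> \<open>That \<open>r\<close> is nonnegative is read off from the gradient bound at
  coordinate 0, which exists only for \<open>p > 0\<close>.\<close>
proof (cases "p = 0")
  case True then show ?thesis by (simp add: J quad_form_def)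
next
  case False
  have r0: "r \<ge> 0" using le[of 0] False by linarith
  have split: "(\<Sum>j<p. f j) = (\<Sum>j\<in>J. f j) + (\<Sum>j\<in>{..<p} - J. f j)" for f :: "nat \<Rightarrow> real"
    by (subst sum.subset_diff[of J]) (auto simp: J)
  have "(mh j - (\<Sum>k<p. A j k * x k)) * (y j - x j) \<le> r / 2 * \<bar>y j - x j\<bar>" if "j < p" for j
  proof -
    have "(mh j - (\<Sum>k<p. A j k * x k)) * (y j - x j) \<le> \<bar>mh j - (\<Sum>k<p. A j k * x k)\<bar> * \<bar>y j - x j\<bar>"
      by (metis abs_ge_self abs_mult)
    also have "\<dots> \<le> r / 2 * \<bar>y j - x j\<bar>" by (intro mult_right_mono le that) auto
    finally show ?thesis .
  qed
  then have 1: "2 * (\<Sum>j<p. (mh j - (\<Sum>k<p. A j k * x k)) * (y j - x j)) \<le> r * (\<Sum>j<p. \<bar>y j - x j\<bar>)"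
    unfolding sum_distrib_left by (intro sum_mono) fastforce
  have 2: "(\<Sum>j<p. \<bar>x j\<bar>) - (\<Sum>j<p. \<bar>y j\<bar>) \<le> (\<Sum>j\<in>J. \<bar>y j - x j\<bar>) - (\<Sum>j\<in>{..<p} - J. \<bar>y j - x j\<bar>)"
  proof -
    have "(\<Sum>j\<in>J. \<bar>x j\<bar>) - (\<Sum>j\<in>J. \<bar>y j\<bar>) \<le> (\<Sum>j\<in>J. \<bar>y j - x j\<bar>)"
      unfolding sum_subtractf[symmetric] by (intro sum_mono) auto
    moreover have "(\<Sum>j\<in>{..<p} - J. \<bar>x j\<bar>) = 0" by (auto simp: J)
    moreover have "(\<Sum>j\<in>{..<p} - J. \<bar>y j\<bar>) = (\<Sum>j\<in>{..<p} - J. \<bar>y j - x j\<bar>)" by (auto simp: J intro!: sum.cong)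
    ultimately show ?thesis using split[of "\<lambda>j. \<bar>x j\<bar>"] split[of "\<lambda>j. \<bar>y j\<bar>"] by linarith
  qed
  have 3: "2 * r * ((\<Sum>j<p. \<bar>x j\<bar>) - (\<Sum>j<p. \<bar>y j\<bar>)) \<le>
    2 * r * ((\<Sum>j\<in>J. \<bar>y j - x j\<bar>) - (\<Sum>j\<in>{..<p} - J. \<bar>y j - x j\<bar>))"
    using 2 r0 by (intro mult_left_mono) auto
  have "quad_form p A (\<lambda>j. y j - x j) \<le> r * (\<Sum>j<p. \<bar>y j - x j\<bar>) +
    2 * r * ((\<Sum>j\<in>J. \<bar>y j - x j\<bar>) - (\<Sum>j\<in>{..<p} - J. \<bar>y j - x j\<bar>))"
  proof -
    have *: "a = b - 2 * c + e \<Longrightarrow> a \<le> 0 \<Longrightarrow> 2 * c \<le> f \<Longrightarrow> - e \<le> g \<Longrightarrow> b \<le> f + g" for a b c e f g :: real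
      by linarith
    show ?thesis
      by (rule *[OF lasso_objective_diff[where p=p and A=A and r=r and mh=mh and y=y and x=x, OF sym]]) (use opt 1 3 in \<open>auto simp: right_diff_distrib\<close>)
  qed
  then show ?thesis by (simp add: split[of "\<lambda>j. \<bar>y j - x j\<bar>"] algebra_simps)
qed

text \<open>
  Cauchy--Schwarz on \<open>J\<close> turns the restricted eigenvalue into a bound for the coordinates in \<open>J\<close>. At
  most \<open>k\<close> of the others exceed \<open>1/k\<close> times their absolute sum; adding these to \<open>J\<close> keeps the cone
  condition, and what remains is small in both sum and maximum.
\<close>

lemma restricted_eigenvalue_sum_squares:
  fixes \<delta> :: "nat \<Rightarrow> real"
  assumes re: "restricted_eigenvalue_ge p s c A" and "c > 0" "r > 0"
    and q: "quad_form p A \<delta> \<le> 3 * r * (\<Sum>j\<in>J. \<bar>\<delta> j\<bar>) - r * (\<Sum>j\<in>{..<p} - J. \<bar>\<delta> j\<bar>)"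
    and psd: "quad_form p A \<delta> \<ge> 0"
    and J: "J \<subseteq> {..<p}" "card J \<le> k" and k: "k \<ge> 1" "2 * k \<le> s"
  shows "(\<Sum>j<p. (\<delta> j)\<^sup>2) \<le> 90 * r\<^sup>2 * real k / c\<^sup>2"
proof -
  have fJ: "finite J" using J finite_subset by blast
  define T where "T = (\<Sum>j\<in>{..<p} - J. \<bar>\<delta> j\<bar>)"
  define U where "U = (\<Sum>j\<in>J. \<bar>\<delta> j\<bar>)"
  define E where "E = (\<Sum>j\<in>J. (\<delta> j)\<^sup>2)"
  have T0: "T \<ge> 0" and U0: "U \<ge> 0" and E0: "E \<ge> 0" unfolding T_def U_def E_def by (auto intro!: sum_nonneg)
  have "r * T \<le> r * (3 * U)" using q psd by (simp add: T_def U_def algebra_simps)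
  then have cone: "T \<le> 3 * U" using \<open>r > 0\<close> by simp
  have "r * T \<ge> 0" using T0 \<open>r > 0\<close> by simp
  then have q3: "quad_form p A \<delta> \<le> 3 * r * U" using q unfolding T_def U_def by linarith
  have CS: "U\<^sup>2 \<le> real k * E"
  proof -
    have "U\<^sup>2 \<le> real (card J) * E"
      using Cauchy_Schwarz_ineq_sum[of "\<lambda>_. 1" "\<lambda>j. \<bar>\<delta> j\<bar>" J] by (simp add: U_def E_def)
    also have "\<dots> \<le> real k * E" using J E0 by (intro mult_right_mono) auto
    finally show ?thesis .
  qed
  show ?thesis
  \<comment> \<open>The restricted eigenvalue condition speaks only of vectors that are nonzero on
    \<open>J\<close>. If \<open>\<delta>\<close> vanishes on \<open>J\<close>, the cone condition
    makes it vanish everywhere.\<close>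
  proof (cases "\<exists>j\<in>J. \<delta> j \<noteq> 0")
    case False
    then have "U = 0" by (simp add: U_def)
    then have "T = 0" using cone T0 by simp
    then have "\<And>j. j \<in> {..<p} - J \<Longrightarrow> \<delta> j = 0" unfolding T_def by (subst (asm) sum_nonneg_eq_0_iff) auto
    then have "\<And>j. j < p \<Longrightarrow> \<delta> j = 0" using False by auto
    then have "(\<Sum>j<p. (\<delta> j)\<^sup>2) = 0" by simp
    then show ?thesis by simp
  next
    case True
    then obtain j0 where j0: "j0 \<in> J" "\<delta> j0 \<noteq> 0" by auto
    have reE: "c * (\<Sum>j\<in>J'. (\<delta> j)\<^sup>2) \<le> quad_form p A \<delta>"
      if J': "J \<subseteq> J'" "J' \<subseteq> {..<p}" "card J' \<le> s" for J'
    proof -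
      have fJ': "finite J'" using J' finite_subset by blast
      have "(\<Sum>j\<in>{..<p} - J'. \<bar>\<delta> j\<bar>) \<le> T" unfolding T_def using J' by (intro sum_mono2) auto
      also have "\<dots> \<le> 3 * U" by (rule cone)
      also have "\<dots> \<le> 3 * (\<Sum>j\<in>J'. \<bar>\<delta> j\<bar>)" unfolding U_def using J' fJ' by (intro mult_left_mono sum_mono2) auto
      finally have "c \<le> quad_form p A \<delta> / (\<Sum>j\<in>J'. (\<delta> j)\<^sup>2)"
        using re J' j0 unfolding restricted_eigenvalue_ge_def by blast
      moreover have "(\<Sum>j\<in>J'. (\<delta> j)\<^sup>2) > 0" using j0 J' fJ' by (intro sum_pos2[of _ j0]) auto
      ultimately show ?thesis by (simp add: pos_le_divide_eq)
    qed
    have cE: "c * E \<le> 3 * r * U" using reE[of J] J k q3 unfolding E_def by force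
    \<comment> \<open>Combines \<open>c * E \<le> 3 * r * U\<close> with
      \<open>U\<^sup>2 \<le> real k * E\<close> and cancels one factor \<open>U\<close>.\<close>
    have Ubd: "U \<le> 3 * r * real k / c"
    proof -
      have "c * U\<^sup>2 \<le> c * (real k * E)" using CS \<open>c > 0\<close> by simp
      also have "\<dots> \<le> real k * (3 * r * U)" using mult_left_mono[OF cE, of "real k"] by (simp add: mult_ac)
      finally have "(c * U) * U \<le> (3 * r * real k) * U" by (simp add: power2_eq_square mult_ac)
      then have "U = 0 \<or> c * U \<le> 3 * r * real k" using U0 by (simp add: mult_le_cancel_right) linarith
      then show ?thesis using \<open>c > 0\<close> \<open>r > 0\<close> by (auto simp: pos_le_divide_eq mult.commute)
    qed
    have qb: "quad_form p A \<delta> \<le> 9 * r\<^sup>2 * real k / c"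
    proof -
      have "3 * r * U \<le> 3 * r * (3 * r * real k / c)" using Ubd \<open>r > 0\<close> by (intro mult_left_mono) auto
      then show ?thesis using q3 by (simp add: power2_eq_square)
    qed
    have Tb: "T \<le> 9 * r * real k / c" using cone Ubd by simp
    define H where "H = {j\<in>{..<p} - J. \<bar>\<delta> j\<bar> > T / real k}"
    have fH: "finite H" unfolding H_def by auto
    have cH: "card H \<le> k"
    proof (cases "H = {}")
      case False
      have "real (card H) * (T / real k) = (\<Sum>j\<in>H. T / real k)" by simp
      also have "\<dots> < (\<Sum>j\<in>H. \<bar>\<delta> j\<bar>)" using False fH by (intro sum_strict_mono) (auto simp: H_def)
      also have "\<dots> \<le> T" unfolding T_def by (intro sum_mono2) (auto simp: H_def)
      finally have *: "real (card H) * T < T * real k" using k by (simp add: pos_divide_less_eq)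
      then have "T > 0" using T0 by (cases "T = 0") auto
      then show ?thesis using * by (simp add: mult.commute)
    qed auto
    have "card (J \<union> H) \<le> s" using card_Un_le[of J H] cH J k by linarith
    then have 1: "c * (\<Sum>j\<in>J \<union> H. (\<delta> j)\<^sup>2) \<le> 9 * r\<^sup>2 * real k / c"
      using reE[of "J \<union> H"] J qb by (force simp: H_def)
    then have 1: "(\<Sum>j\<in>J \<union> H. (\<delta> j)\<^sup>2) \<le> 9 * r\<^sup>2 * real k / c\<^sup>2"
      using \<open>c > 0\<close> by (simp add: power2_eq_square field_simps)
    have "(\<Sum>j\<in>{..<p} - (J \<union> H). (\<delta> j)\<^sup>2) \<le> (\<Sum>j\<in>{..<p} - (J \<union> H). T / real k * \<bar>\<delta> j\<bar>)"
    proof (rule sum_mono)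
      fix j assume "j \<in> {..<p} - (J \<union> H)"
      then have "\<bar>\<delta> j\<bar> \<le> T / real k" by (auto simp: H_def)
      then have "\<bar>\<delta> j\<bar> * \<bar>\<delta> j\<bar> \<le> T / real k * \<bar>\<delta> j\<bar>" by (rule mult_right_mono) simp
      then show "(\<delta> j)\<^sup>2 \<le> T / real k * \<bar>\<delta> j\<bar>" by (simp add: power2_eq_square)
    qed
    also have "\<dots> = T / real k * (\<Sum>j\<in>{..<p} - (J \<union> H). \<bar>\<delta> j\<bar>)" by (simp add: sum_distrib_left)
    also have "\<dots> \<le> T / real k * T" unfolding T_def[unfolded atomize_eq] using T0
      by (intro mult_left_mono) (auto simp: T_def intro!: sum_mono2)
    also have "\<dots> \<le> (9 * r * real k / c) / real k * (9 * r * real k / c)"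
      using Tb T0 \<open>c > 0\<close> \<open>r > 0\<close> by (intro mult_mono divide_right_mono) auto
    also have "\<dots> = 81 * r\<^sup>2 * real k / c\<^sup>2" using k by (simp add: power2_eq_square)
    finally have 2: "(\<Sum>j\<in>{..<p} - (J \<union> H). (\<delta> j)\<^sup>2) \<le> 81 * r\<^sup>2 * real k / c\<^sup>2" .
    \<comment> \<open>The constant 90 is 9 from the enlarged index set plus 81, the square of the 9
      in the bound \<open>Tb\<close> for the absolute sum off \<open>J\<close>.\<close>
    have "(\<Sum>j<p. (\<delta> j)\<^sup>2) = (\<Sum>j\<in>J \<union> H. (\<delta> j)\<^sup>2) + (\<Sum>j\<in>{..<p} - (J \<union> H). (\<delta> j)\<^sup>2)"
      using J by (subst sum.subset_diff[of "J \<union> H"]) (auto simp: H_def)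
    also have "\<dots> \<le> 9 * r\<^sup>2 * real k / c\<^sup>2 + 81 * r\<^sup>2 * real k / c\<^sup>2" by (rule add_mono[OF 1 2])
    also have "\<dots> = 90 * r\<^sup>2 * real k / c\<^sup>2" by (simp add: field_simps)
    finally show ?thesis .
  qed
qed

text \<open>First-order condition along a line; it serves both the maximizer of a Rayleigh quotient
  and the projections onto a subspace.\<close>

lemma linear_coeff_zero_of_nonneg:
  fixes a b :: real
  assumes "\<And>t. 2 * t * a + t\<^sup>2 * b \<ge> 0"
  shows "a = 0"
proof (rule ccontr)
  assume "a \<noteq> 0"
  \<comment> \<open>Opposite in sign to \<open>a\<close>, and small enough that the quadratic term
    offsets at most half of the negative linear term.\<close>
  define t where "t = - a / (\<bar>b\<bar> + 1)"
  have p: "\<bar>b\<bar> + 1 > 0" by linarith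
  have "t\<^sup>2 * b \<le> t\<^sup>2 * (\<bar>b\<bar> + 1)" by (intro mult_left_mono) auto
  also have "\<dots> = - t * a" using p by (simp add: t_def power2_eq_square)
  finally have "2 * t * a - t * a \<ge> 0" using assms[of t] by linarith
  moreover have "t * a < 0" using \<open>a \<noteq> 0\<close> p by (simp add: t_def mult_neg_pos zero_less_mult_iff not_sum_squares_lt_zero less_divide_eq divide_less_0_iff power2_eq_square[symmetric])
  ultimately show False by linarith
qed

text \<open>A maximizer of the quadratic form on the unit sphere is an eigenvector, by perturbing it
  in each coordinate. Its value is therefore both the largest Rayleigh quotient and an eigenvalue,
  which the hypothesis bounds.\<close>

lemma quad_form_le_of_spectrum:
  assumes sym: "\<And>j k. j < p \<Longrightarrow> k < p \<Longrightarrow> A j k = A k j"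
    and spec: "\<And>k. k \<in> spectrum (mat p p (\<lambda>(j, k). A j k)) \<Longrightarrow> k \<le> (C::real)"
    and C: "C \<ge> 0"
  shows "quad_form p A x \<le> C * (\<Sum>j<p. (x j)\<^sup>2)"
proof (cases "p = 0")
  case True then show ?thesis by (simp add: quad_form_def)
next
  case False
  let ?S = "{\<rho>. (\<forall>j\<ge>p. \<rho> j = (0::real)) \<and> (\<Sum>j<p. (\<rho> j)\<^sup>2) = 1}"
  have cc: "continuous_on UNIV (\<lambda>\<rho>::nat\<Rightarrow>real. \<rho> j)" for j by (rule continuous_on_product_coordinates)
  have "?S = (\<Inter>j\<in>{p..}. {\<rho>. \<rho> j = (0::real)}) \<inter> {\<rho>. (\<Sum>j<p. (\<rho> j)\<^sup>2) = 1}" by auto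
  moreover have "closed \<dots>"
    by (auto intro!: closed_Int closed_INT closed_Collect_eq continuous_intros cc)
  ultimately have cl: "closed ?S" by simp
  have e0: "(\<lambda>j. if j = 0 then 1 else 0) \<in> ?S"
  proof -
    have "(\<Sum>j<p. (if j = 0 then 1 else 0::real)\<^sup>2) = (\<Sum>j<p. if j = 0 then 1 else 0)" by (intro sum.cong) auto
    then show ?thesis using False by (auto simp: sum.delta)
  qed
  have cont: "continuous_on UNIV (\<lambda>\<rho>. - quad_form p A \<rho>)"
    unfolding quad_form_def by (intro continuous_intros cc)
  have sub: "?S \<subseteq> {\<rho>. (\<forall>j<p. \<bar>\<rho> j\<bar> \<le> 1) \<and> (\<forall>j\<ge>p. \<rho> j = 0)}"
  proof clarsimp
    fix \<rho> :: "nat \<Rightarrow> real" and j assume "(\<Sum>j<p. (\<rho> j)\<^sup>2) = 1" "j < p"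
    then have "(\<rho> j)\<^sup>2 \<le> 1" using member_le_sum[of j "{..<p}" "\<lambda>j. (\<rho> j)\<^sup>2"] by auto
    then show "\<bar>\<rho> j\<bar> \<le> 1" by (simp add: abs_square_le_1)
  qed
  obtain z where z: "z \<in> ?S" and "\<And>y. y \<in> ?S \<Longrightarrow> - quad_form p A z \<le> - quad_form p A y"
    by (rule box_attains_min[OF cont cl e0 sub]) blast
  then have zmax: "\<And>y. y \<in> ?S \<Longrightarrow> quad_form p A y \<le> quad_form p A z" by simp
  define \<mu> where "\<mu> = quad_form p A z"
  have hom: "quad_form p A (\<lambda>j. a * y j) = a\<^sup>2 * quad_form p A y" for a y
    unfolding quad_form_def sum_distrib_left by (intro sum.cong refl) (simp add: power2_eq_square mult_ac)
  have le: "quad_form p A y \<le> \<mu> * (\<Sum>j<p. (y j)\<^sup>2)" for y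
  proof (cases "(\<Sum>j<p. (y j)\<^sup>2) = 0")
    case True
    then have "\<And>j. j < p \<Longrightarrow> y j = 0" by (subst (asm) sum_nonneg_eq_0_iff) auto
    then show ?thesis by (simp add: quad_form_def)
  next
    case False
    define n where "n = (\<Sum>j<p. (y j)\<^sup>2)"
    have n: "n > 0" using False sum_nonneg[of "{..<p}" "\<lambda>j. (y j)\<^sup>2"] by (simp add: n_def less_le)
    let ?y = "\<lambda>j. (1 / sqrt n) * (if j < p then y j else 0)"
    have "(\<Sum>j<p. (?y j)\<^sup>2) = (1 / n) * n"
      using n by (simp add: n_def sum_distrib_left power_divide sum_divide_distrib)
    then have "?y \<in> ?S" using n by auto
    from zmax[OF this] have "(1 / sqrt n)\<^sup>2 * quad_form p A (\<lambda>j. if j < p then y j else 0) \<le> \<mu>"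
      unfolding hom \<mu>_def .
    moreover have "quad_form p A (\<lambda>j. if j < p then y j else 0) = quad_form p A y" by (rule quad_form_cong) simp
    ultimately show ?thesis using n by (simp add: n_def[symmetric] power_divide field_simps)
  qed
  have eig: "(\<Sum>k<p. A j k * z k) = \<mu> * z j" if j: "j < p" for j
  proof -
    let ?e = "\<lambda>i. if i = j then 1 else 0 :: real"
    have "\<mu> * z j - (\<Sum>k<p. A j k * z k) = 0"
    \<comment> \<open>\<open>\<mu>\<close> times the squared length minus the quadratic form is
      nonnegative everywhere and 0 at \<open>z\<close>. Along the \<open>j\<close>-th axis through
      \<open>z\<close> it is the polynomial in \<open>t\<close> below.\<close>
    proof (rule linear_coeff_zero_of_nonneg[where b = "\<mu> - quad_form p A ?e"])
      fix t :: real
      have "(\<Sum>i<p. (z i + t * ?e i)\<^sup>2) = (\<Sum>i<p. (z i)\<^sup>2 + (if i = j then 2 * t * z i + t\<^sup>2 else 0))"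
        by (intro sum.cong) (auto simp: power2_sum)
      also have "\<dots> = 1 + 2 * t * z j + t\<^sup>2" using z j by (simp add: sum.distrib sum.delta)
      finally have n: "(\<Sum>i<p. (z i + t * ?e i)\<^sup>2) = 1 + 2 * t * z j + t\<^sup>2" .
      have "(\<Sum>i<p. (\<Sum>k<p. A i k * z k) * ?e i) = (\<Sum>i<p. if i = j then (\<Sum>k<p. A i k * z k) else 0)"
        by (intro sum.cong) auto
      also have "\<dots> = (\<Sum>k<p. A j k * z k)" using j by (simp add: sum.delta)
      finally have l: "(\<Sum>i<p. (\<Sum>k<p. A i k * z k) * ?e i) = (\<Sum>k<p. A j k * z k)" .
      show "0 \<le> 2 * t * (\<mu> * z j - (\<Sum>k<p. A j k * z k)) + t\<^sup>2 * (\<mu> - quad_form p A ?e)"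
        using le[of "\<lambda>i. z i + t * ?e i"]
          quad_form_add[where p=p and A=A and x=z and t=t and y="?e", OF sym]
        unfolding n l \<mu>_def[symmetric] by (simp add: algebra_simps)
    qed
    then show ?thesis by simp
  qed
  have "eigenvector (mat p p (\<lambda>(j, k). A j k)) (vec p z) \<mu>"
    unfolding eigenvector_def
  proof (intro conjI)
    show "vec p z \<noteq> 0\<^sub>v (dim_row (mat p p (\<lambda>(j, k). A j k)))"
    proof
      assume "vec p z = 0\<^sub>v (dim_row (mat p p (\<lambda>(j, k). A j k)))"
      then have "\<And>j. j < p \<Longrightarrow> z j = 0" by (metis dim_row_mat(1) index_vec index_zero_vec(1))
      then show False using z by simp
    qed
    show "mat p p (\<lambda>(j, k). A j k) *\<^sub>v vec p z = \<mu> \<cdot>\<^sub>v vec p z"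
      by (rule eq_vecI) (auto simp: scalar_prod_def eig[symmetric] lessThan_atLeast0)
  qed auto
  then have "\<mu> \<in> spectrum (mat p p (\<lambda>(j, k). A j k))" by (auto simp: spectrum_def eigenvalue_def)
  then have "\<mu> \<le> C" by (rule spec)
  then have "\<mu> * (\<Sum>j<p. (x j)\<^sup>2) \<le> C * (\<Sum>j<p. (x j)\<^sup>2)" by (intro mult_right_mono) (auto intro!: sum_nonneg)
  then show ?thesis using le[of x] by simp
qed

text \<open>The criterion it serves counts nonzero coefficients and is therefore discontinuous;
  minimizing up to a slack \<open>e\<close> needs no compactness.\<close>

lemma near_minimizer:
  fixes f :: "'b \<Rightarrow> real"
  assumes "\<And>x. f x \<ge> 0" "e > 0"
  obtains x where "\<And>y. f x \<le> f y + e"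
proof -
  have bdd: "bdd_below (range f)" using assms by (auto intro!: bdd_belowI[of _ 0])
  have "(INF x. f x) < (INF x. f x) + e" using assms by simp
  then obtain x where x: "f x < (INF x. f x) + e" using cINF_less_iff[OF _ bdd] by blast
  have low: "(INF x. f x) \<le> f y" for y by (rule cINF_lower[OF bdd]) simp
  have "f x \<le> f y + e" for y using x low[of y] by linarith
  then show ?thesis using that by blast
qed

section \<open>Rate of the lasso Riesz learner\<close>

lemma (in prob_space) integrable_mult_of_sq:
  fixes f g :: "'a \<Rightarrow> real"
  assumes [measurable]: "f \<in> borel_measurable M" "g \<in> borel_measurable M"
    and "integrable M (\<lambda>x. (f x)\<^sup>2)" "integrable M (\<lambda>x. (g x)\<^sup>2)"
  shows "integrable M (\<lambda>x. f x * g x)"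
proof (rule Bochner_Integration.integrable_bound[where f="\<lambda>x. (f x)\<^sup>2 + (g x)\<^sup>2"])
  show "AE x in M. norm (f x * g x) \<le> norm ((f x)\<^sup>2 + (g x)\<^sup>2)"
  proof (rule AE_I2)
    fix x
    have "2 * \<bar>f x\<bar> * \<bar>g x\<bar> \<le> (f x)\<^sup>2 + (g x)\<^sup>2" using sum_squares_bound[of "\<bar>f x\<bar>" "\<bar>g x\<bar>"] by simp
    moreover have "\<bar>f x\<bar> * \<bar>g x\<bar> \<ge> 0" by simp
    ultimately have "\<bar>f x\<bar> * \<bar>g x\<bar> \<le> (f x)\<^sup>2 + (g x)\<^sup>2" by linarith
    then show "norm (f x * g x) \<le> norm ((f x)\<^sup>2 + (g x)\<^sup>2)" by (simp add: abs_mult)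
  qed
qed (use assms in auto)

lemma sq_add_le: "(x + y)\<^sup>2 \<le> 2 * x\<^sup>2 + 2 * (y::real)\<^sup>2"
  using sum_squares_bound[of x y] by (simp add: power2_sum)

lemma (in prob_space) integrable_sq_add:
  fixes f g :: "'a \<Rightarrow> real"
  assumes [measurable]: "f \<in> borel_measurable M" "g \<in> borel_measurable M"
    and "integrable M (\<lambda>x. (f x)\<^sup>2)" "integrable M (\<lambda>x. (g x)\<^sup>2)"
  shows "integrable M (\<lambda>x. (f x + g x)\<^sup>2)"
    and "(LINT x|M. (f x + g x)\<^sup>2) \<le> 2 * (LINT x|M. (f x)\<^sup>2) + 2 * (LINT x|M. (g x)\<^sup>2)"
proof -
  show i: "integrable M (\<lambda>x. (f x + g x)\<^sup>2)"
    using assms integrable_mult_of_sq[OF assms] by (simp add: power2_sum mult.assoc)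
  have "(LINT x|M. (f x + g x)\<^sup>2) \<le> (LINT x|M. 2 * (f x)\<^sup>2 + 2 * (g x)\<^sup>2)"
    by (rule integral_mono[OF i]) (use assms sq_add_le in auto)
  then show "(LINT x|M. (f x + g x)\<^sup>2) \<le> 2 * (LINT x|M. (f x)\<^sup>2) + 2 * (LINT x|M. (g x)\<^sup>2)"
    using assms by simp
qed

text \<open>\<open>\<alpha>\<close> stands for the projection of the Riesz representer. The
  representation of the functional is asked for on the dictionary only, where the projection does as
  well as the representer itself.\<close>

locale riesz_regression = iid_sample M F W for M :: "'a measure" and F :: "'w measure" and W +
  fixes MX :: "'x measure" and X :: "'w \<Rightarrow> 'x" and m :: "'w \<Rightarrow> ('x \<Rightarrow> real) \<Rightarrow> real"
    and b :: "nat \<Rightarrow> 'x \<Rightarrow> real" and \<alpha> :: "'x \<Rightarrow> real" and Cb :: real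
  assumes X [measurable]: "X \<in> measurable F MX"
    and b_measurable [measurable]: "\<And>j. b j \<in> borel_measurable MX"
    and b_bounded: "AE w in F. \<forall>j. \<bar>b j (X w)\<bar> \<le> Cb" and Cb: "Cb > 0"
    and m_b_measurable [measurable]: "\<And>j. (\<lambda>w. m w (b j)) \<in> borel_measurable F"
    and m_b_riesz: "\<And>j. (LINT w|F. m w (b j)) = (LINT w|F. \<alpha> (X w) * b j (X w))"
    and \<alpha>_measurable [measurable]: "\<alpha> \<in> borel_measurable MX"
    and \<alpha>_sq: "integrable F (\<lambda>w. (\<alpha> (X w))\<^sup>2)"
begin

sublocale F: prob_space F by (rule prob_space_F)

definition gram_entry :: "nat \<Rightarrow> nat \<Rightarrow> real" where
  "gram_entry j k = (LINT w|F. b j (X w) * b k (X w))"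

definition approx_err :: "nat \<Rightarrow> (nat \<Rightarrow> real) \<Rightarrow> real" where
  "approx_err p \<rho> = (LINT w|F. (\<alpha> (X w) - lin_comb b p \<rho> (X w))\<^sup>2)"

definition resid_corr :: "nat \<Rightarrow> (nat \<Rightarrow> real) \<Rightarrow> nat \<Rightarrow> real" where
  "resid_corr p \<rho> j = (LINT w|F. (\<alpha> (X w) - lin_comb b p \<rho> (X w)) * b j (X w))"

lemma lin_comb_measurable [measurable]: "lin_comb b p \<rho> \<in> borel_measurable MX"
  unfolding lin_comb_def by measurable

lemma lin_comb_bound: "AE w in F. \<bar>lin_comb b p \<rho> (X w)\<bar> \<le> Cb * (\<Sum>j<p. \<bar>\<rho> j\<bar>)"
  using b_bounded
proof eventually_elim
  case (elim w)
  have "\<bar>lin_comb b p \<rho> (X w)\<bar> \<le> (\<Sum>j<p. \<bar>\<rho> j * b j (X w)\<bar>)" unfolding lin_comb_def by (rule sum_abs)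
  also have "\<dots> \<le> (\<Sum>j<p. \<bar>\<rho> j\<bar> * Cb)" using elim by (intro sum_mono) (auto simp: abs_mult intro!: mult_left_mono)
  finally show ?case by (simp add: sum_distrib_left mult.commute)
qed

lemma b_sq: "integrable F (\<lambda>w. (b j (X w))\<^sup>2)"
proof (rule F.integrable_const_bound[where B="Cb\<^sup>2"])
  show "AE w in F. norm ((b j (X w))\<^sup>2) \<le> Cb\<^sup>2"
    using b_bounded by eventually_elim (use Cb in \<open>auto simp: abs_le_square_iff[symmetric]\<close>)
qed measurable

lemma lin_comb_sq: "integrable F (\<lambda>w. (lin_comb b p \<rho> (X w))\<^sup>2)"
proof (rule F.integrable_const_bound[where B="(Cb * (\<Sum>j<p. \<bar>\<rho> j\<bar>))\<^sup>2"])
  show "AE w in F. norm ((lin_comb b p \<rho> (X w))\<^sup>2) \<le> (Cb * (\<Sum>j<p. \<bar>\<rho> j\<bar>))\<^sup>2"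
    using lin_comb_bound[of p \<rho>]
  proof eventually_elim
    case (elim w)
    have "\<bar>lin_comb b p \<rho> (X w)\<bar>\<^sup>2 \<le> (Cb * (\<Sum>j<p. \<bar>\<rho> j\<bar>))\<^sup>2" by (rule power_mono[OF elim]) simp
    then show ?case by simp
  qed
qed measurable

lemma residual_sq: "integrable F (\<lambda>w. (\<alpha> (X w) - lin_comb b p \<rho> (X w))\<^sup>2)"
  using F.integrable_sq_add(1)[of "\<lambda>w. \<alpha> (X w)" "\<lambda>w. - lin_comb b p \<rho> (X w)"] \<alpha>_sq lin_comb_sq[of p \<rho>] by simp

lemma b_mult_integrable: "integrable F (\<lambda>w. b j (X w) * b k (X w))"
  by (rule F.integrable_mult_of_sq) (auto simp: b_sq)

lemma integral_lin_comb_sq: "(LINT w|F. (lin_comb b p \<rho> (X w))\<^sup>2) = quad_form p gram_entry \<rho>"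
proof -
  have "(lin_comb b p \<rho> (X w))\<^sup>2 = (\<Sum>j<p. \<Sum>k<p. \<rho> j * \<rho> k * (b j (X w) * b k (X w)))" for w
    unfolding lin_comb_def power2_eq_square sum_product by (intro sum.cong refl) simp
  then show ?thesis
    unfolding quad_form_def gram_entry_def
    by (simp add: b_mult_integrable mult_ac)
qed

lemma approx_err_le_add:
  "approx_err p (\<lambda>j. \<rho> j + \<delta> j) \<le> 2 * approx_err p \<rho> + 2 * quad_form p gram_entry \<delta>"
proof -
  have "lin_comb b p (\<lambda>j. \<rho> j + \<delta> j) x = lin_comb b p \<rho> x + lin_comb b p \<delta> x" for x
    by (simp add: lin_comb_def algebra_simps sum.distrib)
  then have "approx_err p (\<lambda>j. \<rho> j + \<delta> j) =
     (LINT w|F. ((\<alpha> (X w) - lin_comb b p \<rho> (X w)) + - lin_comb b p \<delta> (X w))\<^sup>2)"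
    unfolding approx_err_def by (simp add: algebra_simps)
  also have "\<dots> \<le> 2 * (LINT w|F. (\<alpha> (X w) - lin_comb b p \<rho> (X w))\<^sup>2) + 2 * (LINT w|F. (- lin_comb b p \<delta> (X w))\<^sup>2)"
    by (rule F.integrable_sq_add(2)) (use residual_sq lin_comb_sq in auto)
  finally show ?thesis by (simp add: approx_err_def integral_lin_comb_sq)
qed

text \<open>Keeps the second moment of the fitted function bounded without any condition on its
  coefficients. This is what bounds the variance in the tail bound for the sample moments.\<close>

lemma quad_form_gram_le: "quad_form p gram_entry \<rho> \<le> 2 * (LINT w|F. (\<alpha> (X w))\<^sup>2) + 2 * approx_err p \<rho>"
proof -
  have sq: "(lin_comb b p \<rho> (X w) - \<alpha> (X w))\<^sup>2 = (\<alpha> (X w) - lin_comb b p \<rho> (X w))\<^sup>2" for w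
    by (rule power2_commute)
  have "(LINT w|F. (\<alpha> (X w) + (lin_comb b p \<rho> (X w) - \<alpha> (X w)))\<^sup>2) \<le>
    2 * (LINT w|F. (\<alpha> (X w))\<^sup>2) + 2 * (LINT w|F. (lin_comb b p \<rho> (X w) - \<alpha> (X w))\<^sup>2)"
    by (rule F.integrable_sq_add(2)) (auto simp only: sq \<alpha>_sq residual_sq, measurable)
  then show ?thesis unfolding sq by (simp add: approx_err_def integral_lin_comb_sq)
qed

lemma approx_err_nonneg: "approx_err p \<rho> \<ge> 0"
  unfolding approx_err_def by simp

text \<open>
  The approximation compared with the lasso fit is a near minimizer of the squared error penalized by
  the number of nonzero coefficients: perturbing one coefficient changes the penalty by at most \<open>e\<^sup>2\<close>,
  so every dictionary function is nearly orthogonal to its residual, without any eigenvalue condition.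
\<close>

lemma sparse_near_projection:
  fixes e :: real
  assumes "e > 0"
  obtains \<rho> where "\<And>\<rho>'. approx_err p \<rho> + e\<^sup>2 * real (card {j. j < p \<and> \<rho> j \<noteq> 0})
      \<le> approx_err p \<rho>' + e\<^sup>2 * real (card {j. j < p \<and> \<rho>' j \<noteq> 0}) + e\<^sup>2"
    and "\<And>j. j < p \<Longrightarrow> \<bar>resid_corr p \<rho> j\<bar> \<le> 2 * Cb * e"
proof -
  define \<Phi> where "\<Phi> \<rho> = approx_err p \<rho> + e\<^sup>2 * real (card {j. j < p \<and> \<rho> j \<noteq> 0})" for \<rho> :: "nat \<Rightarrow> real"
  have e2: "e\<^sup>2 > 0" using assms by simp
  have P0: "\<Phi> \<rho> \<ge> 0" for \<rho> unfolding \<Phi>_def using approx_err_nonneg[of p \<rho>] by simp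
  obtain \<rho> where \<rho>: "\<And>\<rho>'. \<Phi> \<rho> \<le> \<Phi> \<rho>' + e\<^sup>2" by (rule near_minimizer[of \<Phi>, OF P0 e2]) blast
  have "\<bar>resid_corr p \<rho> j\<bar> \<le> 2 * Cb * e" if j: "j < p" for j
  proof -
    define v where "v = resid_corr p \<rho> j"
    \<comment> \<open>The minimizer of \<open>t\<^sup>2 * Cb\<^sup>2 - 2 * t * v\<close>, which
      bounds the change of the squared error.\<close>
    define t where "t = v / Cb\<^sup>2"
    define \<rho>' where "\<rho>' = \<rho>(j := \<rho> j + t)"
    have lc: "lin_comb b p \<rho>' x = lin_comb b p \<rho> x + t * b j x" for x
    proof -
      have "lin_comb b p \<rho>' x = (\<Sum>i<p. \<rho> i * b i x + (if i = j then t * b j x else 0))"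
        unfolding lin_comb_def \<rho>'_def by (intro sum.cong) (auto simp: algebra_simps)
      also have "\<dots> = lin_comb b p \<rho> x + t * b j x" using j by (simp add: sum.distrib lin_comb_def)
      finally show ?thesis .
    qed
    have i1: "integrable F (\<lambda>w. (\<alpha> (X w) - lin_comb b p \<rho> (X w)) * b j (X w))"
      by (rule F.integrable_mult_of_sq) (use residual_sq b_sq in auto)
    have "(\<alpha> (X w) - lin_comb b p \<rho>' (X w))\<^sup>2 = (\<alpha> (X w) - lin_comb b p \<rho> (X w))\<^sup>2
        + (t\<^sup>2 * (b j (X w))\<^sup>2 - 2 * t * ((\<alpha> (X w) - lin_comb b p \<rho> (X w)) * b j (X w)))" for w
      unfolding lc by (simp add: power2_eq_square algebra_simps)
    then have "approx_err p \<rho>' = approx_err p \<rho> + (t\<^sup>2 * (LINT w|F. (b j (X w))\<^sup>2) - 2 * t * v)"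
      unfolding approx_err_def v_def resid_corr_def using i1 residual_sq[of p \<rho>] b_sq[of j] by simp
    moreover have "(LINT w|F. (b j (X w))\<^sup>2) \<le> Cb\<^sup>2"
    proof -
      have "(LINT w|F. (b j (X w))\<^sup>2) \<le> (LINT w|F. Cb\<^sup>2)"
      proof (rule integral_mono_AE[OF b_sq])
        show "AE w in F. (b j (X w))\<^sup>2 \<le> Cb\<^sup>2"
          using b_bounded by eventually_elim (use Cb in \<open>auto simp: abs_le_square_iff[symmetric]\<close>)
      qed simp
      then show ?thesis by (simp add: F.prob_space)
    qed
    then have "t\<^sup>2 * (LINT w|F. (b j (X w))\<^sup>2) \<le> t\<^sup>2 * Cb\<^sup>2" by (intro mult_left_mono) auto
    moreover have "card {i. i < p \<and> \<rho>' i \<noteq> 0} \<le> card {i. i < p \<and> \<rho> i \<noteq> 0} + 1"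
    proof -
      have "card {i. i < p \<and> \<rho>' i \<noteq> 0} \<le> card (insert j {i. i < p \<and> \<rho> i \<noteq> 0})"
        by (rule card_mono) (auto simp: \<rho>'_def split: if_splits)
      also have "\<dots> \<le> card {i. i < p \<and> \<rho> i \<noteq> 0} + 1" by (simp add: card_insert_if)
      finally show ?thesis .
    qed
    then have "real (card {i. i < p \<and> \<rho>' i \<noteq> 0}) \<le> real (card {i. i < p \<and> \<rho> i \<noteq> 0}) + 1" by linarith
    from mult_left_mono[OF this, of "e\<^sup>2"] have
      "e\<^sup>2 * real (card {i. i < p \<and> \<rho>' i \<noteq> 0}) \<le> e\<^sup>2 * real (card {i. i < p \<and> \<rho> i \<noteq> 0}) + e\<^sup>2"
      by (simp add: algebra_simps)
    \<comment> \<open>One \<open>e\<^sup>2\<close> pays for a possible new nonzero coefficient, the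
      other is the slack of the near minimizer.\<close>
    ultimately have "0 \<le> t\<^sup>2 * Cb\<^sup>2 - 2 * t * v + 2 * e\<^sup>2" using \<rho>[of \<rho>'] unfolding \<Phi>_def by linarith
    also have "\<dots> = - (v\<^sup>2 / Cb\<^sup>2) + 2 * e\<^sup>2" using Cb by (simp add: t_def power2_eq_square)
    finally have "v\<^sup>2 \<le> 2 * e\<^sup>2 * Cb\<^sup>2" using Cb by (simp add: field_simps)
    also have "\<dots> \<le> (2 * Cb * e)\<^sup>2" by (simp add: power_mult_distrib)
    finally have "\<bar>v\<bar> \<le> \<bar>2 * Cb * e\<bar>" by (simp add: abs_le_square_iff)
    then show ?thesis using Cb assms by (simp add: v_def)
  qed
  then show ?thesis using that \<rho> unfolding \<Phi>_def by blast
qed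

section \<open>Sample moments at a fixed coefficient vector\<close>

lemma quad_form_G_hat:
  "quad_form p (G_hat X b N d) \<rho> = (\<Sum>i\<in>N. (lin_comb b p \<rho> (X (d i)))\<^sup>2) / real (card N)"
proof -
  have "(\<Sum>i\<in>N. (lin_comb b p \<rho> (X (d i)))\<^sup>2) =
     (\<Sum>i\<in>N. \<Sum>j<p. \<Sum>k<p. \<rho> j * (b j (X (d i)) * b k (X (d i))) * \<rho> k)"
    unfolding lin_comb_def power2_eq_square sum_product by (intro sum.cong refl) simp
  also have "\<dots> = (\<Sum>j<p. \<Sum>i\<in>N. \<Sum>k<p. \<rho> j * (b j (X (d i)) * b k (X (d i))) * \<rho> k)" by (rule sum.swap)
  also have "\<dots> = (\<Sum>j<p. \<Sum>k<p. \<Sum>i\<in>N. \<rho> j * (b j (X (d i)) * b k (X (d i))) * \<rho> k)"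
    by (intro sum.cong refl sum.swap)
  also have "\<dots> / real (card N) = quad_form p (G_hat X b N d) \<rho>"
    by (simp add: quad_form_def G_hat_def sum_divide_distrib sum_distrib_left sum_distrib_right)
  finally show ?thesis by simp
qed

text \<open>Exhibits the lasso gradient at a fixed \<open>\<rho>\<close> as an average over
  observations, so that tail bounds for sums apply to it.\<close>

lemma moment_residual_mean:
  "M_hat m b N d j - (\<Sum>k<p. G_hat X b N d j k * \<rho> k) =
    (\<Sum>i\<in>N. m (d i) (b j) - b j (X (d i)) * lin_comb b p \<rho> (X (d i))) / real (card N)"
proof -
  have "(\<Sum>k<p. G_hat X b N d j k * \<rho> k) = (\<Sum>k<p. \<Sum>i\<in>N. b j (X (d i)) * b k (X (d i)) * \<rho> k / real (card N))"
    by (simp add: G_hat_def sum_divide_distrib sum_distrib_right)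
  also have "\<dots> = (\<Sum>i\<in>N. \<Sum>k<p. b j (X (d i)) * b k (X (d i)) * \<rho> k / real (card N))" by (rule sum.swap)
  also have "\<dots> = (\<Sum>i\<in>N. b j (X (d i)) * lin_comb b p \<rho> (X (d i))) / real (card N)"
    by (simp add: lin_comb_def sum_divide_distrib sum_distrib_left mult_ac)
  finally show ?thesis by (simp add: M_hat_def sum_subtractf diff_divide_distrib)
qed

text \<open>The almost sure bound of a summand involves \<open>A\<close>, which will diverge like
  1/\<epsilon>, but its variance involves only \<open>Q\<close>, which stays fixed. Only the choice
  of the exponential parameter \<open>c\<close> feels \<open>A\<close>.\<close>

lemma prob_moment_residual:
  fixes \<rho> :: "nat \<Rightarrow> real"
  assumes Cm: "AE w in F. \<forall>j<p. \<bar>m w (b j)\<bar> \<le> Cm" and "Cm > 0"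
    and l1: "(\<Sum>j<p. \<bar>\<rho> j\<bar>) \<le> A" and qf: "quad_form p gram_entry \<rho> \<le> Q"
    and "finite N" "c > 0" "c * (2 * (Cm + Cb\<^sup>2 * A)) \<le> 1" and j: "j < p"
  shows "prob {\<omega>\<in>space M. \<bar>(\<Sum>i\<in>N. m (W i \<omega>) (b j) - b j (X (W i \<omega>)) * lin_comb b p \<rho> (X (W i \<omega>)) - resid_corr p \<rho> j)\<bar> \<ge> t}
     \<le> 2 * exp (real (card N) * c\<^sup>2 * (2 * Cm\<^sup>2 + 2 * Cb\<^sup>2 * Q) - c * t)"
proof -
  define h where "h w = m w (b j) - b j (X w) * lin_comb b p \<rho> (X w)" for w
  define v where "v = resid_corr p \<rho> j"
  have [measurable]: "h \<in> borel_measurable F" unfolding h_def by measurable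
  let ?H = "Cm + Cb\<^sup>2 * A"
  have bl: "AE w in F. \<bar>b j (X w)\<bar> \<le> Cb \<and> \<bar>m w (b j)\<bar> \<le> Cm \<and> \<bar>lin_comb b p \<rho> (X w)\<bar> \<le> Cb * A"
    using b_bounded Cm lin_comb_bound[of p \<rho>]
  proof eventually_elim
    case (elim w)
    then have "\<bar>lin_comb b p \<rho> (X w)\<bar> \<le> Cb * A" using mult_left_mono[OF l1, of Cb] Cb by linarith
    then show ?case using elim j by auto
  qed
  have hb: "AE w in F. \<bar>h w\<bar> \<le> ?H"
    using bl
  proof eventually_elim
    case (elim w)
    have "\<bar>b j (X w)\<bar> * \<bar>lin_comb b p \<rho> (X w)\<bar> \<le> Cb * (Cb * A)"
      using elim Cb by (intro mult_mono) auto
    then have "\<bar>b j (X w) * lin_comb b p \<rho> (X w)\<bar> \<le> Cb\<^sup>2 * A" by (simp add: abs_mult power2_eq_square)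
    then show ?case using elim unfolding h_def by linarith
  qed
  have im: "integrable F (\<lambda>w. m w (b j))"
    by (rule F.integrable_const_bound[where B=Cm]) (use bl in \<open>auto elim!: eventually_mono\<close>)
  have ib: "integrable F (\<lambda>w. b j (X w) * lin_comb b p \<rho> (X w))"
    by (rule F.integrable_mult_of_sq) (use b_sq lin_comb_sq in auto)
  have ia: "integrable F (\<lambda>w. \<alpha> (X w) * b j (X w))"
    by (rule F.integrable_mult_of_sq) (use b_sq \<alpha>_sq in auto)
  have ih: "integrable F h" unfolding h_def using im ib by simp
  \<comment> \<open>The Riesz property replaces the mean of \<open>m w (b j)\<close> by that of
    \<open>\<alpha> (X w) * b j (X w)\<close>, which leaves the residual correlation.\<close>
  have Eh: "(LINT w|F. h w) = v"
  proof -
    have "(LINT w|F. h w) = (LINT w|F. \<alpha> (X w) * b j (X w)) - (LINT w|F. b j (X w) * lin_comb b p \<rho> (X w))"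
      unfolding h_def using im ib m_b_riesz[of j] by simp
    also have "\<dots> = (LINT w|F. \<alpha> (X w) * b j (X w) - b j (X w) * lin_comb b p \<rho> (X w))" using ia ib by simp
    finally show ?thesis by (simp add: v_def resid_corr_def algebra_simps)
  qed
  have vb: "\<bar>v\<bar> \<le> ?H"
  proof -
    have "\<bar>v\<bar> \<le> (LINT w|F. \<bar>h w\<bar>)" using Eh integral_abs_bound[of F h] by simp
    also have "\<dots> \<le> (LINT w|F. ?H)" by (rule integral_mono_AE) (use ih hb in auto)
    finally show ?thesis by (simp add: F.prob_space)
  qed
  have ih2: "integrable F (\<lambda>w. (h w)\<^sup>2)"
  proof (rule F.integrable_const_bound[where B="?H\<^sup>2"])
    show "AE w in F. norm ((h w)\<^sup>2) \<le> ?H\<^sup>2" using hb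
    proof eventually_elim
      case (elim w)
      have "\<bar>h w\<bar>\<^sup>2 \<le> ?H\<^sup>2" by (rule power_mono[OF elim]) simp
      then show ?case by simp
    qed
  qed measurable
  have var: "(LINT w|F. (h w - v)\<^sup>2) \<le> 2 * Cm\<^sup>2 + 2 * Cb\<^sup>2 * Q"
  proof -
    have "(LINT w|F. (h w - v)\<^sup>2) = (LINT w|F. (h w)\<^sup>2) - v\<^sup>2"
      using F.variance_eq[OF ih ih2] Eh by simp
    also have "\<dots> \<le> (LINT w|F. (h w)\<^sup>2)" by simp
    also have "\<dots> \<le> (LINT w|F. 2 * Cm\<^sup>2 + 2 * Cb\<^sup>2 * (lin_comb b p \<rho> (X w))\<^sup>2)"
    proof (rule integral_mono_AE[OF ih2])
      show "integrable F (\<lambda>w. 2 * Cm\<^sup>2 + 2 * Cb\<^sup>2 * (lin_comb b p \<rho> (X w))\<^sup>2)" using lin_comb_sq by auto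
      show "AE w in F. (h w)\<^sup>2 \<le> 2 * Cm\<^sup>2 + 2 * Cb\<^sup>2 * (lin_comb b p \<rho> (X w))\<^sup>2"
        using bl
      proof eventually_elim
        case (elim w)
        have "(h w)\<^sup>2 \<le> 2 * (m w (b j))\<^sup>2 + 2 * (- (b j (X w) * lin_comb b p \<rho> (X w)))\<^sup>2"
          using sq_add_le[of "m w (b j)" "- (b j (X w) * lin_comb b p \<rho> (X w))"] by (simp add: h_def)
        also have "\<dots> = 2 * \<bar>m w (b j)\<bar>\<^sup>2 + 2 * (\<bar>b j (X w)\<bar>\<^sup>2 * (lin_comb b p \<rho> (X w))\<^sup>2)"
          by (simp add: power_mult_distrib)
        also have "\<dots> \<le> 2 * Cm\<^sup>2 + 2 * (Cb\<^sup>2 * (lin_comb b p \<rho> (X w))\<^sup>2)"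
          using elim by (intro add_mono mult_left_mono mult_right_mono power_mono) auto
        finally show ?case by simp
      qed
    qed
    also have "\<dots> = 2 * Cm\<^sup>2 + 2 * Cb\<^sup>2 * quad_form p gram_entry \<rho>"
      using lin_comb_sq[of p \<rho>] by (simp add: F.prob_space integral_lin_comb_sq)
    also have "\<dots> \<le> 2 * Cm\<^sup>2 + 2 * Cb\<^sup>2 * Q" using qf by (simp add: mult_left_mono)
    finally show ?thesis .
  qed
  have "prob {\<omega>\<in>space M. \<bar>\<Sum>i\<in>N. (\<lambda>w. h w - v) (W i \<omega>)\<bar> \<ge> t}
     \<le> 2 * exp (real (card N) * c\<^sup>2 * (2 * Cm\<^sup>2 + 2 * Cb\<^sup>2 * Q) - c * t)"
  proof (rule prob_abs_sum_bernstein)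
    show "AE w in F. \<bar>c * (h w - v)\<bar> \<le> 1"
      using hb
    proof eventually_elim
      case (elim w)
      have "\<bar>c * (h w - v)\<bar> \<le> c * (2 * ?H)"
        using elim vb \<open>c > 0\<close> by (auto simp: abs_mult intro!: mult_left_mono)
      then show ?case using assms by linarith
    qed
    show "integrable F (\<lambda>w. (h w - v)\<^sup>2)" using ih ih2 by (simp add: power2_diff)
    show "(LINT w|F. h w - v) = 0" using ih Eh by (simp add: F.prob_space)
  qed (use var assms in auto)
  then show ?thesis by (simp add: h_def v_def)
qed

end

section \<open>Combining events of probability tending to one\<close>

lemma wpa1_of_events:
  assumes "\<And>n. E n \<in> sets M" "(\<lambda>n. measure M (E n)) \<longlonglongrightarrow> 1"
  shows "wpa1 M (\<lambda>n \<omega>. \<omega> \<in> E n)"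
  unfolding wpa1_def using assms by (intro exI[of _ E]) auto

lemma (in prob_space) wpa1_combine:
  assumes "wpa1 M P" "wpa1 M Q"
    and imp: "\<forall>\<^sub>F n in sequentially. \<forall>\<omega>\<in>space M. P n \<omega> \<longrightarrow> Q n \<omega> \<longrightarrow> R n \<omega>"
  shows "wpa1 M R"
proof -
  obtain A where A: "\<And>n. A n \<in> sets M" "\<And>n \<omega>. \<omega> \<in> A n \<Longrightarrow> P n \<omega>" "(\<lambda>n. prob (A n)) \<longlonglongrightarrow> 1"
    using assms(1) unfolding wpa1_def by blast
  obtain B where B: "\<And>n. B n \<in> sets M" "\<And>n \<omega>. \<omega> \<in> B n \<Longrightarrow> Q n \<omega>" "(\<lambda>n. prob (B n)) \<longlonglongrightarrow> 1"
    using assms(2) unfolding wpa1_def by blast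
  obtain n0 where n0: "\<And>n \<omega>. n \<ge> n0 \<Longrightarrow> \<omega> \<in> space M \<Longrightarrow> P n \<omega> \<Longrightarrow> Q n \<omega> \<Longrightarrow> R n \<omega>"
    using imp unfolding eventually_sequentially by blast
  \<comment> \<open>The implication holds only for large \<open>n\<close>. The empty event at the
    finitely many earlier sample sizes changes no limit.\<close>
  define D where "D n = (if n \<ge> n0 then A n \<inter> B n else {})" for n
  have D: "D n \<in> sets M" for n using A B by (auto simp: D_def)
  have R: "R n \<omega>" if "\<omega> \<in> D n" for n \<omega>
    using that n0[of n \<omega>] A(2)[of \<omega> n] B(2)[of \<omega> n] sets.sets_into_space[OF A(1)[of n]]
    by (auto simp: D_def split: if_splits)
  have lower: "prob (A n) + prob (B n) - 1 \<le> prob (A n \<inter> B n)" for n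
  proof -
    have "prob (A n \<union> B n) = prob (A n) + prob (B n) - prob (A n \<inter> B n)"
      using A(1) B(1) by (intro measure_Un3) (auto simp: fmeasurable_eq_sets)
    then show ?thesis using prob_le_1[of "A n \<union> B n"] by simp
  qed
  have "(\<lambda>n. prob (A n \<inter> B n)) \<longlonglongrightarrow> 1"
  proof (rule tendsto_sandwich[where h="\<lambda>_. 1"])
    show "(\<lambda>n. prob (A n) + prob (B n) - 1) \<longlonglongrightarrow> 1"
      using tendsto_diff[OF tendsto_add[OF A(3) B(3)] tendsto_const[of 1]] by simp
  qed (use lower in auto)
  moreover have "\<forall>\<^sub>F n in sequentially. prob (A n \<inter> B n) = prob (D n)"
    using eventually_ge_at_top[of n0] by eventually_elim (simp add: D_def)
  ultimately have "(\<lambda>n. prob (D n)) \<longlonglongrightarrow> 1" using tendsto_cong by fast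
  then show ?thesis unfolding wpa1_def using D R by blast
qed

lemma nat_ceiling_bounds:
  assumes "x \<ge> (0::real)"
  shows "x \<le> real (nat \<lceil>x\<rceil>)" "real (nat \<lceil>x\<rceil>) \<le> x + 1"
  using assms by linarith+

context riesz_regression
begin

text \<open>A deterministic conclusion from a random condition. By Markov's inequality the empirical
  second moment of the fixed combination reaches twice \<open>Q\<close> with probability at most
  1/2, so some outcome of the eigenvalue event avoids this. The cone condition is automatic there,
  because \<open>\<rho>\<close> vanishes off its support.\<close>

lemma sum_squares_le_of_restricted_eigenvalue:
  assumes wp: "A \<in> sets M" "prob A > 1/2"
    and RE: "\<And>\<omega>. \<omega> \<in> A \<Longrightarrow> restricted_eigenvalue_ge p s c (G_hat X b N (obs N \<omega>))"
    and c: "c > 0" and N: "finite N" "card N > 0" and Q: "quad_form p gram_entry \<rho> \<le> Q" "Q > 0"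
    and S: "S = {j. j < p \<and> \<rho> j \<noteq> 0}" "card S \<le> s"
  shows "(\<Sum>j\<in>S. (\<rho> j)\<^sup>2) \<le> 2 * Q / c"
proof (cases "S = {}")
  case True then show ?thesis using c Q by simp
next
  case False
  let ?B = "{\<omega>\<in>space M. (\<Sum>i\<in>N. (lin_comb b p \<rho> (X (W i \<omega>)))\<^sup>2) \<ge> 2 * Q * real (card N)}"
  have "prob ?B \<le> real (card N) * (LINT w|F. (lin_comb b p \<rho> (X w))\<^sup>2) / (2 * Q * real (card N))"
    by (rule prob_sum_markov[of "\<lambda>w. (lin_comb b p \<rho> (X w))\<^sup>2"]) (use lin_comb_sq N Q in auto)
  also have "\<dots> \<le> 1/2" using N Q by (simp add: integral_lin_comb_sq field_simps)
  finally have B: "prob ?B \<le> 1/2" .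
  have "\<not> A \<subseteq> ?B"
  proof
    assume "A \<subseteq> ?B"
    then have "prob A \<le> prob ?B" by (rule finite_measure_mono) measurable
    then show False using wp B by simp
  qed
  then obtain \<omega> where w: "\<omega> \<in> A" "\<omega> \<notin> ?B" by blast
  have ws: "\<omega> \<in> space M" using w sets.sets_into_space[OF wp(1)] by auto
  let ?G = "G_hat X b N (obs N \<omega>)"
  have "quad_form p ?G \<rho> = (\<Sum>i\<in>N. (lin_comb b p \<rho> (X (W i \<omega>)))\<^sup>2) / real (card N)"
    unfolding quad_form_G_hat by simp
  also have "\<dots> < 2 * Q" using w ws N by (simp add: pos_divide_less_eq)
  finally have q: "quad_form p ?G \<rho> < 2 * Q" .
  have "(\<Sum>j\<in>{..<p} - S. \<bar>\<rho> j\<bar>) = 0" by (auto simp: S)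
  moreover have "0 \<le> 3 * (\<Sum>j\<in>S. \<bar>\<rho> j\<bar>)" by (auto intro!: sum_nonneg)
  moreover have "S \<subseteq> {..<p}" "\<exists>j\<in>S. \<rho> j \<noteq> 0" using False by (auto simp: S)
  ultimately have "c \<le> quad_form p ?G \<rho> / (\<Sum>j\<in>S. (\<rho> j)\<^sup>2)"
    by (intro RE[OF w(1), unfolded restricted_eigenvalue_ge_def, rule_format]) (use S(2) in auto)
  moreover have "(\<Sum>j\<in>S. (\<rho> j)\<^sup>2) > 0"
    using False by (intro sum_pos) (auto simp: S)
  ultimately have "c * (\<Sum>j\<in>S. (\<rho> j)\<^sup>2) \<le> quad_form p ?G \<rho>" by (simp add: pos_le_divide_eq)
  then have "c * (\<Sum>j\<in>S. (\<rho> j)\<^sup>2) \<le> 2 * Q" using q by linarith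
  then show ?thesis using c by (simp add: field_simps)
qed

text \<open>The deterministic part of the lasso analysis. The sample restricted eigenvalue controls
  the distance of the coefficients, and the upper eigenvalue bound of the population Gram matrix
  turns that distance into mean-square error. The bound \<open>mom\<close> guarantees that a
  minimizer exists, hence that \<open>y\<close> is one.\<close>

lemma lasso_error_bound:
  assumes RE: "restricted_eigenvalue_ge p s c (G_hat X b N d)" and c: "c > 0" and r: "r > 0"
    and eig: "\<And>\<rho>. quad_form p gram_entry \<rho> \<le> \<Lambda> * (\<Sum>j<p. (\<rho> j)\<^sup>2)" "\<Lambda> \<ge> 0"
    and mom: "\<And>j. j < p \<Longrightarrow> \<bar>M_hat m b N d j - (\<Sum>k<p. G_hat X b N d j k * \<rho> k)\<bar> \<le> r / 2"
    and opt: "\<And>\<rho>. is_arg_min (lasso_objective p r (M_hat m b N d) (G_hat X b N d)) (\<lambda>_. True) \<rho> \<Longrightarrow>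
       is_arg_min (lasso_objective p r (M_hat m b N d) (G_hat X b N d)) (\<lambda>_. True) y"
    and k: "card {j. j < p \<and> \<rho> j \<noteq> 0} \<le> k" "k \<ge> 1" "2 * k \<le> s"
  shows "approx_err p y \<le> 2 * approx_err p \<rho> + 180 * \<Lambda> * r\<^sup>2 * real k / c\<^sup>2"
proof -
  let ?G = "G_hat X b N d" and ?M = "M_hat m b N d"
  let ?S = "{j. j < p \<and> \<rho> j \<noteq> 0}"
  have sym: "?G j k = ?G k j" for j k by (simp add: G_hat_def mult.commute)
  have psd: "quad_form p ?G x \<ge> 0" for x unfolding quad_form_G_hat by (auto intro!: divide_nonneg_nonneg sum_nonneg)
  obtain \<rho>m where "is_arg_min (lasso_objective p r ?M ?G) (\<lambda>_. True) \<rho>m"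
    using lasso_minimizer_exists[where A="?G" and p=p and mh="?M" and x=\<rho> and q="r/2" and r=r, OF sym psd mom] r by auto
  then have "is_arg_min (lasso_objective p r ?M ?G) (\<lambda>_. True) y" by (rule opt)
  then have le: "lasso_objective p r ?M ?G y \<le> lasso_objective p r ?M ?G \<rho>"
    by (auto simp: is_arg_min_def not_less)
  have "quad_form p ?G (\<lambda>j. y j - \<rho> j) \<le>
    3 * r * (\<Sum>j\<in>?S. \<bar>y j - \<rho> j\<bar>) - r * (\<Sum>j\<in>{..<p} - ?S. \<bar>y j - \<rho> j\<bar>)"
    by (rule lasso_basic_inequality[OF sym mom le refl])
  then have ss: "(\<Sum>j<p. (y j - \<rho> j)\<^sup>2) \<le> 90 * r\<^sup>2 * real k / c\<^sup>2"
    by (rule restricted_eigenvalue_sum_squares[OF RE c r _ psd]) (use k in auto)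
  have "approx_err p y = approx_err p (\<lambda>j. \<rho> j + (y j - \<rho> j))" by simp
  \<comment> \<open>The factor 2 of this split times the 90 from the restricted eigenvalue bound
    gives 180.\<close>
  also have "\<dots> \<le> 2 * approx_err p \<rho> + 2 * quad_form p gram_entry (\<lambda>j. y j - \<rho> j)" by (rule approx_err_le_add)
  also have "quad_form p gram_entry (\<lambda>j. y j - \<rho> j) \<le> \<Lambda> * (90 * r\<^sup>2 * real k / c\<^sup>2)"
    using eig(1)[of "\<lambda>j. y j - \<rho> j"] mult_left_mono[OF ss eig(2)] by linarith
  finally show ?thesis by (simp add: mult_ac)
qed

end

context riesz_regression
begin

text \<open>\<open>val\<close> bounds the penalized criterion at known approximations
  \<open>\<rho>0\<close>; the near minimizer inherits this bound up to one \<epsilon> squared.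
  Writing U for the sum, its support has size of order U / \<epsilon>^2, and a lasso error of order
  r^2 times this size is (r/\<epsilon>)^2 U. One quantity thus bounds approximation and estimation
  error.\<close>

lemma lasso_rate:
  fixes p :: "nat \<Rightarrow> nat" and r :: "nat \<Rightarrow> real" and N :: "nat \<Rightarrow> nat set" and \<rho>0 :: "nat \<Rightarrow> nat \<Rightarrow> real"
  assumes p: "\<And>n. p n \<ge> 2" and r: "\<And>n. r n > 0"
    and eps0: "eps p \<longlonglongrightarrow> 0" and epsr: "eps p \<in> o(r)"
    and fin: "\<And>n. finite (N n)" and card: "\<forall>\<^sub>F n in sequentially. real n / 4 \<le> real (card (N n))"
    and Cm: "\<And>n. AE w in F. \<forall>j<p n. \<bar>m w (b j)\<bar> \<le> Cm" "Cm > 0"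
    and eig: "\<And>n \<rho>. quad_form (p n) gram_entry \<rho> \<le> \<Lambda> * (\<Sum>j<p n. (\<rho> j)\<^sup>2)" "\<Lambda> \<ge> 0"
    and Cr: "Cr > 0" and c: "c > 0"
    and RE: "\<And>s::nat\<Rightarrow>nat. (\<lambda>n. real (s n) * (eps p n)\<^sup>2) \<longlonglongrightarrow> Cr \<Longrightarrow>
        wpa1 M (\<lambda>n \<omega>. restricted_eigenvalue_ge (p n) (s n) c (G_hat X b (N n) (obs (N n) \<omega>)))"
    and opt: "\<And>n d \<rho>. d \<in> space (PiM (N n) (\<lambda>_. F)) \<Longrightarrow>
        is_arg_min (lasso_objective (p n) (r n) (M_hat m b (N n) d) (G_hat X b (N n) d)) (\<lambda>_. True) \<rho> \<Longrightarrow>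
        is_arg_min (lasso_objective (p n) (r n) (M_hat m b (N n) d) (G_hat X b (N n) d)) (\<lambda>_. True) (rh n d)"
    and val: "\<And>n. approx_err (p n) (\<rho>0 n) + (eps p n)\<^sup>2 * real (card {j. j < p n \<and> \<rho>0 n j \<noteq> 0}) \<le> val n"
    and val0: "val \<longlonglongrightarrow> 0"
  shows "\<exists>K>0. wpa1 M (\<lambda>n \<omega>. approx_err (p n) (rh n (obs (N n) \<omega>))
            \<le> K * (r n / eps p n)\<^sup>2 * (val n + (eps p n)\<^sup>2))"
proof -
  define e where "e = eps p"
  have e2: "(e n)\<^sup>2 = ln (real (p n)) / real n" for n
    using p[of n] by (simp add: e_def eps_def)
  have lnp: "ln (real (p n)) \<ge> ln 2" for n using p[of n] by simp
  have lnp0: "ln (real (p n)) > 0" for n using p[of n] by simp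
  have e_pos: "e n > 0" if "n \<ge> 1" for n using that lnp0[of n] by (simp add: e_def eps_def)
  have e20: "(\<lambda>n. (e n)\<^sup>2) \<longlonglongrightarrow> 0" using tendsto_power[OF eps0, of 2] by (simp add: e_def)
  define U where "U n = val n + (e n)\<^sup>2" for n
  have U0: "U \<longlonglongrightarrow> 0" using tendsto_add[OF val0 e20] by (simp add: U_def[abs_def])
  have Ue: "(e n)\<^sup>2 \<le> U n" for n
  proof -
    have "0 \<le> approx_err (p n) (\<rho>0 n) + (eps p n)\<^sup>2 * real (card {j. j < p n \<and> \<rho>0 n j \<noteq> 0})"
      using approx_err_nonneg by (intro add_nonneg_nonneg) auto
    then show ?thesis using val[of n] by (simp add: U_def)
  qed
  \<comment> \<open>Division by zero gives \<open>eps p 0 = 0\<close>, so the penalty level is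
    positive only for \<open>n \<ge> 1\<close>.\<close>
  have "\<exists>\<rho>. n \<ge> 1 \<longrightarrow> approx_err (p n) \<rho> + (e n)\<^sup>2 * real (card {j. j < p n \<and> \<rho> j \<noteq> 0}) \<le> U n
      \<and> (\<forall>j<p n. \<bar>resid_corr (p n) \<rho> j\<bar> \<le> 2 * Cb * e n)" for n
  proof (cases "n \<ge> 1")
    case True
    obtain \<rho> where 1: "\<And>\<rho>'. approx_err (p n) \<rho> + (e n)\<^sup>2 * real (card {j. j < p n \<and> \<rho> j \<noteq> 0})
      \<le> approx_err (p n) \<rho>' + (e n)\<^sup>2 * real (card {j. j < p n \<and> \<rho>' j \<noteq> 0}) + (e n)\<^sup>2"
      and 2: "\<And>j. j < p n \<Longrightarrow> \<bar>resid_corr (p n) \<rho> j\<bar> \<le> 2 * Cb * e n"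
      using sparse_near_projection[OF e_pos[OF True]] by blast
    show ?thesis using 1[of "\<rho>0 n"] val[of n] 2 by (intro exI[of _ \<rho>]) (auto simp: U_def e_def)
  qed auto
  then have "\<forall>n. \<exists>\<rho>. n \<ge> 1 \<longrightarrow> approx_err (p n) \<rho> + (e n)\<^sup>2 * real (card {j. j < p n \<and> \<rho> j \<noteq> 0}) \<le> U n
      \<and> (\<forall>j<p n. \<bar>resid_corr (p n) \<rho> j\<bar> \<le> 2 * Cb * e n)" by blast
  from choice[OF this] obtain \<rho> where \<rho>: "\<forall>n. n \<ge> 1 \<longrightarrow> approx_err (p n) (\<rho> n) + (e n)\<^sup>2 * real (card {j. j < p n \<and> \<rho> n j \<noteq> 0}) \<le> U n
      \<and> (\<forall>j<p n. \<bar>resid_corr (p n) (\<rho> n) j\<bar> \<le> 2 * Cb * e n)" by blast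
  have \<rho>1: "\<And>n. n \<ge> 1 \<Longrightarrow> approx_err (p n) (\<rho> n) + (e n)\<^sup>2 * real (card {j. j < p n \<and> \<rho> n j \<noteq> 0}) \<le> U n"
    and \<rho>2: "\<And>n j. n \<ge> 1 \<Longrightarrow> j < p n \<Longrightarrow> \<bar>resid_corr (p n) (\<rho> n) j\<bar> \<le> 2 * Cb * e n"
    using \<rho> by blast+
  define S where "S n = {j. j < p n \<and> \<rho> n j \<noteq> 0}" for n
  have err: "approx_err (p n) (\<rho> n) \<le> U n" if "n \<ge> 1" for n
    by (rule order_trans[OF _ \<rho>1[OF that]]) simp
  \<comment> \<open>\<open>k\<close> bounds the support of the near minimizer, and \<open>s\<close>
    is a sparsity level to which the eigenvalue condition applies. Since
    \<open>k n * (e n)\<^sup>2\<close> tends to 0 while \<open>s n * (e n)\<^sup>2\<close> tends to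
    \<open>Cr > 0\<close>, eventually \<open>2 * k n \<le> s n\<close>.\<close>
  define k where "k n = nat \<lceil>U n / (e n)\<^sup>2\<rceil>" for n
  define s where "s n = nat \<lceil>Cr / (e n)\<^sup>2\<rceil>" for n
  have k_prop: "card (S n) \<le> k n \<and> k n \<ge> 1 \<and> real (k n) * (e n)\<^sup>2 \<le> 2 * U n" if "n \<ge> 1" for n
  proof -
    have ep: "(e n)\<^sup>2 > 0" using e_pos[OF that] by simp
    have q1: "U n / (e n)\<^sup>2 \<ge> 1" using Ue[of n] ep by simp
    have kb: "U n / (e n)\<^sup>2 \<le> real (k n)" "real (k n) \<le> U n / (e n)\<^sup>2 + 1"
      unfolding k_def using nat_ceiling_bounds[of "U n / (e n)\<^sup>2"] q1 by auto
    have "(e n)\<^sup>2 * real (card (S n)) \<le> U n"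
      using \<rho>1[OF that] approx_err_nonneg[of "p n" "\<rho> n"] by (simp add: S_def)
    then have "real (card (S n)) \<le> U n / (e n)\<^sup>2" using ep by (simp add: pos_le_divide_eq mult.commute)
    then have "card (S n) \<le> k n" using kb by linarith
    moreover have "k n \<ge> 1" using kb q1 by linarith
    \<comment> \<open>Rounding up at most doubles the ratio, which is at least 1.\<close>
    moreover have "real (k n) * (e n)\<^sup>2 \<le> (2 * (U n / (e n)\<^sup>2)) * (e n)\<^sup>2" using kb q1 by (intro mult_right_mono) auto
    then have "real (k n) * (e n)\<^sup>2 \<le> 2 * U n" using ep by simp
    ultimately show ?thesis by blast
  qed
  have s_prop: "Cr \<le> real (s n) * (e n)\<^sup>2 \<and> real (s n) * (e n)\<^sup>2 \<le> Cr + (e n)\<^sup>2" if "n \<ge> 1" for n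
  proof -
    have ep: "(e n)\<^sup>2 > 0" using e_pos[OF that] by simp
    have kb: "Cr / (e n)\<^sup>2 \<le> real (s n)" "real (s n) \<le> Cr / (e n)\<^sup>2 + 1"
      unfolding s_def using nat_ceiling_bounds[of "Cr / (e n)\<^sup>2"] Cr by auto
    show ?thesis using kb ep mult_right_mono[OF kb(1), of "(e n)\<^sup>2"] mult_right_mono[OF kb(2), of "(e n)\<^sup>2"]
      by (simp add: distrib_right)
  qed
  have "(\<lambda>n. real (s n) * (e n)\<^sup>2) \<longlonglongrightarrow> Cr"
  proof (rule tendsto_sandwich[where f="\<lambda>_. Cr" and h="\<lambda>n. Cr + (e n)\<^sup>2"])
    show "(\<lambda>n. Cr + (e n)\<^sup>2) \<longlonglongrightarrow> Cr" using tendsto_add[OF tendsto_const e20, of Cr] by simp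
  qed (use s_prop in \<open>auto intro!: eventually_sequentiallyI[of 1]\<close>)
  then have "wpa1 M (\<lambda>n \<omega>. restricted_eigenvalue_ge (p n) (s n) c (G_hat X b (N n) (obs (N n) \<omega>)))"
    by (intro RE) (simp add: e_def)
  then obtain A where A: "\<And>n. A n \<in> sets M" "(\<lambda>n. prob (A n)) \<longlonglongrightarrow> 1"
    "\<And>n \<omega>. \<omega> \<in> A n \<Longrightarrow> restricted_eigenvalue_ge (p n) (s n) c (G_hat X b (N n) (obs (N n) \<omega>))"
    unfolding wpa1_def by blast
  define Q where "Q = 2 * (LINT w|F. (\<alpha> (X w))\<^sup>2) + 2"
  have Qp: "Q > 0" unfolding Q_def by (intro add_nonneg_pos) auto
  \<comment> \<open>\<open>A1 / e n\<close> will bound the absolute sum, by Cauchy--Schwarz with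
    support size at most \<open>2 / (e n)\<^sup>2\<close> and squares summing to at most
    \<open>2 * Q / c\<close>. For \<open>e n < 1\<close>, \<open>K1 / e n\<close> dominates twice
    the resulting bound on a summand, so \<open>e n / K1\<close> is an admissible exponential
    parameter.\<close>
  define A1 where "A1 = sqrt (4 * Q / c)"
  define K1 where "K1 = 2 * Cm + 2 * Cb\<^sup>2 * A1"
  have A1p: "A1 > 0" using Qp c by (simp add: A1_def)
  have K1p: "K1 > 0" using Cm(2) Cb A1p by (simp add: K1_def add_pos_pos)
  define \<sigma> where "\<sigma> = 2 * Cm\<^sup>2 + 2 * Cb\<^sup>2 * Q"
  have \<sigma>p: "\<sigma> > 0" using Cm(2) Cb Qp by (simp add: \<sigma>_def add_pos_pos)
  have small_e: "\<forall>\<^sub>F n in sequentially. e n \<le> a * r n" if "a > 0" for a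
  proof -
    have "\<forall>\<^sub>F n in sequentially. norm (eps p n) \<le> a * norm (r n)" by (rule landau_o.smallD[OF epsr that])
    then show ?thesis by eventually_elim (use r in \<open>simp add: e_def less_imp_le\<close>)
  qed
  have evU: "\<forall>\<^sub>F n in sequentially. U n < a" if "a > 0" for a using order_tendstoD(2)[OF U0 that] .
  have ev_e: "\<forall>\<^sub>F n in sequentially. e n < 1" using order_tendstoD(2)[OF eps0, of 1] by (simp add: e_def)
  have Cr4: "Cr / 4 > 0" and one: "0 < (1::real)" and half: "1 / 2 < (1::real)" using Cr by auto
  have "\<forall>\<^sub>F n in sequentially. 2 * k n \<le> s n"
    using evU[OF Cr4] eventually_ge_at_top[of 1]
  proof eventually_elim
    case (elim n)
    have "real (2 * k n) * (e n)\<^sup>2 \<le> real (s n) * (e n)\<^sup>2" using elim k_prop[of n] s_prop[of n] by auto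
    then have "real (2 * k n) \<le> real (s n)" using e_pos[of n] elim by (simp add: mult_le_cancel_right)
    then show ?case by linarith
  qed
  note ev_ks = this
  have ev_l1: "\<forall>\<^sub>F n in sequentially. quad_form (p n) gram_entry (\<rho> n) \<le> Q \<and> (\<Sum>j<p n. \<bar>\<rho> n j\<bar>) \<le> A1 / e n"
    using evU[OF one] eventually_ge_at_top[of 1] card order_tendstoD(1)[OF A(2) half] ev_ks
  proof eventually_elim
    case (elim n)
    have n: "n \<ge> 1" and e: "e n > 0" using elim e_pos by auto
    have q: "quad_form (p n) gram_entry (\<rho> n) \<le> Q"
      using quad_form_gram_le[of "p n" "\<rho> n"] err[OF n] elim by (simp add: Q_def)
    have cN: "card (N n) > 0"
    proof -
      have "real n / 4 > 0" using n by simp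
      then have "real (card (N n)) > 0" using elim by linarith
      then show ?thesis by simp
    qed
    have ss: "(\<Sum>j\<in>S n. (\<rho> n j)\<^sup>2) \<le> 2 * Q / c"
      by (rule sum_squares_le_of_restricted_eigenvalue[OF A(1)[of n] _ A(3) c fin[of n] cN q Qp S_def])
        (use elim k_prop[OF n] in auto)
    have "(\<Sum>j\<in>S n. \<bar>\<rho> n j\<bar>)\<^sup>2 \<le> real (card (S n)) * (\<Sum>j\<in>S n. (\<rho> n j)\<^sup>2)"
      using Cauchy_Schwarz_ineq_sum[of "\<lambda>_. 1" "\<lambda>j. \<bar>\<rho> n j\<bar>" "S n"] by simp
    also have "\<dots> \<le> real (k n) * (2 * Q / c)"
      by (rule mult_mono) (use k_prop[OF n] ss in \<open>auto intro!: sum_nonneg\<close>)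
    also have "\<dots> \<le> (2 / (e n)\<^sup>2) * (2 * Q / c)"
    proof (rule mult_right_mono)
      have "real (k n) * (e n)\<^sup>2 \<le> 2" using k_prop[OF n] elim by linarith
      then show "real (k n) \<le> 2 / (e n)\<^sup>2" using e by (simp add: pos_le_divide_eq)
    qed (use Qp c in auto)
    also have "\<dots> = (A1 / e n)\<^sup>2" using Qp c by (simp add: A1_def power_divide)
    finally have "(\<Sum>j\<in>S n. \<bar>\<rho> n j\<bar>) \<le> A1 / e n"
      by (rule power2_le_imp_le) (use A1p e in auto)
    moreover have "(\<Sum>j<p n. \<bar>\<rho> n j\<bar>) = (\<Sum>j\<in>S n. \<bar>\<rho> n j\<bar>)"
      by (rule sum.mono_neutral_right) (auto simp: S_def)
    ultimately show ?case using q by simp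
  qed
  define T where "T n j \<omega> = (\<Sum>i\<in>N n. m (W i \<omega>) (b j) - b j (X (W i \<omega>)) * lin_comb b (p n) (\<rho> n) (X (W i \<omega>)) - resid_corr (p n) (\<rho> n) j)" for n j \<omega>
  have T_meas [measurable]: "T n j \<in> borel_measurable M" for n j unfolding T_def by measurable
  define E where "E n = {\<omega>\<in>space M. \<forall>j<p n. \<bar>T n j \<omega>\<bar> < real (card (N n)) * (r n / 4)}" for n
  have E [measurable]: "E n \<in> sets M" for n unfolding E_def by measurable
  have "\<forall>\<^sub>F n in sequentially. prob (E n) > 1 - \<delta>" if \<delta>: "\<delta> > 0" for \<delta>
  proof -
    \<comment> \<open>The union over \<open>p n\<close> coordinates consumes one power of
      \<open>p n\<close>. The further power \<open>x\<close> leaves at most 2 times 2 to the power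
      \<open>- x\<close>, which this choice makes smaller than \<open>\<delta>\<close>; only
      \<open>p n \<ge> 2\<close> enters.\<close>
    define x where "x = 2 / (\<delta> * ln 2)"
    have x0: "x > 0" using \<delta> by (simp add: x_def)
    have x: "2 * exp (- (x * ln 2)) < \<delta>"
    proof -
      have eq: "x * ln 2 = 2 / \<delta>" using \<delta> by (simp add: x_def)
      have "exp (x * ln 2) > 2 / \<delta>" unfolding eq using exp_ge_add_one_self[of "2 / \<delta>"] by linarith
      then show ?thesis using \<delta> by (simp add: exp_minus field_simps)
    qed
    \<comment> \<open>The first threshold makes the variance term at most half of the linear term in
      the exponent. The second makes the remaining half at least
      \<open>(1 + x) * ln (p n)\<close>.\<close>
    have a1: "K1 / (8 * \<sigma>) > 0" "1 / (32 * K1 * (1 + x)) > 0" using K1p \<sigma>p x0 by auto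
    show ?thesis
      using ev_l1 small_e[OF a1(1)] small_e[OF a1(2)] ev_e card eventually_ge_at_top[of 1]
    proof eventually_elim
      case (elim n)
      have n: "n \<ge> 1" and e: "e n > 0" using elim e_pos by auto
      let ?N = "real (card (N n))"
      have bd: "prob {\<omega>\<in>space M. \<bar>T n j \<omega>\<bar> \<ge> ?N * (r n / 4)} \<le> 2 * exp (- (1 + x) * ln (real (p n)))" if j: "j < p n" for j
      proof -
        have cc: "e n / K1 * (2 * (Cm + Cb\<^sup>2 * (A1 / e n))) \<le> 1"
        proof -
          have "e n / K1 * (2 * (Cm + Cb\<^sup>2 * (A1 / e n))) = (2 * Cm * e n + 2 * Cb\<^sup>2 * A1) / K1"
            using e K1p by (simp add: field_simps)
          also have "\<dots> \<le> K1 / K1"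
            using elim Cm(2) K1p by (intro divide_right_mono) (auto simp: K1_def)
          finally show ?thesis using K1p by simp
        qed
        have "prob {\<omega>\<in>space M. \<bar>T n j \<omega>\<bar> \<ge> ?N * (r n / 4)}
            \<le> 2 * exp (?N * (e n / K1)\<^sup>2 * (2 * Cm\<^sup>2 + 2 * Cb\<^sup>2 * Q) - e n / K1 * (?N * (r n / 4)))"
          unfolding T_def
          by (rule prob_moment_residual[OF Cm(1)[of n] Cm(2), where A="A1 / e n"])
            (use elim fin e K1p cc j in auto)
        also have "\<dots> \<le> 2 * exp (- (1 + x) * ln (real (p n)))"
        proof -
          have "e n / K1 * \<sigma> \<le> r n / 8"
            using elim(2) K1p \<sigma>p by (simp add: field_simps)
          then have "(?N * (e n / K1)) * (e n / K1 * \<sigma>) \<le> (?N * (e n / K1)) * (r n / 8)"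
            using e K1p by (intro mult_left_mono) auto
          then have "?N * (e n / K1)\<^sup>2 * \<sigma> - e n / K1 * (?N * (r n / 4)) \<le> - (?N * (e n * r n / (8 * K1)))"
            by (simp add: power2_eq_square field_simps)
          also have "\<dots> \<le> - (real n / 4 * (e n * r n / (8 * K1)))"
          proof -
            have "e n * r n / (8 * K1) \<ge> 0" using e r[of n] K1p by simp
            from mult_right_mono[OF elim(5) this] show ?thesis by (simp only: neg_le_iff_le)
          qed
          also have "\<dots> \<le> - (real n * (e n)\<^sup>2 * (1 + x))"
          proof -
            have "32 * K1 * (1 + x) > 0" using K1p x0 by simp
            moreover have "e n \<le> r n / (32 * K1 * (1 + x))" using elim(3) by simp
            ultimately have "32 * K1 * (1 + x) * e n \<le> r n" by (simp only: pos_le_divide_eq mult.commute)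
            then have "real n * e n * (32 * K1 * (1 + x) * e n) \<le> real n * e n * r n" using e by (intro mult_left_mono) auto
            then show ?thesis using K1p by (simp add: field_simps power2_eq_square)
          qed
          also have "\<dots> = - (1 + x) * ln (real (p n))" using n by (simp add: e2 algebra_simps)
          finally show ?thesis unfolding \<sigma>_def[symmetric] by simp
        qed
        finally show ?thesis .
      qed
      have "prob (space M - E n) \<le> prob (\<Union>j\<in>{..<p n}. {\<omega>\<in>space M. \<bar>T n j \<omega>\<bar> \<ge> ?N * (r n / 4)})"
        by (rule finite_measure_mono) (auto simp: E_def not_less)
      also have "\<dots> \<le> (\<Sum>j<p n. prob {\<omega>\<in>space M. \<bar>T n j \<omega>\<bar> \<ge> ?N * (r n / 4)})"
        by (rule finite_measure_subadditive_finite) auto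
      also have "\<dots> \<le> (\<Sum>j<p n. 2 * exp (- (1 + x) * ln (real (p n))))"
        by (intro sum_mono bd) auto
      also have "\<dots> = exp (ln (real (p n))) * (2 * exp (- (1 + x) * ln (real (p n))))"
        using p[of n] by (simp add: exp_ln)
      also have "\<dots> = 2 * exp (- (x * ln (real (p n))))"
        by (simp add: exp_add[symmetric] algebra_simps)
      also have "\<dots> \<le> 2 * exp (- (x * ln 2))" using lnp[of n] x0 by simp
      also have "\<dots> < \<delta>" by (rule x)
      finally have "prob (space M - E n) < \<delta>" .
      then show ?case using prob_compl[OF E[of n]] by simp
    qed
  qed
  note E_large = this
  have E1: "(\<lambda>n. prob (E n)) \<longlonglongrightarrow> 1"
  proof (rule order_tendstoI)
    fix a :: real assume "a < 1"
    then show "\<forall>\<^sub>F n in sequentially. a < prob (E n)" using E_large[of "1 - a"] by simp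
  next
    fix a :: real assume "a > 1"
    then show "\<forall>\<^sub>F n in sequentially. prob (E n) < a" using prob_le_1 le_less_trans by (intro always_eventually) blast
  qed
  \<comment> \<open>The 2 belongs to the approximation error; 360 is 180 times the 2 in
    \<open>real (k n) * (e n)\<^sup>2 \<le> 2 * U n\<close>.\<close>
  define K where "K = 2 + 360 * \<Lambda> / c\<^sup>2"
  have Kp: "K > 0" using eig(2) unfolding K_def by (intro add_pos_nonneg) auto
  have "wpa1 M (\<lambda>n \<omega>. approx_err (p n) (rh n (obs (N n) \<omega>)) \<le> K * (r n / eps p n)\<^sup>2 * (val n + (eps p n)\<^sup>2))"
  proof (rule wpa1_combine[OF wpa1_of_events[OF A(1) A(2)] wpa1_of_events[OF E E1]])
    \<comment> \<open>With this threshold the residual correlation, at most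
      \<open>2 * Cb * e n\<close>, uses \<open>r n / 4\<close>; the other \<open>r n / 4\<close> is
      left to the random part.\<close>
    have a1: "1 / (8 * Cb) > 0" using Cb by simp
    show "\<forall>\<^sub>F n in sequentially. \<forall>\<omega>\<in>space M. \<omega> \<in> A n \<longrightarrow> \<omega> \<in> E n \<longrightarrow>
      approx_err (p n) (rh n (obs (N n) \<omega>)) \<le> K * (r n / eps p n)\<^sup>2 * (val n + (eps p n)\<^sup>2)"
      using small_e[OF a1] small_e[OF one] eventually_ge_at_top[of 1] ev_ks card
    proof eventually_elim
      case (elim n)
      have n: "n \<ge> 1" and e: "e n > 0" using elim e_pos by auto
      let ?N = "real (card (N n))"
      have cN: "?N > 0"
      proof -
        have "real n / 4 > 0" using n by simp
        then show ?thesis using elim by linarith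
      qed
      show ?case
      proof (intro ballI impI)
        fix \<omega> assume w: "\<omega> \<in> space M" "\<omega> \<in> A n" "\<omega> \<in> E n"
        let ?d = "obs (N n) \<omega>"
        have ds: "?d \<in> space (PiM (N n) (\<lambda>_. F))" by (rule measurable_space[OF obs_measurable w(1)])
        have mom: "\<bar>M_hat m b (N n) ?d j - (\<Sum>k<p n. G_hat X b (N n) ?d j k * \<rho> n k)\<bar> \<le> r n / 2" if j: "j < p n" for j
        proof -
          define v where "v = resid_corr (p n) (\<rho> n) j"
          have v: "\<bar>v\<bar> \<le> r n / 4" using \<rho>2[OF n j] elim(1) Cb by (simp add: v_def field_simps)
          have "M_hat m b (N n) ?d j - (\<Sum>k<p n. G_hat X b (N n) ?d j k * \<rho> n k) = (T n j \<omega> + ?N * v) / ?N"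
            unfolding moment_residual_mean T_def v_def by (simp add: sum_subtractf)
          also have "\<dots> = T n j \<omega> / ?N + v" using cN by (simp add: add_divide_distrib)
          finally have eq: "M_hat m b (N n) ?d j - (\<Sum>k<p n. G_hat X b (N n) ?d j k * \<rho> n k) = T n j \<omega> / ?N + v" .
          have "\<bar>T n j \<omega>\<bar> < ?N * (r n / 4)" using w j by (auto simp: E_def)
          then have "\<bar>T n j \<omega> / ?N\<bar> \<le> r n / 4" using cN by (simp add: pos_divide_le_eq mult.commute)
          then show ?thesis unfolding eq using v by linarith
        qed
        have "approx_err (p n) (rh n ?d) \<le> 2 * approx_err (p n) (\<rho> n) + 180 * \<Lambda> * (r n)\<^sup>2 * real (k n) / c\<^sup>2"
          by (rule lasso_error_bound[OF A(3)[OF w(2)] c r[of n] eig(1)[of n] eig(2) mom opt[OF ds]])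
            (use k_prop[OF n] elim S_def in auto)
        also have "\<dots> \<le> 2 * ((r n / e n)\<^sup>2 * U n) + 360 * \<Lambda> / c\<^sup>2 * ((r n / e n)\<^sup>2 * U n)"
        proof (rule add_mono)
          have U1: "0 \<le> U n" using Ue[of n] zero_le_power2[of "e n"] by linarith
          have "1 \<le> r n / e n" using elim(2) e by simp
          then have "1 \<le> (r n / e n)\<^sup>2" by (rule one_le_power)
          from mult_right_mono[OF this U1] show "2 * approx_err (p n) (\<rho> n) \<le> 2 * ((r n / e n)\<^sup>2 * U n)"
            using err[OF n] by simp
          have "real (k n) * (e n)\<^sup>2 \<le> 2 * U n" using k_prop[OF n] by blast
          then have "real (k n) \<le> 2 * U n / (e n)\<^sup>2" using e by (simp add: pos_le_divide_eq)
          then have "180 * \<Lambda> * (r n)\<^sup>2 * real (k n) / c\<^sup>2 \<le> 180 * \<Lambda> * (r n)\<^sup>2 * (2 * U n / (e n)\<^sup>2) / c\<^sup>2"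
            using eig(2) by (intro divide_right_mono mult_left_mono) auto
          also have "\<dots> = 360 * \<Lambda> / c\<^sup>2 * ((r n / e n)\<^sup>2 * U n)" by (simp add: power_divide mult_ac)
          finally show "180 * \<Lambda> * (r n)\<^sup>2 * real (k n) / c\<^sup>2 \<le> 360 * \<Lambda> / c\<^sup>2 * ((r n / e n)\<^sup>2 * U n)" .
        qed
        also have "\<dots> = K * (r n / eps p n)\<^sup>2 * (val n + (eps p n)\<^sup>2)"
          by (simp add: K_def U_def e_def distrib_right)
        finally show "approx_err (p n) (rh n ?d) \<le> K * (r n / eps p n)\<^sup>2 * (val n + (eps p n)\<^sup>2)" .
      qed
    qed
  qed
  then show ?thesis using Kp by blast
qed

end

section \<open>Remainder of one fold\<close>

text \<open>Cauchy--Schwarz in terms of given bounds for the norms, by the weighted inequality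
  between arithmetic and geometric mean. The weights \<open>B / (2 * A)\<close> and
  \<open>A / (2 * B)\<close> split \<open>A * B\<close> into equal halves.\<close>

lemma (in prob_space) integral_abs_mult_le:
  fixes f g :: "'a \<Rightarrow> real"
  assumes [measurable]: "f \<in> borel_measurable M" "g \<in> borel_measurable M"
    and i: "integrable M (\<lambda>x. (f x)\<^sup>2)" "integrable M (\<lambda>x. (g x)\<^sup>2)"
    and le: "(LINT x|M. (f x)\<^sup>2) \<le> A\<^sup>2" "(LINT x|M. (g x)\<^sup>2) \<le> B\<^sup>2" and "A > 0" "B > 0"
  shows "integrable M (\<lambda>x. \<bar>f x\<bar> * \<bar>g x\<bar>)" "(LINT x|M. \<bar>f x\<bar> * \<bar>g x\<bar>) \<le> A * B"
proof -
  show int: "integrable M (\<lambda>x. \<bar>f x\<bar> * \<bar>g x\<bar>)"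
    by (rule integrable_mult_of_sq) (use i in auto)
  have "(LINT x|M. \<bar>f x\<bar> * \<bar>g x\<bar>) \<le> (LINT x|M. B / (2 * A) * (f x)\<^sup>2 + A / (2 * B) * (g x)\<^sup>2)"
  proof (rule integral_mono[OF int])
    fix x
    have "0 \<le> (B * \<bar>f x\<bar> - A * \<bar>g x\<bar>)\<^sup>2" by simp
    then have "2 * A * B * (\<bar>f x\<bar> * \<bar>g x\<bar>) \<le> B\<^sup>2 * (f x)\<^sup>2 + A\<^sup>2 * (g x)\<^sup>2"
      by (simp add: power2_diff power_mult_distrib algebra_simps)
    then have "\<bar>f x\<bar> * \<bar>g x\<bar> \<le> (B\<^sup>2 * (f x)\<^sup>2 + A\<^sup>2 * (g x)\<^sup>2) / (2 * A * B)"
      using assms by (simp add: pos_le_divide_eq mult.commute)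
    also have "\<dots> = B / (2 * A) * (f x)\<^sup>2 + A / (2 * B) * (g x)\<^sup>2"
      using assms by (simp add: field_simps power2_eq_square)
    finally show "\<bar>f x\<bar> * \<bar>g x\<bar> \<le> B / (2 * A) * (f x)\<^sup>2 + A / (2 * B) * (g x)\<^sup>2" .
  qed (use i in auto)
  also have "\<dots> = B / (2 * A) * (LINT x|M. (f x)\<^sup>2) + A / (2 * B) * (LINT x|M. (g x)\<^sup>2)" using i by simp
  also have "\<dots> \<le> B / (2 * A) * A\<^sup>2 + A / (2 * B) * B\<^sup>2"
    using assms by (intro add_mono mult_left_mono) auto
  also have "\<dots> = A * B" using assms by (simp add: power2_eq_square)
  finally show "(LINT x|M. \<bar>f x\<bar> * \<bar>g x\<bar>) \<le> A * B" .
qed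

text \<open>The targeting step makes \<open>\<Sum>a (y - g - k a)\<close> vanish; adding it to the plug-in sum debiases it.\<close>

lemma tml_expansion:
  fixes mg ma mc a al g c y :: "'i \<Rightarrow> real"
  assumes "(\<Sum>i\<in>J. (a i)\<^sup>2) \<noteq> 0" and k: "k = (\<Sum>i\<in>J. a i * (y i - g i)) / (\<Sum>i\<in>J. (a i)\<^sup>2)"
  shows "(\<Sum>i\<in>J. mg i + k * ma i) - (\<Sum>i\<in>J. mc i + al i * (y i - c i)) =
    (\<Sum>i\<in>J. mg i - mc i - al i * (g i - c i)) + k * (\<Sum>i\<in>J. ma i - al i * a i)
    + (\<Sum>i\<in>J. (a i - al i) * (y i - c i)) - (\<Sum>i\<in>J. (a i - al i) * (g i - c i))
    - k * (\<Sum>i\<in>J. (a i - al i) * a i)"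
proof -
  have "(\<Sum>i\<in>J. a i * (y i - g i)) - k * (\<Sum>i\<in>J. (a i)\<^sup>2) = 0" using assms by simp
  then have z: "(\<Sum>i\<in>J. a i * (y i - g i) - k * (a i)\<^sup>2) = 0" by (simp only: sum_subtractf sum_distrib_left)
  have "(\<Sum>i\<in>J. mg i + k * ma i) - (\<Sum>i\<in>J. mc i + al i * (y i - c i)) =
    (\<Sum>i\<in>J. mg i + k * ma i - (mc i + al i * (y i - c i))) + (\<Sum>i\<in>J. a i * (y i - g i) - k * (a i)\<^sup>2)"
    unfolding z by (simp only: sum_subtractf add_0_right)
  also have "\<dots> = (\<Sum>i\<in>J. (mg i - mc i - al i * (g i - c i)) + k * (ma i - al i * a i)
    + (a i - al i) * (y i - c i) - (a i - al i) * (g i - c i) - k * ((a i - al i) * a i))"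
    unfolding sum.distrib[symmetric] by (intro sum.cong refl) (simp add: algebra_simps power2_eq_square)
  also have "\<dots> = (\<Sum>i\<in>J. mg i - mc i - al i * (g i - c i)) + k * (\<Sum>i\<in>J. ma i - al i * a i)
    + (\<Sum>i\<in>J. (a i - al i) * (y i - c i)) - (\<Sum>i\<in>J. (a i - al i) * (g i - c i))
    - k * (\<Sum>i\<in>J. (a i - al i) * a i)"
    by (simp only: sum_distrib_left[symmetric] sum.distrib sum_subtractf)
  finally show ?thesis .
qed

lemma linear_functional_lin_comb:
  assumes lin: "linear_functional_on D \<phi>" and b: "\<And>j. b j \<in> D" and lc: "\<And>p. lin_comb b p \<rho> \<in> D"
  shows "\<phi> (lin_comb b p \<rho>) = (\<Sum>j<p. \<rho> j * \<phi> (b j))"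
proof (induction p)
  case 0
  have "\<phi> (\<lambda>x. 0 * b 0 x + 0 * b 0 x) = 0 * \<phi> (b 0) + 0 * \<phi> (b 0)"
    using lin b unfolding linear_functional_on_def by blast
  then show ?case by (simp add: lin_comb_def[abs_def])
next
  case (Suc p)
  have "\<phi> (\<lambda>x. 1 * lin_comb b p \<rho> x + \<rho> p * b p x) = 1 * \<phi> (lin_comb b p \<rho>) + \<rho> p * \<phi> (b p)"
    using lin b lc unfolding linear_functional_on_def by blast
  moreover have "lin_comb b (Suc p) \<rho> = (\<lambda>x. 1 * lin_comb b p \<rho> x + \<rho> p * b p x)" by (auto simp: lin_comb_def)
  ultimately show ?case using Suc by simp
qed

text \<open>The hypotheses in the form the remainder bounds consume: orthogonality relations in
  place of minimization over the subspace, an unconditional bound in place of the conditional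
  variance, and second moments of the functional on the dictionary only.\<close>

locale debiased_regression = riesz_regression M F W MX X m b \<alpha> Cb
  for M :: "'a measure" and F :: "'w measure" and W and MX :: "'x measure" and X :: "'w \<Rightarrow> 'x"
    and m :: "'w \<Rightarrow> ('x \<Rightarrow> real) \<Rightarrow> real" and b :: "nat \<Rightarrow> 'x \<Rightarrow> real" and \<alpha> :: "'x \<Rightarrow> real" and Cb :: real +
  fixes Y :: "'w \<Rightarrow> real" and \<gamma> :: "'x \<Rightarrow> real" and C\<alpha> Cv C2 :: real
  assumes Y [measurable]: "Y \<in> borel_measurable F" and Y_sq: "integrable F (\<lambda>w. (Y w)\<^sup>2)"
    and \<gamma>_measurable [measurable]: "\<gamma> \<in> borel_measurable MX" and \<gamma>_sq: "integrable F (\<lambda>w. (\<gamma> (X w))\<^sup>2)"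
    and m_linear: "\<And>w. w \<in> space F \<Longrightarrow> linear_functional_on (sq_integrable_funs F MX X) (m w)"
    and m_\<gamma>_measurable [measurable]: "(\<lambda>w. m w \<gamma>) \<in> borel_measurable F"
    and m_\<gamma>_sq: "integrable F (\<lambda>w. (m w \<gamma>)\<^sup>2)"
    and m_\<gamma>_riesz: "(LINT w|F. m w \<gamma>) = (LINT w|F. \<alpha> (X w) * \<gamma> (X w))"
    and b_orth: "\<And>j. (LINT w|F. b j (X w) * (Y w - \<gamma> (X w))) = 0"
    and \<alpha>_orth: "(LINT w|F. \<alpha> (X w) * (Y w - \<gamma> (X w))) = 0"
    and \<alpha>_bounded: "AE w in F. \<bar>\<alpha> (X w)\<bar> \<le> C\<alpha>" and C\<alpha>: "C\<alpha> > 0"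
    and resid_var: "\<And>a B. a \<in> borel_measurable MX \<Longrightarrow> AE w in F. \<bar>a (X w)\<bar> \<le> B \<Longrightarrow>
        integrable F (\<lambda>w. (a (X w) * (Y w - \<gamma> (X w)))\<^sup>2) \<and>
        (LINT w|F. (a (X w) * (Y w - \<gamma> (X w)))\<^sup>2) \<le> Cv * (LINT w|F. (a (X w))\<^sup>2)" and Cv: "Cv > 0"
    and m_lin_sq: "\<And>p \<rho>. integrable F (\<lambda>w. (\<Sum>j<p. \<rho> j * m w (b j))\<^sup>2) \<and>
        (LINT w|F. (\<Sum>j<p. \<rho> j * m w (b j))\<^sup>2) \<le> C2 * (LINT w|F. (lin_comb b p \<rho> (X w))\<^sup>2)" and C2: "C2 > 0"
    and \<alpha>_nonzero: "(LINT w|F. (\<alpha> (X w))\<^sup>2) > 0"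
begin

text \<open>The limit of the targeting denominator per observation.\<close>

definition \<kappa> :: real where "\<kappa> = (LINT w|F. (\<alpha> (X w))\<^sup>2)"

text \<open>The parameter itself is not subtracted: it would enter both sums alike and
  cancel.\<close>

definition fold_remainder :: "nat set \<Rightarrow> ('x \<Rightarrow> real) \<Rightarrow> ('x \<Rightarrow> real) \<Rightarrow> 'a \<Rightarrow> real" where
  "fold_remainder J g a \<omega> = (\<Sum>i\<in>J. m (W i \<omega>) (gamma_tilde X Y J g a (\<lambda>i. W i \<omega>)))
     - (\<Sum>i\<in>J. m (W i \<omega>) \<gamma> + \<alpha> (X (W i \<omega>)) * (Y (W i \<omega>) - \<gamma> (X (W i \<omega>))))"

lemma lin_comb_sq_integrable_funs: "lin_comb b p \<rho> \<in> sq_integrable_funs F MX X"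
  using lin_comb_sq by (simp add: sq_integrable_funs_def)

lemma b_sq_integrable_funs: "b j \<in> sq_integrable_funs F MX X"
  using b_sq by (simp add: sq_integrable_funs_def)

lemma m_add:
  assumes "w \<in> space F" "g \<in> sq_integrable_funs F MX X" "h \<in> sq_integrable_funs F MX X"
  shows "m w (\<lambda>x. g x + k * h x) = m w g + k * m w h"
proof -
  have "m w (\<lambda>x. 1 * g x + k * h x) = 1 * m w g + k * m w h"
    using m_linear[OF assms(1)] assms(2,3) unfolding linear_functional_on_def by blast
  then show ?thesis by simp
qed

text \<open>The remainder bounds work with the sum in place of the functional. It is visibly
  measurable jointly in the coefficients and the observation, and the two agree on the space of
  \<open>F\<close>.\<close>

lemma m_lin_comb:
  assumes "w \<in> space F"
  shows "m w (lin_comb b p \<rho>) = (\<Sum>j<p. \<rho> j * m w (b j))"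
  by (rule linear_functional_lin_comb[OF m_linear[OF assms] b_sq_integrable_funs lin_comb_sq_integrable_funs])

lemma m_b_integrable: "integrable F (\<lambda>w. m w (b j))"
proof (rule F.square_integrable_imp_integrable)
  \<comment> \<open>Second moments are available for linear combinations; the \<open>j\<close>-th
    unit vector of length \<open>Suc j\<close> singles out \<open>b j\<close>.\<close>
  have "(\<Sum>i<Suc j. (if i = j then 1 else 0) * m w (b i)) = m w (b j)" for w
    by (simp add: sum.delta if_distrib[of "\<lambda>x. x * _"] cong: if_cong)
  then show "integrable F (\<lambda>w. (m w (b j))\<^sup>2)" using m_lin_sq[where p="Suc j" and \<rho>="\<lambda>i. if i = j then 1 else 0"] by simp
qed measurable

lemma resid_sq: "integrable F (\<lambda>w. (Y w - \<gamma> (X w))\<^sup>2)"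
  using F.integrable_sq_add(1)[of Y "\<lambda>w. - \<gamma> (X w)"] Y_sq \<gamma>_sq by simp

lemma \<alpha>_mult_integrable:
  assumes "g \<in> borel_measurable F" "integrable F (\<lambda>w. (g w)\<^sup>2)"
  shows "integrable F (\<lambda>w. \<alpha> (X w) * g w)"
  by (rule F.integrable_mult_of_sq) (use assms \<alpha>_sq in auto)

lemma \<alpha>_mult_sq:
  assumes [measurable]: "g \<in> borel_measurable F" and g: "integrable F (\<lambda>w. (g w)\<^sup>2)"
  shows "integrable F (\<lambda>w. (\<alpha> (X w) * g w)\<^sup>2)"
    and "(LINT w|F. (\<alpha> (X w) * g w)\<^sup>2) \<le> C\<alpha>\<^sup>2 * (LINT w|F. (g w)\<^sup>2)"
proof -
  have le: "AE w in F. (\<alpha> (X w) * g w)\<^sup>2 \<le> C\<alpha>\<^sup>2 * (g w)\<^sup>2"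
    using \<alpha>_bounded
  proof eventually_elim
    case (elim w)
    have "\<bar>\<alpha> (X w)\<bar>\<^sup>2 \<le> C\<alpha>\<^sup>2" by (rule power_mono[OF elim]) simp
    then show ?case by (simp add: power_mult_distrib mult_right_mono)
  qed
  show i: "integrable F (\<lambda>w. (\<alpha> (X w) * g w)\<^sup>2)"
    by (rule Bochner_Integration.integrable_bound[where f="\<lambda>w. C\<alpha>\<^sup>2 * (g w)\<^sup>2"]) (use g le in auto)
  have "(LINT w|F. (\<alpha> (X w) * g w)\<^sup>2) \<le> (LINT w|F. C\<alpha>\<^sup>2 * (g w)\<^sup>2)"
    by (rule integral_mono_AE[OF i]) (use g le in auto)
  then show "(LINT w|F. (\<alpha> (X w) * g w)\<^sup>2) \<le> C\<alpha>\<^sup>2 * (LINT w|F. (g w)\<^sup>2)" by simp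
qed

lemma integral_lin_comb_resid: "(LINT w|F. lin_comb b p \<rho> (X w) * (Y w - \<gamma> (X w))) = 0"
proof -
  have i: "integrable F (\<lambda>w. b j (X w) * (Y w - \<gamma> (X w)))" for j
    by (rule F.integrable_mult_of_sq) (use b_sq resid_sq in auto)
  have "lin_comb b p \<rho> (X w) * (Y w - \<gamma> (X w)) = (\<Sum>j<p. \<rho> j * (b j (X w) * (Y w - \<gamma> (X w))))" for w
    by (simp add: lin_comb_def sum_distrib_right mult.assoc)
  then show ?thesis using i b_orth by simp
qed

lemma integral_m_lin_comb: "(LINT w|F. (\<Sum>j<p. \<rho> j * m w (b j)) - \<alpha> (X w) * lin_comb b p \<rho> (X w)) = 0"
proof -
  have i: "integrable F (\<lambda>w. \<alpha> (X w) * b j (X w))" for j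
    by (rule \<alpha>_mult_integrable) (use b_sq in auto)
  have "(\<Sum>j<p. \<rho> j * m w (b j)) - \<alpha> (X w) * lin_comb b p \<rho> (X w) = (\<Sum>j<p. \<rho> j * (m w (b j) - \<alpha> (X w) * b j (X w)))" for w
    by (simp add: lin_comb_def sum_distrib_left sum_subtractf right_diff_distrib mult_ac)
  then show ?thesis using i m_b_integrable m_b_riesz by simp
qed

lemma approx_err_commute: "(LINT w|F. (lin_comb b p \<rho> (X w) - \<alpha> (X w))\<^sup>2) = approx_err p \<rho>"
  and residual_sq': "integrable F (\<lambda>w. (lin_comb b p \<rho> (X w) - \<alpha> (X w))\<^sup>2)"
proof -
  have sq: "(lin_comb b p \<rho> (X w) - \<alpha> (X w))\<^sup>2 = (\<alpha> (X w) - lin_comb b p \<rho> (X w))\<^sup>2" for w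
    by (rule power2_commute)
  show "(LINT w|F. (lin_comb b p \<rho> (X w) - \<alpha> (X w))\<^sup>2) = approx_err p \<rho>"
    unfolding sq by (simp add: approx_err_def)
  show "integrable F (\<lambda>w. (lin_comb b p \<rho> (X w) - \<alpha> (X w))\<^sup>2)"
    unfolding sq by (rule residual_sq)
qed

text \<open>Prepares the lower bound of the targeting denominator. Boundedness of
  \<open>\<alpha>\<close> supplies the fourth moment, and positivity of \<open>\<kappa>\<close>
  makes half the mean an admissible deviation.\<close>

lemma \<alpha>_sq_chebyshev:
  assumes "finite J" "card J > 0"
  shows "prob {\<omega>\<in>space M. \<bar>\<Sum>i\<in>J. (\<alpha> (X (W i \<omega>)))\<^sup>2 - \<kappa>\<bar> \<ge> \<kappa> * real (card J) / 2} \<le> 4 * C\<alpha>^4 / (\<kappa>\<^sup>2 * real (card J))"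
proof -
  have k0: "\<kappa> > 0" using \<alpha>_nonzero by (simp add: \<kappa>_def)
  have b4: "AE w in F. ((\<alpha> (X w))\<^sup>2)\<^sup>2 \<le> C\<alpha>^4"
    using \<alpha>_bounded
  proof eventually_elim
    case (elim w)
    have "\<bar>\<alpha> (X w)\<bar>^4 \<le> C\<alpha>^4" by (rule power_mono[OF elim]) simp
    then show ?case by (simp add: power_mult[symmetric])
  qed
  have i4: "integrable F (\<lambda>w. ((\<alpha> (X w))\<^sup>2)\<^sup>2)"
    by (rule F.integrable_const_bound[where B="C\<alpha>^4"]) (use b4 in auto)
  have i: "integrable F (\<lambda>w. ((\<alpha> (X w))\<^sup>2 - \<kappa>)\<^sup>2)" using i4 \<alpha>_sq by (simp add: power2_diff)
  have "(LINT w|F. ((\<alpha> (X w))\<^sup>2 - \<kappa>)\<^sup>2) = (LINT w|F. ((\<alpha> (X w))\<^sup>2)\<^sup>2) - \<kappa>\<^sup>2"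
    using F.variance_eq[OF \<alpha>_sq i4] by (simp add: \<kappa>_def)
  also have "\<dots> \<le> (LINT w|F. ((\<alpha> (X w))\<^sup>2)\<^sup>2)" by simp
  also have "\<dots> \<le> (LINT w|F. C\<alpha>^4)" by (rule integral_mono_AE[OF i4]) (use b4 in auto)
  finally have v: "(LINT w|F. ((\<alpha> (X w))\<^sup>2 - \<kappa>)\<^sup>2) \<le> C\<alpha>^4" by (simp add: F.prob_space)
  have "prob {\<omega>\<in>space M. \<bar>\<Sum>i\<in>J. (\<alpha> (X (W i \<omega>)))\<^sup>2 - \<kappa>\<bar> \<ge> \<kappa> * real (card J) / 2}
    \<le> real (card J) * (LINT w|F. ((\<alpha> (X w))\<^sup>2 - \<kappa>)\<^sup>2) / (\<kappa> * real (card J) / 2)\<^sup>2"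
    by (rule prob_sum_chebyshev[of "\<lambda>w. (\<alpha> (X w))\<^sup>2 - \<kappa>"]) (use i \<alpha>_sq assms k0 in \<open>auto simp: F.prob_space \<kappa>_def\<close>)
  also have "\<dots> \<le> real (card J) * C\<alpha>^4 / (\<kappa> * real (card J) / 2)\<^sup>2"
    using v by (intro divide_right_mono mult_left_mono) auto
  also have "\<dots> = 4 * C\<alpha>^4 / (\<kappa>\<^sup>2 * real (card J))" using assms k0 by (simp add: field_simps power2_eq_square)
  finally show ?thesis .
qed

end

context debiased_regression
begin

text \<open>\<open>T\<close> is a large constant for terms that are merely bounded in probability,
  \<open>e\<close> a small one for terms that must vanish. The nine summands of the failure
  probability belong to \<open>f1\<close>, ..., \<open>f8\<close> and the sum of squares of
  \<open>\<alpha>\<close>, in this order. \<open>cond\<close> compares the numerator of the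
  targeting coefficient times its two factors with the lower bound for its denominator. The four
  multiples of \<open>e\<close> come from \<open>f1\<close>, \<open>f3\<close>, \<open>f4\<close>
  and the terms carrying the targeting coefficient.\<close>

lemma fold_remainder_bound:
  fixes g :: "(nat \<Rightarrow> 'w) \<Rightarrow> 'x \<Rightarrow> real" and \<rho>h :: "(nat \<Rightarrow> 'w) \<Rightarrow> nat \<Rightarrow> real" and n :: real
  assumes disj: "N \<inter> J = {}" "finite J" and J: "card J > 0" and nJ: "real (card J) \<le> n"
    and g_meas: "(\<lambda>(d, x). g d x) \<in> borel_measurable (PiM N (\<lambda>_. F) \<Otimes>\<^sub>M MX)"
    and mg_meas: "(\<lambda>(d, w). m w (g d)) \<in> borel_measurable (PiM N (\<lambda>_. F) \<Otimes>\<^sub>M F)"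
    and \<rho>_meas: "\<And>j. j < p \<Longrightarrow> (\<lambda>d. \<rho>h d j) \<in> borel_measurable (PiM N (\<lambda>_. F))"
    and B: "B \<in> sets (PiM N (\<lambda>_. F))"
    and g_sq: "\<And>d. d \<in> B \<Longrightarrow> integrable F (\<lambda>w. (g d (X w) - \<gamma> (X w))\<^sup>2) \<and> (LINT w|F. (g d (X w) - \<gamma> (X w))\<^sup>2) \<le> G\<^sup>2"
    and mg_sq: "\<And>d. d \<in> B \<Longrightarrow> integrable F (\<lambda>w. (m w (g d) - m w \<gamma>)\<^sup>2) \<and> (LINT w|F. (m w (g d) - m w \<gamma>)\<^sup>2) \<le> \<tau>"
    and g_riesz: "\<And>d. d \<in> B \<Longrightarrow> (LINT w|F. m w (g d)) = (LINT w|F. \<alpha> (X w) * g d (X w))"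
    and a_err: "\<And>d. d \<in> B \<Longrightarrow> approx_err p (\<rho>h d) \<le> A\<^sup>2"
    and G: "G > 0" and A: "A > 0" "A \<le> 1" and \<tau>: "\<tau> \<ge> 0" and e: "e > 0" and T: "T > 0"
    and cond: "(T * sqrt n + T * n * G) * (T * sqrt n + T * n * A) \<le> e * sqrt n * (\<kappa> * real (card J) / 8)"
  defines "S \<equiv> 2 * \<kappa> + 2"
  shows "whp ((2 * \<tau> + 2 * C\<alpha>\<^sup>2 * G\<^sup>2) / e\<^sup>2 + 2 * (C2 + C\<alpha>\<^sup>2) * S / T\<^sup>2 + Cv * A\<^sup>2 / e\<^sup>2 + sqrt n * A * G / e
        + sqrt S / T + Cv * S / T\<^sup>2 + sqrt S / T + 8 * A\<^sup>2 / \<kappa> + 4 * C\<alpha>^4 / (\<kappa>\<^sup>2 * real (card J)))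
      (\<lambda>\<omega>. obs N \<omega> \<in> B \<longrightarrow>
        \<bar>fold_remainder J (g (obs N \<omega>)) (lin_comb b p (\<rho>h (obs N \<omega>))) \<omega>\<bar> < 4 * e * sqrt n)"
proof -
  let ?P = "PiM N (\<lambda>_. F)"
  have k0: "\<kappa> > 0" using \<alpha>_nonzero by (simp add: \<kappa>_def)
  have S0: "S > 0" using k0 by (simp add: S_def)
  have cJ: "real (card J) > 0" using J by simp
  have n0: "n > 0" using cJ nJ by linarith
  have sn: "sqrt n > 0" "sqrt n * sqrt n = n" using n0 by auto
  \<comment> \<open>Deviations are measured against the full sample size, so that the Chebyshev
    bounds are free of the fold size.\<close>
  have scale: "real (card J) * v / (x * sqrt n)\<^sup>2 \<le> v / x\<^sup>2" if "v \<ge> 0" "x > 0" for v x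
  proof -
    have "real (card J) * v / (x * sqrt n)\<^sup>2 \<le> n * v / (x * sqrt n)\<^sup>2"
      using nJ that by (intro divide_right_mono mult_right_mono) auto
    also have "\<dots> = v / x\<^sup>2" using n0 by (simp add: power_mult_distrib)
    finally show ?thesis .
  qed
  have cancel: "s * s * x / (y * s) = s * x / y" if "s \<noteq> 0" for s x y :: real
    using that by (cases "y = 0") (auto simp: field_simps)
  note [measurable] = g_meas mg_meas
  have dS: "d \<in> space ?P" if "d \<in> B" for d using that sets.sets_into_space[OF B] by auto
  define a where "a d w = lin_comb b p (\<rho>h d) (X w)" for d w
  have gj [measurable]: "(\<lambda>x. g (fst x) (X (snd x))) \<in> borel_measurable (?P \<Otimes>\<^sub>M F)"
  proof -
    have "(\<lambda>x. (fst x, X (snd x))) \<in> measurable (?P \<Otimes>\<^sub>M F) (?P \<Otimes>\<^sub>M MX)" by measurable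
    from measurable_compose[OF this g_meas] show ?thesis by simp
  qed
  have mgj [measurable]: "(\<lambda>x. m (snd x) (g (fst x))) \<in> borel_measurable (?P \<Otimes>\<^sub>M F)"
    using mg_meas by (simp add: split_beta)
  have \<rho>j: "(\<lambda>x. \<rho>h (fst x) j) \<in> borel_measurable (?P \<Otimes>\<^sub>M F)" if "j < p" for j
    by (rule measurable_compose[OF measurable_fst \<rho>_meas[OF that]])
  have aj [measurable]: "(\<lambda>x. a (fst x) (snd x)) \<in> borel_measurable (?P \<Otimes>\<^sub>M F)"
    unfolding a_def lin_comb_def using \<rho>j by (intro borel_measurable_sum borel_measurable_times) auto
  have maj [measurable]: "(\<lambda>x. \<Sum>j<p. \<rho>h (fst x) j * m (snd x) (b j)) \<in> borel_measurable (?P \<Otimes>\<^sub>M F)"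
    using \<rho>j by (intro borel_measurable_sum borel_measurable_times) auto
  have gd [measurable]: "g d \<in> borel_measurable MX" if "d \<in> B" for d
    using measurable_Pair2[OF g_meas dS[OF that]] by simp
  have mgd [measurable]: "(\<lambda>w. m w (g d)) \<in> borel_measurable F" if "d \<in> B" for d
    using measurable_Pair2[OF mg_meas dS[OF that]] by simp
  have ad [measurable]: "a d \<in> borel_measurable F" for d unfolding a_def by measurable
  have a_sq: "integrable F (\<lambda>w. (a d w)\<^sup>2)" for d unfolding a_def by (rule lin_comb_sq)
  have aS: "(LINT w|F. (a d w)\<^sup>2) \<le> S" if "d \<in> B" for d
  proof -
    have "(LINT w|F. (a d w)\<^sup>2) \<le> 2 * \<kappa> + 2 * approx_err p (\<rho>h d)"
      using quad_form_gram_le[of p "\<rho>h d"] by (simp add: a_def integral_lin_comb_sq \<kappa>_def)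
    moreover have "A\<^sup>2 \<le> 1" using A by (simp add: power_le_one)
    ultimately show ?thesis using a_err[OF that] by (simp add: S_def)
  qed
  have r_sq: "integrable F (\<lambda>w. (a d w - \<alpha> (X w))\<^sup>2)" for d unfolding a_def by (rule residual_sq')
  have rA: "(LINT w|F. (a d w - \<alpha> (X w))\<^sup>2) \<le> A\<^sup>2" if "d \<in> B" for d
    using a_err[OF that] by (simp add: a_def approx_err_commute)
  have S_sqrt: "(LINT w|F. (a d w)\<^sup>2) \<le> (sqrt S)\<^sup>2" if "d \<in> B" for d using aS[OF that] S0 by simp
  have ab: "AE w in F. \<bar>a d w\<bar> \<le> Cb * (\<Sum>j<p. \<bar>\<rho>h d j\<bar>)" for d unfolding a_def by (rule lin_comb_bound)

  \<comment> \<open>Plug-in error of the learner minus its Riesz representation. Both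
    \<open>g d\<close> and \<open>\<gamma>\<close> satisfy the representation, so the mean given the
    training data is 0; the variance is small with \<open>\<tau>\<close> and
    \<open>G\<close>.\<close>
  define f1 where "f1 d w = m w (g d) - m w \<gamma> - \<alpha> (X w) * (g d (X w) - \<gamma> (X w))" for d w
  have h1: "whp ((2 * \<tau> + 2 * C\<alpha>\<^sup>2 * G\<^sup>2) / e\<^sup>2) (\<lambda>\<omega>. obs N \<omega> \<in> B \<longrightarrow> \<bar>\<Sum>i\<in>J. f1 (obs N \<omega>) (W i \<omega>)\<bar> < e * sqrt n)"
    unfolding f1_def
  proof (rule whp_conditional_chebyshev[OF disj _ B])
    show "(\<lambda>(d, w). m w (g d) - m w \<gamma> - \<alpha> (X w) * (g d (X w) - \<gamma> (X w))) \<in> borel_measurable (?P \<Otimes>\<^sub>M F)"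
      unfolding split_beta by measurable
    fix d assume d: "d \<in> B"
    note [measurable] = gd[OF d] mgd[OF d]
    define u where "u w = g d (X w) - \<gamma> (X w)" for w
    define v where "v w = m w (g d) - m w \<gamma>" for w
    have [measurable]: "u \<in> borel_measurable F" "v \<in> borel_measurable F" unfolding u_def v_def by measurable
    have u2: "integrable F (\<lambda>w. (u w)\<^sup>2)" "(LINT w|F. (u w)\<^sup>2) \<le> G\<^sup>2" using g_sq[OF d] by (auto simp: u_def)
    have v2: "integrable F (\<lambda>w. (v w)\<^sup>2)" "(LINT w|F. (v w)\<^sup>2) \<le> \<tau>" using mg_sq[OF d] by (auto simp: v_def)
    have "integrable F v" using F.square_integrable_imp_integrable[OF _ v2(1)] by simp
    have im: "integrable F (\<lambda>w. m w \<gamma>)" using F.square_integrable_imp_integrable[OF _ m_\<gamma>_sq] by simp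
    have img: "integrable F (\<lambda>w. m w (g d))"
      using Bochner_Integration.integrable_add[OF \<open>integrable F v\<close> im] by (simp add: v_def)
    have iau: "integrable F (\<lambda>w. \<alpha> (X w) * u w)" by (rule \<alpha>_mult_integrable) (use u2 in auto)
    have iac: "integrable F (\<lambda>w. \<alpha> (X w) * \<gamma> (X w))" by (rule \<alpha>_mult_integrable) (use \<gamma>_sq in auto)
    have iag: "integrable F (\<lambda>w. \<alpha> (X w) * g d (X w))"
      using Bochner_Integration.integrable_add[OF iau iac] by (simp add: u_def algebra_simps)
    have "(LINT w|F. v w - \<alpha> (X w) * u w) = (LINT w|F. m w (g d)) - (LINT w|F. m w \<gamma>)
       - ((LINT w|F. \<alpha> (X w) * g d (X w)) - (LINT w|F. \<alpha> (X w) * \<gamma> (X w)))"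
      using img im iag iac by (simp add: v_def u_def right_diff_distrib)
    then have mean: "(LINT w|F. v w - \<alpha> (X w) * u w) = 0" using g_riesz[OF d] m_\<gamma>_riesz by simp
    have i: "integrable F (\<lambda>w. (v w + (- (\<alpha> (X w) * u w)))\<^sup>2)"
      by (rule F.integrable_sq_add(1)) (use v2 \<alpha>_mult_sq(1)[OF _ u2(1)] in auto)
    have "(LINT w|F. (v w + (- (\<alpha> (X w) * u w)))\<^sup>2) \<le> 2 * (LINT w|F. (v w)\<^sup>2) + 2 * (LINT w|F. (- (\<alpha> (X w) * u w))\<^sup>2)"
      by (rule F.integrable_sq_add(2)) (use v2 \<alpha>_mult_sq(1)[OF _ u2(1)] in auto)
    also have "(LINT w|F. (- (\<alpha> (X w) * u w))\<^sup>2) = (LINT w|F. (\<alpha> (X w) * u w)\<^sup>2)" by simp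
    also have "\<dots> \<le> C\<alpha>\<^sup>2 * (LINT w|F. (u w)\<^sup>2)" by (rule \<alpha>_mult_sq(2)) (use u2 in auto)
    also have "\<dots> \<le> C\<alpha>\<^sup>2 * G\<^sup>2" using u2 by (intro mult_left_mono) auto
    finally have "(LINT w|F. (v w - \<alpha> (X w) * u w)\<^sup>2) \<le> 2 * \<tau> + 2 * C\<alpha>\<^sup>2 * G\<^sup>2" using v2 by simp
    then show "integrable F (\<lambda>w. (m w (g d) - m w \<gamma> - \<alpha> (X w) * (g d (X w) - \<gamma> (X w)))\<^sup>2) \<and>
         (LINT w|F. m w (g d) - m w \<gamma> - \<alpha> (X w) * (g d (X w) - \<gamma> (X w))) = 0 \<and>
         (LINT w|F. (m w (g d) - m w \<gamma> - \<alpha> (X w) * (g d (X w) - \<gamma> (X w)))\<^sup>2) \<le> 2 * \<tau> + 2 * C\<alpha>\<^sup>2 * G\<^sup>2"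
      using mean i by (simp add: u_def v_def)
  next
    show "real (card J) * (2 * \<tau> + 2 * C\<alpha>\<^sup>2 * G\<^sup>2) / (e * sqrt n)\<^sup>2 \<le> (2 * \<tau> + 2 * C\<alpha>\<^sup>2 * G\<^sup>2) / e\<^sup>2"
      by (rule scale) (use \<tau> e T C2 S0 Cv in auto)
  qed (use \<tau> e sn in auto)

  \<comment> \<open>The same difference in the direction of the lasso fit. Its variance is only
    bounded, but the sum is multiplied by the targeting coefficient.\<close>
  define f2 where "f2 d w = (\<Sum>j<p. \<rho>h d j * m w (b j)) - \<alpha> (X w) * a d w" for d w
  have h2: "whp (2 * (C2 + C\<alpha>\<^sup>2) * S / T\<^sup>2) (\<lambda>\<omega>. obs N \<omega> \<in> B \<longrightarrow> \<bar>\<Sum>i\<in>J. f2 (obs N \<omega>) (W i \<omega>)\<bar> < T * sqrt n)"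
    unfolding f2_def
  proof (rule whp_conditional_chebyshev[OF disj _ B])
    show "(\<lambda>(d, w). (\<Sum>j<p. \<rho>h d j * m w (b j)) - \<alpha> (X w) * a d w) \<in> borel_measurable (?P \<Otimes>\<^sub>M F)"
      unfolding split_beta by measurable
    fix d assume d: "d \<in> B"
    define v where "v w = (\<Sum>j<p. \<rho>h d j * m w (b j))" for w
    have [measurable]: "v \<in> borel_measurable F" unfolding v_def by measurable
    have v2: "integrable F (\<lambda>w. (v w)\<^sup>2)" "(LINT w|F. (v w)\<^sup>2) \<le> C2 * (LINT w|F. (a d w)\<^sup>2)"
      using m_lin_sq by (auto simp: v_def a_def)
    have i: "integrable F (\<lambda>w. (v w + (- (\<alpha> (X w) * a d w)))\<^sup>2)"
      by (rule F.integrable_sq_add(1)) (use v2 \<alpha>_mult_sq(1)[OF ad a_sq] in auto)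
    have "(LINT w|F. (v w + (- (\<alpha> (X w) * a d w)))\<^sup>2) \<le> 2 * (LINT w|F. (v w)\<^sup>2) + 2 * (LINT w|F. (- (\<alpha> (X w) * a d w))\<^sup>2)"
      by (rule F.integrable_sq_add(2)) (use v2 \<alpha>_mult_sq(1)[OF ad a_sq] in auto)
    also have "(LINT w|F. (- (\<alpha> (X w) * a d w))\<^sup>2) = (LINT w|F. (\<alpha> (X w) * a d w)\<^sup>2)" by simp
    also have "\<dots> \<le> C\<alpha>\<^sup>2 * (LINT w|F. (a d w)\<^sup>2)" by (rule \<alpha>_mult_sq(2)[OF ad a_sq])
    finally have "(LINT w|F. (v w - \<alpha> (X w) * a d w)\<^sup>2) \<le> 2 * (C2 + C\<alpha>\<^sup>2) * (LINT w|F. (a d w)\<^sup>2)"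
      using v2 by (simp add: algebra_simps)
    also have "\<dots> \<le> 2 * (C2 + C\<alpha>\<^sup>2) * S" using aS[OF d] C2 by (intro mult_left_mono) auto
    finally show "integrable F (\<lambda>w. ((\<Sum>j<p. \<rho>h d j * m w (b j)) - \<alpha> (X w) * a d w)\<^sup>2) \<and>
         (LINT w|F. (\<Sum>j<p. \<rho>h d j * m w (b j)) - \<alpha> (X w) * a d w) = 0 \<and>
         (LINT w|F. ((\<Sum>j<p. \<rho>h d j * m w (b j)) - \<alpha> (X w) * a d w)\<^sup>2) \<le> 2 * (C2 + C\<alpha>\<^sup>2) * S"
      using i integral_m_lin_comb[where p=p and \<rho>="\<rho>h d"] by (simp add: v_def a_def)
  next
    show "real (card J) * (2 * (C2 + C\<alpha>\<^sup>2) * S) / (T * sqrt n)\<^sup>2 \<le> 2 * (C2 + C\<alpha>\<^sup>2) * S / T\<^sup>2"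
      by (rule scale) (use \<tau> e T C2 S0 Cv in auto)
  qed (use C2 S0 T sn in auto)

  \<comment> \<open>Centred because the dictionary and \<open>\<alpha>\<close> are both orthogonal
    to the regression residual; the bounded conditional variance makes its variance at most
    \<open>Cv * A\<^sup>2\<close>.\<close>
  define f3 where "f3 d w = (a d w - \<alpha> (X w)) * (Y w - \<gamma> (X w))" for d w
  have h3: "whp (Cv * A\<^sup>2 / e\<^sup>2) (\<lambda>\<omega>. obs N \<omega> \<in> B \<longrightarrow> \<bar>\<Sum>i\<in>J. f3 (obs N \<omega>) (W i \<omega>)\<bar> < e * sqrt n)"
    unfolding f3_def
  proof (rule whp_conditional_chebyshev[OF disj _ B])
    show "(\<lambda>(d, w). (a d w - \<alpha> (X w)) * (Y w - \<gamma> (X w))) \<in> borel_measurable (?P \<Otimes>\<^sub>M F)"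
      unfolding split_beta by measurable
    fix d assume d: "d \<in> B"
    have bd: "AE w in F. \<bar>lin_comb b p (\<rho>h d) (X w) - \<alpha> (X w)\<bar> \<le> Cb * (\<Sum>j<p. \<bar>\<rho>h d j\<bar>) + C\<alpha>"
      using ab[of d] \<alpha>_bounded by eventually_elim (auto simp: a_def)
    have rv: "integrable F (\<lambda>w. ((a d w - \<alpha> (X w)) * (Y w - \<gamma> (X w)))\<^sup>2)"
      "(LINT w|F. ((a d w - \<alpha> (X w)) * (Y w - \<gamma> (X w)))\<^sup>2) \<le> Cv * (LINT w|F. (a d w - \<alpha> (X w))\<^sup>2)"
      using resid_var[OF _ bd] by (auto simp: a_def)
    have i1: "integrable F (\<lambda>w. a d w * (Y w - \<gamma> (X w)))" "integrable F (\<lambda>w. \<alpha> (X w) * (Y w - \<gamma> (X w)))"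
      by (rule F.integrable_mult_of_sq; use a_sq \<alpha>_sq resid_sq in auto)+
    have "(LINT w|F. (a d w - \<alpha> (X w)) * (Y w - \<gamma> (X w))) = (LINT w|F. a d w * (Y w - \<gamma> (X w))) - (LINT w|F. \<alpha> (X w) * (Y w - \<gamma> (X w)))"
      unfolding left_diff_distrib[of "a d _"] using i1 by simp
    also have "\<dots> = 0" using integral_lin_comb_resid[of p "\<rho>h d"] \<alpha>_orth by (simp add: a_def)
    finally have mean: "(LINT w|F. (a d w - \<alpha> (X w)) * (Y w - \<gamma> (X w))) = 0" .
    have "Cv * (LINT w|F. (a d w - \<alpha> (X w))\<^sup>2) \<le> Cv * A\<^sup>2" using rA[OF d] Cv by (intro mult_left_mono) auto
    then show "integrable F (\<lambda>w. ((a d w - \<alpha> (X w)) * (Y w - \<gamma> (X w)))\<^sup>2) \<and>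
         (LINT w|F. (a d w - \<alpha> (X w)) * (Y w - \<gamma> (X w))) = 0 \<and>
         (LINT w|F. ((a d w - \<alpha> (X w)) * (Y w - \<gamma> (X w)))\<^sup>2) \<le> Cv * A\<^sup>2"
      using rv mean by auto
  next
    show "real (card J) * (Cv * A\<^sup>2) / (e * sqrt n)\<^sup>2 \<le> Cv * A\<^sup>2 / e\<^sup>2"
      by (rule scale) (use \<tau> e T C2 S0 Cv in auto)
  qed (use Cv e sn in auto)

  \<comment> \<open>Not centred: the product of the two estimation errors, bounded in mean by
    \<open>A * G\<close>. The requirement that \<open>sqrt n * A * G\<close> vanish arises
    here.\<close>
  define f4 where "f4 d w = \<bar>a d w - \<alpha> (X w)\<bar> * \<bar>g d (X w) - \<gamma> (X w)\<bar>" for d w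
  have h4: "whp (sqrt n * A * G / e) (\<lambda>\<omega>. obs N \<omega> \<in> B \<longrightarrow> \<bar>\<Sum>i\<in>J. f4 (obs N \<omega>) (W i \<omega>)\<bar> < e * sqrt n)"
    unfolding f4_def
  proof (rule whp_conditional_markov[OF disj _ B])
    show "(\<lambda>(d, w). \<bar>a d w - \<alpha> (X w)\<bar> * \<bar>g d (X w) - \<gamma> (X w)\<bar>) \<in> borel_measurable (?P \<Otimes>\<^sub>M F)"
      unfolding split_beta by measurable
    fix d assume d: "d \<in> B"
    note [measurable] = gd[OF d]
    show "integrable F (\<lambda>w. \<bar>a d w - \<alpha> (X w)\<bar> * \<bar>g d (X w) - \<gamma> (X w)\<bar>) \<and>
       (LINT w|F. \<bar>a d w - \<alpha> (X w)\<bar> * \<bar>g d (X w) - \<gamma> (X w)\<bar>) \<le> A * G"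
      using F.integral_abs_mult_le[of "\<lambda>w. a d w - \<alpha> (X w)" "\<lambda>w. g d (X w) - \<gamma> (X w)" A G] r_sq rA[OF d] g_sq[OF d] A G by simp
  next
    have "real (card J) * (A * G) \<le> n * (A * G)" using nJ A G by (intro mult_right_mono) auto
    then have "real (card J) * (A * G) / (e * sqrt n) \<le> (sqrt n * sqrt n) * (A * G) / (e * sqrt n)"
      unfolding sn(2) using e sn by (intro divide_right_mono) auto
    also have "\<dots> = sqrt n * (A * G) / e" by (rule cancel) (use sn(1) in simp)
    finally show "real (card J) * (A * G) / (e * sqrt n) \<le> sqrt n * A * G / e" by (simp only: mult.assoc)
  qed (use A G e sn in auto)

  \<comment> \<open>The other product term; being of order \<open>n * A\<close> it is small only
    after multiplication by the targeting coefficient.\<close>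
  define f5 where "f5 d w = \<bar>a d w - \<alpha> (X w)\<bar> * \<bar>a d w\<bar>" for d w
  have h5: "whp (sqrt S / T) (\<lambda>\<omega>. obs N \<omega> \<in> B \<longrightarrow> \<bar>\<Sum>i\<in>J. f5 (obs N \<omega>) (W i \<omega>)\<bar> < T * n * A)"
    unfolding f5_def
  proof (rule whp_conditional_markov[OF disj _ B])
    show "(\<lambda>(d, w). \<bar>a d w - \<alpha> (X w)\<bar> * \<bar>a d w\<bar>) \<in> borel_measurable (?P \<Otimes>\<^sub>M F)"
      unfolding split_beta by measurable
    fix d assume d: "d \<in> B"
    show "integrable F (\<lambda>w. \<bar>a d w - \<alpha> (X w)\<bar> * \<bar>a d w\<bar>) \<and>
       (LINT w|F. \<bar>a d w - \<alpha> (X w)\<bar> * \<bar>a d w\<bar>) \<le> A * sqrt S"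
      using F.integral_abs_mult_le[of "\<lambda>w. a d w - \<alpha> (X w)" "a d" A "sqrt S"] r_sq rA[OF d] a_sq S_sqrt[OF d] A S0 by simp
  next
    have "real (card J) * (A * sqrt S) \<le> n * (A * sqrt S)" using nJ A S0 by (intro mult_right_mono) auto
    then have "real (card J) * (A * sqrt S) / (T * n * A) \<le> n * (A * sqrt S) / (T * n * A)"
      using T n0 A by (intro divide_right_mono) auto
    also have "\<dots> = sqrt S / T" using n0 A by simp
    finally show "real (card J) * (A * sqrt S) / (T * n * A) \<le> sqrt S / T" .
  qed (use A S0 T n0 in auto)

  \<comment> \<open>Together with \<open>f7\<close> this bounds the numerator of the targeting
    coefficient, whose residual is split at \<open>\<gamma>\<close> into a centred part and the
    learner's error.\<close>
  define f6 where "f6 d w = a d w * (Y w - \<gamma> (X w))" for d w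
  have h6: "whp (Cv * S / T\<^sup>2) (\<lambda>\<omega>. obs N \<omega> \<in> B \<longrightarrow> \<bar>\<Sum>i\<in>J. f6 (obs N \<omega>) (W i \<omega>)\<bar> < T * sqrt n)"
    unfolding f6_def
  proof (rule whp_conditional_chebyshev[OF disj _ B])
    show "(\<lambda>(d, w). a d w * (Y w - \<gamma> (X w))) \<in> borel_measurable (?P \<Otimes>\<^sub>M F)"
      unfolding split_beta by measurable
    fix d assume d: "d \<in> B"
    have rv: "integrable F (\<lambda>w. (a d w * (Y w - \<gamma> (X w)))\<^sup>2)"
      "(LINT w|F. (a d w * (Y w - \<gamma> (X w)))\<^sup>2) \<le> Cv * (LINT w|F. (a d w)\<^sup>2)"
      using resid_var[OF _ lin_comb_bound[of p "\<rho>h d"]] by (auto simp: a_def)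
    have "Cv * (LINT w|F. (a d w)\<^sup>2) \<le> Cv * S" using aS[OF d] Cv by (intro mult_left_mono) auto
    then show "integrable F (\<lambda>w. (a d w * (Y w - \<gamma> (X w)))\<^sup>2) \<and>
         (LINT w|F. a d w * (Y w - \<gamma> (X w))) = 0 \<and>
         (LINT w|F. (a d w * (Y w - \<gamma> (X w)))\<^sup>2) \<le> Cv * S"
      using rv integral_lin_comb_resid[of p "\<rho>h d"] by (auto simp: a_def)
  next
    show "real (card J) * (Cv * S) / (T * sqrt n)\<^sup>2 \<le> Cv * S / T\<^sup>2"
      by (rule scale) (use \<tau> e T C2 S0 Cv in auto)
  qed (use Cv S0 T sn in auto)

  define f7 where "f7 d w = \<bar>a d w\<bar> * \<bar>g d (X w) - \<gamma> (X w)\<bar>" for d w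
  have h7: "whp (sqrt S / T) (\<lambda>\<omega>. obs N \<omega> \<in> B \<longrightarrow> \<bar>\<Sum>i\<in>J. f7 (obs N \<omega>) (W i \<omega>)\<bar> < T * n * G)"
    unfolding f7_def
  proof (rule whp_conditional_markov[OF disj _ B])
    show "(\<lambda>(d, w). \<bar>a d w\<bar> * \<bar>g d (X w) - \<gamma> (X w)\<bar>) \<in> borel_measurable (?P \<Otimes>\<^sub>M F)"
      unfolding split_beta by measurable
    fix d assume d: "d \<in> B"
    note [measurable] = gd[OF d]
    show "integrable F (\<lambda>w. \<bar>a d w\<bar> * \<bar>g d (X w) - \<gamma> (X w)\<bar>) \<and>
       (LINT w|F. \<bar>a d w\<bar> * \<bar>g d (X w) - \<gamma> (X w)\<bar>) \<le> sqrt S * G"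
      using F.integral_abs_mult_le[of "a d" "\<lambda>w. g d (X w) - \<gamma> (X w)" "sqrt S" G] a_sq S_sqrt[OF d] g_sq[OF d] S0 G by simp
  next
    have "real (card J) * (sqrt S * G) \<le> n * (sqrt S * G)" using nJ G S0 by (intro mult_right_mono) auto
    then have "real (card J) * (sqrt S * G) / (T * n * G) \<le> n * (sqrt S * G) / (T * n * G)"
      using T n0 G by (intro divide_right_mono) auto
    also have "\<dots> = sqrt S / T" using n0 G by simp
    finally show "real (card J) * (sqrt S * G) / (T * n * G) \<le> sqrt S / T" .
  qed (use G S0 T n0 in auto)

  \<comment> \<open>Together with the sum of squares of \<open>\<alpha>\<close> this bounds the
    targeting denominator from below.\<close>
  define f8 where "f8 d w = (a d w - \<alpha> (X w))\<^sup>2" for d w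
  have h8: "whp (8 * A\<^sup>2 / \<kappa>) (\<lambda>\<omega>. obs N \<omega> \<in> B \<longrightarrow> \<bar>\<Sum>i\<in>J. f8 (obs N \<omega>) (W i \<omega>)\<bar> < \<kappa> * real (card J) / 8)"
    unfolding f8_def
  proof (rule whp_conditional_markov[OF disj _ B])
    show "(\<lambda>(d, w). (a d w - \<alpha> (X w))\<^sup>2) \<in> borel_measurable (?P \<Otimes>\<^sub>M F)"
      unfolding split_beta by measurable
    fix d assume d: "d \<in> B"
    show "integrable F (\<lambda>w. (a d w - \<alpha> (X w))\<^sup>2) \<and> (LINT w|F. (a d w - \<alpha> (X w))\<^sup>2) \<le> A\<^sup>2"
      using r_sq rA[OF d] by simp
  qed (use k0 cJ in \<open>auto simp: mult.commute\<close>)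

  have h9: "whp (4 * C\<alpha>^4 / (\<kappa>\<^sup>2 * real (card J))) (\<lambda>\<omega>. \<bar>\<Sum>i\<in>J. (\<alpha> (X (W i \<omega>)))\<^sup>2 - \<kappa>\<bar> < \<kappa> * real (card J) / 2)"
    using \<alpha>_sq_chebyshev[OF disj(2) J] unfolding whp_def
    by (intro bexI[of _ "{\<omega>\<in>space M. \<bar>\<Sum>i\<in>J. (\<alpha> (X (W i \<omega>)))\<^sup>2 - \<kappa>\<bar> \<ge> \<kappa> * real (card J) / 2}"]) auto

  note h = whp_conj[OF whp_conj[OF whp_conj[OF whp_conj[OF whp_conj[OF whp_conj[OF whp_conj[OF whp_conj[OF h1 h2] h3] h4] h5] h6] h7] h8] h9]
  show ?thesis
  proof (rule whp_mono[OF h order_refl], goal_cases)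
    case (1 \<omega>)
    show ?case
    proof
      assume B\<omega>: "obs N \<omega> \<in> B"
      define d where "d = obs N \<omega>"
      have dB: "d \<in> B" using B\<omega> by (simp add: d_def)
      have wF: "W i \<omega> \<in> space F" for i by (rule measurable_space[OF W_measurable 1(1)])
      define ai gi ci ali yi mgi mai mci where "ai = (\<lambda>i. a d (W i \<omega>))" and "gi = (\<lambda>i. g d (X (W i \<omega>)))"
        and "ci = (\<lambda>i. \<gamma> (X (W i \<omega>)))" and "ali = (\<lambda>i. \<alpha> (X (W i \<omega>)))" and "yi = (\<lambda>i. Y (W i \<omega>))"
        and "mgi = (\<lambda>i. m (W i \<omega>) (g d))" and "mai = (\<lambda>i. \<Sum>j<p. \<rho>h d j * m (W i \<omega>) (b j))"
        and "mci = (\<lambda>i. m (W i \<omega>) \<gamma>)"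
      note defs = ai_def gi_def ci_def ali_def yi_def mgi_def mai_def mci_def
      have H: "\<bar>\<Sum>i\<in>J. f1 d (W i \<omega>)\<bar> < e * sqrt n"
        "\<bar>\<Sum>i\<in>J. f2 d (W i \<omega>)\<bar> < T * sqrt n"
        "\<bar>\<Sum>i\<in>J. f3 d (W i \<omega>)\<bar> < e * sqrt n"
        "\<bar>\<Sum>i\<in>J. f4 d (W i \<omega>)\<bar> < e * sqrt n"
        "\<bar>\<Sum>i\<in>J. f5 d (W i \<omega>)\<bar> < T * n * A"
        "\<bar>\<Sum>i\<in>J. f6 d (W i \<omega>)\<bar> < T * sqrt n"
        "\<bar>\<Sum>i\<in>J. f7 d (W i \<omega>)\<bar> < T * n * G"
        "\<bar>\<Sum>i\<in>J. f8 d (W i \<omega>)\<bar> < \<kappa> * real (card J) / 8"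
        "\<bar>\<Sum>i\<in>J. (ali i)\<^sup>2 - \<kappa>\<bar> < \<kappa> * real (card J) / 2"
        using 1(2) B\<omega> by (auto simp: d_def ali_def)
      have b1: "\<bar>\<Sum>i\<in>J. mgi i - mci i - ali i * (gi i - ci i)\<bar> < e * sqrt n"
        using H(1) by (simp add: defs f1_def)
      have b2: "\<bar>\<Sum>i\<in>J. mai i - ali i * ai i\<bar> < T * sqrt n"
        using H(2) by (simp add: defs f2_def)
      have b3: "\<bar>\<Sum>i\<in>J. (ai i - ali i) * (yi i - ci i)\<bar> < e * sqrt n"
        using H(3) by (simp add: defs f3_def)
      have b4: "(\<Sum>i\<in>J. \<bar>ai i - ali i\<bar> * \<bar>gi i - ci i\<bar>) < e * sqrt n"
        using H(4) by (simp add: defs f4_def abs_less_iff)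
      have b5: "(\<Sum>i\<in>J. \<bar>ai i - ali i\<bar> * \<bar>ai i\<bar>) < T * n * A"
        using H(5) by (simp add: defs f5_def abs_less_iff)
      have b6: "\<bar>\<Sum>i\<in>J. ai i * (yi i - ci i)\<bar> < T * sqrt n"
        using H(6) by (simp add: defs f6_def)
      have b7: "(\<Sum>i\<in>J. \<bar>ai i\<bar> * \<bar>gi i - ci i\<bar>) < T * n * G"
        using H(7) by (simp add: defs f7_def abs_less_iff)
      have b8: "(\<Sum>i\<in>J. (ai i - ali i)\<^sup>2) < \<kappa> * real (card J) / 8"
        using H(8) by (simp add: defs f8_def abs_less_iff)
      have "(\<Sum>i\<in>J. (ali i)\<^sup>2 - \<kappa>) = (\<Sum>i\<in>J. (ali i)\<^sup>2) - \<kappa> * real (card J)"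
        by (simp add: sum_subtractf mult.commute)
      then have b9: "(\<Sum>i\<in>J. (ali i)\<^sup>2) > \<kappa> * real (card J) / 2" using H(9) by linarith
      define D where "D = (\<Sum>i\<in>J. (ai i)\<^sup>2)"
      have D: "D > \<kappa> * real (card J) / 8"
      proof -
        \<comment> \<open>Per observation, more than \<open>\<kappa> / 2\<close> is at most twice
          the share of \<open>D\<close> plus twice \<open>\<kappa> / 8\<close>, which leaves more
          than \<open>\<kappa> / 8\<close> for \<open>D\<close>.\<close>
        have "(\<Sum>i\<in>J. (ali i)\<^sup>2) \<le> (\<Sum>i\<in>J. 2 * (ai i)\<^sup>2 + 2 * (ai i - ali i)\<^sup>2)"
        proof (rule sum_mono)
          fix i
          have "(ai i + (ali i - ai i))\<^sup>2 \<le> 2 * (ai i)\<^sup>2 + 2 * (ali i - ai i)\<^sup>2" by (rule sq_add_le)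
          then show "(ali i)\<^sup>2 \<le> 2 * (ai i)\<^sup>2 + 2 * (ai i - ali i)\<^sup>2" by (simp add: power2_commute)
        qed
        also have "\<dots> = 2 * D + 2 * (\<Sum>i\<in>J. (ai i - ali i)\<^sup>2)" by (simp add: D_def sum.distrib sum_distrib_left)
        finally show ?thesis using b8 b9 by linarith
      qed
      have "\<kappa> * real (card J) / 8 > 0" using k0 cJ by simp
      then have D0: "D > 0" using D by linarith
      define k where "k = (\<Sum>i\<in>J. ai i * (yi i - gi i)) / D"
      have gt: "gamma_tilde X Y J (g d) (lin_comb b p (\<rho>h d)) (\<lambda>i. W i \<omega>) = (\<lambda>x. g d x + k * lin_comb b p (\<rho>h d) x)"
        by (auto simp: gamma_tilde_def k_def D_def defs a_def)
      have gsq: "g d \<in> sq_integrable_funs F MX X"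
      proof -
        note [measurable] = gd[OF dB]
        have "integrable F (\<lambda>w. ((g d (X w) - \<gamma> (X w)) + \<gamma> (X w))\<^sup>2)"
          by (rule F.integrable_sq_add(1)) (use g_sq[OF dB] \<gamma>_sq in auto)
        then show ?thesis by (simp add: sq_integrable_funs_def)
      qed
      have ms: "m (W i \<omega>) (gamma_tilde X Y J (g d) (lin_comb b p (\<rho>h d)) (\<lambda>i. W i \<omega>)) = mgi i + k * mai i" for i
        unfolding gt using m_add[OF wF gsq lin_comb_sq_integrable_funs] m_lin_comb[OF wF] by (simp add: defs)
      have kb: "\<bar>k\<bar> * D \<le> T * sqrt n + T * n * G"
      proof -
        have "(\<Sum>i\<in>J. ai i * (yi i - gi i)) = (\<Sum>i\<in>J. ai i * (yi i - ci i)) - (\<Sum>i\<in>J. ai i * (gi i - ci i))"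
          by (simp add: sum_subtractf[symmetric] algebra_simps)
        moreover have "\<bar>\<Sum>i\<in>J. ai i * (gi i - ci i)\<bar> \<le> (\<Sum>i\<in>J. \<bar>ai i\<bar> * \<bar>gi i - ci i\<bar>)"
          by (rule order_trans[OF sum_abs]) (simp add: abs_mult)
        ultimately have "\<bar>\<Sum>i\<in>J. ai i * (yi i - gi i)\<bar> \<le> T * sqrt n + T * n * G" using b6 b7 by linarith
        moreover have "\<bar>k\<bar> * D = \<bar>\<Sum>i\<in>J. ai i * (yi i - gi i)\<bar>" using D0 by (simp add: k_def)
        ultimately show ?thesis by simp
      qed
      \<comment> \<open>Both sides are compared after multiplication by \<open>D\<close>; this is
        where \<open>cond\<close> meets the lower bound of the denominator.\<close>
      have tail: "\<bar>k\<bar> * (T * sqrt n + T * n * A) \<le> e * sqrt n"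
      proof -
        have "(\<bar>k\<bar> * (T * sqrt n + T * n * A)) * D \<le> (T * sqrt n + T * n * G) * (T * sqrt n + T * n * A)"
          using mult_right_mono[OF kb, of "T * sqrt n + T * n * A"] T A sn n0 by (simp add: mult_ac)
        also have "\<dots> \<le> e * sqrt n * (\<kappa> * real (card J) / 8)" by (rule cond)
        also have "\<dots> \<le> (e * sqrt n) * D" using D e sn by (intro mult_left_mono) auto
        finally show ?thesis using D0 by (simp add: mult_le_cancel_right)
      qed
      have c4: "\<bar>\<Sum>i\<in>J. (ai i - ali i) * (gi i - ci i)\<bar> < e * sqrt n"
        by (rule le_less_trans[OF sum_abs]) (use b4 in \<open>simp add: abs_mult\<close>)
      have c5: "\<bar>\<Sum>i\<in>J. (ai i - ali i) * ai i\<bar> \<le> T * n * A"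
        by (rule order_trans[OF sum_abs]) (use b5 in \<open>simp add: abs_mult\<close>)
      have c25: "\<bar>k * (\<Sum>i\<in>J. mai i - ali i * ai i) - k * (\<Sum>i\<in>J. (ai i - ali i) * ai i)\<bar> \<le> e * sqrt n"
      proof -
        have "\<bar>k * (\<Sum>i\<in>J. mai i - ali i * ai i) - k * (\<Sum>i\<in>J. (ai i - ali i) * ai i)\<bar>
          \<le> \<bar>k\<bar> * (\<bar>\<Sum>i\<in>J. mai i - ali i * ai i\<bar> + \<bar>\<Sum>i\<in>J. (ai i - ali i) * ai i\<bar>)"
          unfolding right_diff_distrib[symmetric] abs_mult by (intro mult_left_mono) auto
        also have "\<dots> \<le> \<bar>k\<bar> * (T * sqrt n + T * n * A)" using b2 c5 by (intro mult_left_mono) auto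
        finally show ?thesis using tail by linarith
      qed
      have "\<bar>(\<Sum>i\<in>J. mgi i + k * mai i) - (\<Sum>i\<in>J. mci i + ali i * (yi i - ci i))\<bar> < 4 * e * sqrt n"
        using tml_expansion[of ai J k yi gi mgi mai mci ali ci] D0 b1 b3 c4 c25 unfolding D_def k_def by linarith
      then show "\<bar>fold_remainder J (g (obs N \<omega>)) (lin_comb b p (\<rho>h (obs N \<omega>))) \<omega>\<bar> < 4 * e * sqrt n"
        unfolding fold_remainder_def d_def[symmetric] ms by (simp add: defs)
    qed
  qed
qed

end

section \<open>Mean-square bounds from extended-valued norms and integrals\<close>

lemma nn_integral_sq_le_of_ms_norm:
  assumes "ms_norm F f \<le> ennreal K" "K \<ge> 0"
  shows "(\<integral>\<^sup>+ w. ennreal ((f w)\<^sup>2) \<partial>F) \<le> ennreal (K\<^sup>2)"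
proof -
  define I where "I = (\<integral>\<^sup>+ w. ennreal ((f w)\<^sup>2) \<partial>F)"
  have "I \<noteq> \<top>" using assms by (auto simp: ms_norm_def I_def[symmetric] Let_def top_unique split: if_splits)
  then have "ennreal (sqrt (enn2real I)) \<le> ennreal K" using assms by (simp add: ms_norm_def I_def[symmetric])
  then have "sqrt (enn2real I) \<le> K" using assms(2) by (simp add: ennreal_le_iff)
  then have "(sqrt (enn2real I))\<^sup>2 \<le> K\<^sup>2" by (intro power_mono) auto
  then have "ennreal (enn2real I) \<le> ennreal (K\<^sup>2)" by (intro ennreal_leI) simp
  moreover have "ennreal (enn2real I) = I" using \<open>I \<noteq> \<top>\<close> by (simp add: less_top)
  ultimately have "I \<le> ennreal (K\<^sup>2)" by (simp only:)
  then show ?thesis by (simp add: I_def)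
qed

lemma integrable_sq_of_nn_integral:
  fixes f :: "'a \<Rightarrow> real"
  assumes [measurable]: "f \<in> borel_measurable F" and le: "(\<integral>\<^sup>+ w. ennreal ((f w)\<^sup>2) \<partial>F) \<le> ennreal c" and "c \<ge> 0"
  shows "integrable F (\<lambda>w. (f w)\<^sup>2) \<and> (LINT w|F. (f w)\<^sup>2) \<le> c"
proof -
  have "(\<integral>\<^sup>+ w. ennreal ((f w)\<^sup>2) \<partial>F) < \<top>" using le by (rule le_less_trans) simp
  then have i: "integrable F (\<lambda>w. (f w)\<^sup>2)" by (intro integrableI_bounded) auto
  have "ennreal (LINT w|F. (f w)\<^sup>2) = (\<integral>\<^sup>+ w. ennreal ((f w)\<^sup>2) \<partial>F)"
    by (rule nn_integral_eq_integral[symmetric]) (use i in auto)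
  then have "ennreal (LINT w|F. (f w)\<^sup>2) \<le> ennreal c" using le by simp
  then show ?thesis using i \<open>c \<ge> 0\<close> by (simp add: ennreal_le_iff)
qed

context debiased_regression
begin

text \<open>
  The event \<open>g d \<in> \<Gamma>\<close> need not be measurable in the training data \<open>d\<close>. Conditioning is on the measurable
  set of all \<open>d\<close> for which \<open>g d\<close> satisfies the one consequence of membership that is needed,
  \<open>E[m(W, g d)] = E[\<alpha>(X) g d(X)]\<close>.
\<close>

lemma fold_remainder_in_prob:
  fixes g :: "nat \<Rightarrow> (nat \<Rightarrow> 'w) \<Rightarrow> 'x \<Rightarrow> real" and \<rho>h :: "nat \<Rightarrow> (nat \<Rightarrow> 'w) \<Rightarrow> nat \<Rightarrow> real"
    and p :: "nat \<Rightarrow> nat" and N J :: "nat \<Rightarrow> nat set" and A :: "nat \<Rightarrow> real"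
  assumes disj: "\<And>n. N n \<inter> J n = {}" "\<And>n. finite (J n)" and nJ: "\<And>n. card (J n) \<le> n"
    and J: "\<forall>\<^sub>F n in sequentially. c * real n \<le> real (card (J n))" "c > 0"
    and g_meas: "\<And>n. (\<lambda>(d, x). g n d x) \<in> borel_measurable (PiM (N n) (\<lambda>_. F) \<Otimes>\<^sub>M MX)"
    and mg_meas: "\<And>n. (\<lambda>(d, w). m w (g n d)) \<in> borel_measurable (PiM (N n) (\<lambda>_. F) \<Otimes>\<^sub>M F)"
    and \<rho>_meas: "\<And>n j. j < p n \<Longrightarrow> (\<lambda>d. \<rho>h n d j) \<in> borel_measurable (PiM (N n) (\<lambda>_. F))"
    and A: "\<And>n. A n > 0" "A \<longlonglongrightarrow> 0"
    and a_err: "wpa1 M (\<lambda>n \<omega>. approx_err (p n) (\<rho>h n (obs (N n) \<omega>)) \<le> (A n)\<^sup>2)"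
    and g_riesz: "wpa1 M (\<lambda>n \<omega>. (LINT w|F. m w (g n (obs (N n) \<omega>))) =
          (LINT w|F. \<alpha> (X w) * g n (obs (N n) \<omega>) (X w)))"
    and mg: "tendsto_0_in_prob M (\<lambda>n \<omega>. \<integral>\<^sup>+ w. ennreal ((m w (g n (obs (N n) \<omega>)) - m w \<gamma>)\<^sup>2) \<partial>F)"
    and g_rate: "bigO_in_prob M (\<lambda>n \<omega>. ms_norm F (\<lambda>w. g n (obs (N n) \<omega>) (X w) - \<gamma> (X w))) (\<lambda>n. real n powr (- d\<gamma>))"
    and d\<gamma>: "d\<gamma> > 0" and prod_rate: "(\<lambda>n. sqrt (real n) * A n * real n powr (- d\<gamma>)) \<longlonglongrightarrow> 0"
    and e: "e > 0" and \<delta>: "\<delta> > 0"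
  shows "\<forall>\<^sub>F n in sequentially. whp \<delta> (\<lambda>\<omega>.
      \<bar>fold_remainder (J n) (g n (obs (N n) \<omega>)) (lin_comb b (p n) (\<rho>h n (obs (N n) \<omega>))) \<omega>\<bar> < e * sqrt (real n))"
proof -
  have k0: "\<kappa> > 0" using \<alpha>_nonzero by (simp add: \<kappa>_def)
  define S where "S = 2 * \<kappa> + 2"
  define e' where "e' = e / 4"
  have e': "e' > 0" using e by (simp add: e'_def)
  \<comment> \<open>The budget: \<open>2 * \<tau> / e'\<^sup>2\<close> is
    \<open>\<delta> / 12\<close>, the terms vanishing in \<open>n\<close> get another
    \<open>\<delta> / 12\<close>, those controlled by \<open>T\<close> get
    \<open>\<delta> / 6\<close>, and each of the four conditions on the training data gets
    \<open>\<delta> / 6\<close>.\<close>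
  define \<tau> where "\<tau> = \<delta> * e'\<^sup>2 / 24"
  have \<tau>: "\<tau> > 0" using \<delta> e' by (simp add: \<tau>_def)
  have \<delta>6: "\<delta> / 6 > 0" using \<delta> by simp
  \<comment> \<open>\<open>T\<close> is fixed before \<open>n\<close> grows, so that
    \<open>cond\<close> has to hold only eventually for this one \<open>T\<close>.\<close>
  have "((\<lambda>T. 2 * (C2 + C\<alpha>\<^sup>2) * S / T\<^sup>2 + Cv * S / T\<^sup>2 + 2 * sqrt S / T) \<longlongrightarrow> 0 + 0 + 0) at_top"
    by (intro tendsto_add tendsto_divide_0[OF tendsto_const] filterlim_at_top_imp_at_infinity filterlim_pow_at_top filterlim_ident) auto
  then have "\<forall>\<^sub>F T in at_top. 2 * (C2 + C\<alpha>\<^sup>2) * S / T\<^sup>2 + Cv * S / T\<^sup>2 + 2 * sqrt S / T < \<delta> / 6"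
    using \<delta>6 by (intro order_tendstoD) auto
  from eventually_happens'[OF _ eventually_conj[OF this eventually_gt_at_top[of 0]]]
  obtain T where T: "2 * (C2 + C\<alpha>\<^sup>2) * S / T\<^sup>2 + Cv * S / T\<^sup>2 + 2 * sqrt S / T < \<delta> / 6" "T > 0" by auto
  obtain K where K: "K > 0" and gO0: "\<forall>\<^sub>F n in sequentially. \<exists>D\<in>sets M. prob D \<ge> 1 - \<delta> / 6 \<and>
     (\<forall>\<omega>\<in>D. ms_norm F (\<lambda>w. g n (obs (N n) \<omega>) (X w) - \<gamma> (X w)) \<le> ennreal (K * real n powr (- d\<gamma>)))"
    using g_rate \<delta>6 unfolding bigO_in_prob_def by blast
  have gO: "\<forall>\<^sub>F n in sequentially. whp (\<delta> / 6) (\<lambda>\<omega>.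
     ms_norm F (\<lambda>w. g n (obs (N n) \<omega>) (X w) - \<gamma> (X w)) \<le> ennreal (K * real n powr (- d\<gamma>)))"
    using gO0 by eventually_elim (blast intro: whp_of_prob)
  define G where "G n = K * real n powr (- d\<gamma>)" for n
  have Gp: "G n > 0" if "n \<ge> 1" for n using K that by (simp add: G_def)
  have G0: "G \<longlonglongrightarrow> 0"
    unfolding G_def using d\<gamma> by (intro tendsto_mult_right_zero tendsto_neg_powr filterlim_real_sequentially) auto
  have AG0: "(\<lambda>n. sqrt (real n) * A n * G n) \<longlonglongrightarrow> 0"
    using tendsto_mult_right_zero[OF prod_rate, of K] by (simp add: G_def mult_ac)
  have rn0: "(\<lambda>n. 1 / real n) \<longlonglongrightarrow> 0" by (rule lim_1_over_n)
  have sn0: "(\<lambda>n. 1 / sqrt (real n)) \<longlonglongrightarrow> 0" using tendsto_real_sqrt[OF rn0] by (simp add: real_sqrt_divide)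
  have "(\<lambda>n. T\<^sup>2 * (1 / sqrt (real n) + G n + A n + sqrt (real n) * A n * G n)) \<longlonglongrightarrow> T\<^sup>2 * (0 + 0 + 0 + 0)"
    by (intro tendsto_mult tendsto_add tendsto_const sn0 G0 A AG0)
  then have ev_cond: "\<forall>\<^sub>F n in sequentially. T\<^sup>2 * (1 / sqrt (real n) + G n + A n + sqrt (real n) * A n * G n) < e' * \<kappa> * c / 8"
    using e' k0 J(2) by (intro order_tendstoD) auto
  have "(\<lambda>n. 2 * C\<alpha>\<^sup>2 * (G n)\<^sup>2 / e'\<^sup>2 + Cv * (A n)\<^sup>2 / e'\<^sup>2 + sqrt (real n) * A n * G n / e' + 8 * (A n)\<^sup>2 / \<kappa> + 4 * C\<alpha>^4 / (\<kappa>\<^sup>2 * c) * (1 / real n))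
      \<longlonglongrightarrow> 2 * C\<alpha>\<^sup>2 * 0\<^sup>2 / e'\<^sup>2 + Cv * 0\<^sup>2 / e'\<^sup>2 + 0 / e' + 8 * 0\<^sup>2 / \<kappa> + 4 * C\<alpha>^4 / (\<kappa>\<^sup>2 * c) * 0"
    by (intro tendsto_intros AG0 G0 A rn0) (use e' k0 in auto)
  then have ev_rest: "\<forall>\<^sub>F n in sequentially. 2 * C\<alpha>\<^sup>2 * (G n)\<^sup>2 / e'\<^sup>2 + Cv * (A n)\<^sup>2 / e'\<^sup>2 + sqrt (real n) * A n * G n / e' + 8 * (A n)\<^sup>2 / \<kappa> + 4 * C\<alpha>^4 / (\<kappa>\<^sup>2 * c) * (1 / real n) < \<delta> / 12"
    using \<delta> by (intro order_tendstoD) auto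
  have ev_A1: "\<forall>\<^sub>F n in sequentially. A n < 1" using order_tendstoD(2)[OF A(2), of 1] by simp
  have mg\<tau>: "wpa1 M (\<lambda>n \<omega>. (\<integral>\<^sup>+ w. ennreal ((m w (g n (obs (N n) \<omega>)) - m w \<gamma>)\<^sup>2) \<partial>F) \<le> ennreal \<tau>)"
    using mg \<tau> unfolding tendsto_0_in_prob_def by blast
  show ?thesis
    using eventually_whp_of_wpa1[OF a_err \<delta>6] eventually_whp_of_wpa1[OF g_riesz \<delta>6] eventually_whp_of_wpa1[OF mg\<tau> \<delta>6] gO
      ev_cond ev_rest ev_A1 J(1) eventually_ge_at_top[of 1]
  proof eventually_elim
    case (elim n)
    have n: "n \<ge> 1" by fact
    let ?P = "PiM (N n) (\<lambda>_. F)"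
    have gj [measurable]: "(\<lambda>x. g n (fst x) (X (snd x))) \<in> borel_measurable (?P \<Otimes>\<^sub>M F)"
    proof -
      have "(\<lambda>x. (fst x, X (snd x))) \<in> measurable (?P \<Otimes>\<^sub>M F) (?P \<Otimes>\<^sub>M MX)" by measurable
      from measurable_compose[OF this g_meas] show ?thesis by simp
    qed
    have mgj [measurable]: "(\<lambda>x. m (snd x) (g n (fst x))) \<in> borel_measurable (?P \<Otimes>\<^sub>M F)"
      using mg_meas by (simp add: split_beta)
    have \<rho>j: "(\<lambda>x. \<rho>h n (fst x) j) \<in> borel_measurable (?P \<Otimes>\<^sub>M F)" if "j < p n" for j
      by (rule measurable_compose[OF measurable_fst \<rho>_meas[OF that]])
    have aj [measurable]: "(\<lambda>x. lin_comb b (p n) (\<rho>h n (fst x)) (X (snd x))) \<in> borel_measurable (?P \<Otimes>\<^sub>M F)"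
      unfolding lin_comb_def using \<rho>j by (intro borel_measurable_sum borel_measurable_times) auto
    define B where "B = {d \<in> space ?P. (\<integral>\<^sup>+ w. ennreal ((g n d (X w) - \<gamma> (X w))\<^sup>2) \<partial>F) \<le> ennreal ((G n)\<^sup>2) \<and>
       (\<integral>\<^sup>+ w. ennreal ((m w (g n d) - m w \<gamma>)\<^sup>2) \<partial>F) \<le> ennreal \<tau> \<and>
       (LINT w|F. m w (g n d)) = (LINT w|F. \<alpha> (X w) * g n d (X w)) \<and> approx_err (p n) (\<rho>h n d) \<le> (A n)\<^sup>2}"
    have B: "B \<in> sets ?P"
    proof -
      have 1: "(\<lambda>d. \<integral>\<^sup>+ w. ennreal ((g n d (X w) - \<gamma> (X w))\<^sup>2) \<partial>F) \<in> borel_measurable ?P"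
        by (rule F.borel_measurable_nn_integral) (simp add: split_beta, measurable)
      have 2: "(\<lambda>d. \<integral>\<^sup>+ w. ennreal ((m w (g n d) - m w \<gamma>)\<^sup>2) \<partial>F) \<in> borel_measurable ?P"
        by (rule F.borel_measurable_nn_integral) (simp add: split_beta, measurable)
      have 3: "(\<lambda>d. LINT w|F. m w (g n d)) \<in> borel_measurable ?P"
        by (rule F.borel_measurable_lebesgue_integral) (simp add: split_beta)
      have 4: "(\<lambda>d. LINT w|F. \<alpha> (X w) * g n d (X w)) \<in> borel_measurable ?P"
        by (rule F.borel_measurable_lebesgue_integral) (simp add: split_beta)
      have 5: "(\<lambda>d. approx_err (p n) (\<rho>h n d)) \<in> borel_measurable ?P"
        unfolding approx_err_def by (rule F.borel_measurable_lebesgue_integral) (simp add: split_beta)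
      define f1 f2 f3 f4 f5 where "f1 = (\<lambda>d. \<integral>\<^sup>+ w. ennreal ((g n d (X w) - \<gamma> (X w))\<^sup>2) \<partial>F)"
        and "f2 = (\<lambda>d. \<integral>\<^sup>+ w. ennreal ((m w (g n d) - m w \<gamma>)\<^sup>2) \<partial>F)"
        and "f3 = (\<lambda>d. LINT w|F. m w (g n d))" and "f4 = (\<lambda>d. LINT w|F. \<alpha> (X w) * g n d (X w))"
        and "f5 = (\<lambda>d. approx_err (p n) (\<rho>h n d))"
      note fd = f1_def f2_def f3_def f4_def f5_def
      have [measurable]: "f1 \<in> borel_measurable ?P" "f2 \<in> borel_measurable ?P" "f3 \<in> borel_measurable ?P"
        "f4 \<in> borel_measurable ?P" "f5 \<in> borel_measurable ?P"
        unfolding fd by (fact 1 2 3 4 5)+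
      have eq: "{d \<in> space ?P. f3 d = f4 d} \<in> sets ?P" by (rule borel_measurable_eq) measurable
      have "B = {d \<in> space ?P. f1 d \<le> ennreal ((G n)\<^sup>2) \<and> f2 d \<le> ennreal \<tau> \<and> f5 d \<le> (A n)\<^sup>2} \<inter> {d \<in> space ?P. f3 d = f4 d}"
        by (auto simp add: B_def fd)
      also have "\<dots> \<in> sets ?P" by (intro sets.Int eq) measurable
      finally show ?thesis .
    qed
    have dS: "d \<in> space ?P" if "d \<in> B" for d using that by (simp add: B_def)
    have gd [measurable]: "g n d \<in> borel_measurable MX" if "d \<in> B" for d
      using measurable_Pair2[OF g_meas dS[OF that]] by simp
    have mgd [measurable]: "(\<lambda>w. m w (g n d)) \<in> borel_measurable F" if "d \<in> B" for d
      using measurable_Pair2[OF mg_meas dS[OF that]] by simp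
    have cJ: "real (card (J n)) > 0"
    proof -
      have "c * real n > 0" using J(2) n by simp
      then show ?thesis using elim(8) by linarith
    qed
    have s: "sqrt (real n) > 0" "sqrt (real n) * sqrt (real n) = real n" using n by auto
    have cond: "(T * sqrt n + T * n * G n) * (T * sqrt n + T * n * A n) \<le> e' * sqrt n * (\<kappa> * real (card (J n)) / 8)"
    proof -
      define q where "q = sqrt (real n)"
      have q: "q > 0" "real n = q * q" using s by (auto simp: q_def)
      have l5: "T\<^sup>2 * (1 / q + G n + A n + q * A n * G n) \<le> e' * \<kappa> * c / 8"
        using less_imp_le[OF elim(5)] by (simp only: q_def)
      have l8: "c * (q * q) \<le> real (card (J n))" using elim(8) by (simp only: q(2))
      \<comment> \<open>Factoring out the cube of \<open>q\<close>, the order of the right-hand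
        side, leaves four terms that tend to 0; the product rate is needed for the last of
        them.\<close>
      have "(T * q + T * (q * q) * G n) * (T * q + T * (q * q) * A n) =
        (q * q * q) * (T\<^sup>2 * (1 / q + G n + A n + q * A n * G n))"
        using q(1) by (simp add: field_simps power2_eq_square)
      also have "\<dots> \<le> (q * q * q) * (e' * \<kappa> * c / 8)"
        by (intro mult_left_mono l5) (use q(1) in simp)
      also have "\<dots> = e' * q * (\<kappa> * (c * (q * q)) / 8)" by simp
      also have "\<dots> \<le> e' * q * (\<kappa> * real (card (J n)) / 8)"
        using l8 e' q(1) k0 by (intro mult_left_mono divide_right_mono) auto
      finally show ?thesis by (simp only: q_def[symmetric] q(2)[symmetric])
    qed
    have rem: "whp ((2 * \<tau> + 2 * C\<alpha>\<^sup>2 * (G n)\<^sup>2) / e'\<^sup>2 + 2 * (C2 + C\<alpha>\<^sup>2) * S / T\<^sup>2 + Cv * (A n)\<^sup>2 / e'\<^sup>2 + sqrt n * A n * G n / e'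
        + sqrt S / T + Cv * S / T\<^sup>2 + sqrt S / T + 8 * (A n)\<^sup>2 / \<kappa> + 4 * C\<alpha>^4 / (\<kappa>\<^sup>2 * real (card (J n))))
      (\<lambda>\<omega>. obs (N n) \<omega> \<in> B \<longrightarrow>
        \<bar>fold_remainder (J n) (g n (obs (N n) \<omega>)) (lin_comb b (p n) (\<rho>h n (obs (N n) \<omega>))) \<omega>\<bar> < 4 * e' * sqrt n)"
      unfolding S_def
    proof (rule fold_remainder_bound[OF disj(1) disj(2) _ _ g_meas mg_meas \<rho>_meas B])
      show "card (J n) > 0" using cJ by simp
      show "real (card (J n)) \<le> real n" using nJ[of n] by simp
      show "integrable F (\<lambda>w. (g n d (X w) - \<gamma> (X w))\<^sup>2) \<and> (LINT w|F. (g n d (X w) - \<gamma> (X w))\<^sup>2) \<le> (G n)\<^sup>2" if "d \<in> B" for d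
        by (rule integrable_sq_of_nn_integral) (use that gd[OF that] in \<open>auto simp: B_def\<close>)
      show "integrable F (\<lambda>w. (m w (g n d) - m w \<gamma>)\<^sup>2) \<and> (LINT w|F. (m w (g n d) - m w \<gamma>)\<^sup>2) \<le> \<tau>" if "d \<in> B" for d
        by (rule integrable_sq_of_nn_integral) (use that mgd[OF that] \<tau> in \<open>auto simp: B_def\<close>)
    qed (use Gp[OF n] A(1)[of n] elim(7) \<tau> e' T(2) cond in \<open>auto simp: B_def\<close>)
    have cJb: "4 * C\<alpha>^4 / (\<kappa>\<^sup>2 * real (card (J n))) \<le> 4 * C\<alpha>^4 / (\<kappa>\<^sup>2 * c) * (1 / real n)"
    proof -
      have "4 * C\<alpha>^4 / (\<kappa>\<^sup>2 * real (card (J n))) \<le> 4 * C\<alpha>^4 / (\<kappa>\<^sup>2 * (c * real n))"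
        using elim(8) k0 J(2) n C\<alpha> cJ by (intro divide_left_mono mult_left_mono mult_pos_pos) auto
      then show ?thesis by (simp add: mult.assoc)
    qed
    have "2 * \<tau> / e'\<^sup>2 = \<delta> / 12" using e' by (simp add: \<tau>_def)
    then have q: "(2 * \<tau> + 2 * C\<alpha>\<^sup>2 * (G n)\<^sup>2) / e'\<^sup>2 + 2 * (C2 + C\<alpha>\<^sup>2) * S / T\<^sup>2 + Cv * (A n)\<^sup>2 / e'\<^sup>2 + sqrt n * A n * G n / e'
        + sqrt S / T + Cv * S / T\<^sup>2 + sqrt S / T + 8 * (A n)\<^sup>2 / \<kappa> + 4 * C\<alpha>^4 / (\<kappa>\<^sup>2 * real (card (J n))) \<le> \<delta> / 3"
      using cJb T(1) elim(6) unfolding add_divide_distrib[of "2 * \<tau>"] by linarith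
    note h = whp_conj[OF whp_conj[OF whp_conj[OF whp_conj[OF rem elim(1)] elim(2)] elim(3)] elim(4)]
    show ?case
    proof (rule whp_mono[OF h], goal_cases)
      case 1
      then show ?case using q by linarith
    next
      case (2 \<omega>)
      have "obs (N n) \<omega> \<in> space ?P" by (rule measurable_space[OF obs_measurable 2(1)])
      moreover have "(\<integral>\<^sup>+ w. ennreal ((g n (obs (N n) \<omega>) (X w) - \<gamma> (X w))\<^sup>2) \<partial>F) \<le> ennreal ((G n)\<^sup>2)"
        unfolding G_def by (rule nn_integral_sq_le_of_ms_norm[OF 2(2)[THEN conjunct2]]) (use K in simp)
      ultimately have "obs (N n) \<omega> \<in> B" using 2(2) by (simp add: B_def)
      then show ?case using 2(2) by (simp add: e'_def)
    qed
  qed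
qed

end

section \<open>Rates of approximation\<close>

lemma eps_nonneg: "p n \<ge> 2 \<Longrightarrow> eps p n \<ge> 0"
  by (simp add: eps_def)

text \<open>With \<open>p\<close> of polynomial size its logarithm is absorbed by an arbitrarily
  small power of \<open>n\<close>, which allows all rates to be expressed as powers.\<close>

lemma eps_le_powr:
  assumes p: "\<And>n. p n \<ge> 2" and pC: "\<exists>C>0. \<forall>\<^sub>F n in sequentially. real (p n) \<le> C * real n powr C" and c: "c > 0"
  shows "\<forall>\<^sub>F n in sequentially. eps p n \<le> real n powr (c - 1/2)"
proof -
  obtain C where C: "C > 0" and pb: "\<forall>\<^sub>F n in sequentially. real (p n) \<le> C * real n powr C" using pC by blast
  have "\<forall>\<^sub>F n::nat in sequentially. ln C + C * ln (real n) \<le> real n powr (2 * c)"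
    using C c by real_asymp
  then show ?thesis using pb eventually_ge_at_top[of 1]
  proof eventually_elim
    case (elim n)
    have n: "real n > 0" using elim by simp
    have "ln (real (p n)) \<le> ln (C * real n powr C)" using elim p[of n] by (intro ln_mono) auto
    also have "\<dots> = ln C + C * ln (real n)" using C n by (simp add: ln_mult ln_powr)
    finally have "ln (real (p n)) \<le> real n powr (2 * c)" using elim by linarith
    then have "ln (real (p n)) / real n \<le> real n powr (2 * c) / real n" by (rule divide_right_mono) simp
    also have "\<dots> = real n powr (2 * c - 1)" using n by (simp add: powr_diff)
    also have "\<dots> = (real n powr (c - 1/2))\<^sup>2" by (simp add: power2_eq_square powr_add[symmetric])
    finally have "sqrt (ln (real (p n)) / real n) \<le> sqrt ((real n powr (c - 1/2))\<^sup>2)" by (rule real_sqrt_le_mono)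
    then show ?case by (simp add: eps_def)
  qed
qed

lemma powr_neg_tendsto_0: "a < 0 \<Longrightarrow> (\<lambda>n. real n powr a) \<longlonglongrightarrow> 0"
  by (intro tendsto_neg_powr filterlim_real_sequentially)

lemma eps_tendsto_0:
  assumes p: "\<And>n. p n \<ge> 2" and pC: "\<exists>C>0. \<forall>\<^sub>F n in sequentially. real (p n) \<le> C * real n powr C"
  shows "eps p \<longlonglongrightarrow> 0"
proof (rule tendsto_sandwich[where f="\<lambda>_. 0" and h="\<lambda>n. real n powr (1/4 - 1/2)"])
  show "\<forall>\<^sub>F n in sequentially. eps p n \<le> real n powr (1/4 - 1/2)" by (rule eps_le_powr[OF p pC]) simp
qed (use eps_nonneg p powr_neg_tendsto_0[of "1/4 - 1/2"] in auto)

lemma eps_pos: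
  assumes "p n \<ge> 2" "n \<ge> 1"
  shows "eps p n > 0"
  using assms by (simp add: eps_def)

lemma floor_ge_half:
  assumes "x \<ge> (1::real)"
  shows "nat \<lfloor>x\<rfloor> \<ge> 1" "real (nat \<lfloor>x\<rfloor>) \<le> x" "x / 2 \<le> real (nat \<lfloor>x\<rfloor>)"
proof -
  have 1: "\<lfloor>x\<rfloor> \<ge> 1" using assms by linarith
  then show "nat \<lfloor>x\<rfloor> \<ge> 1" by linarith
  show "real (nat \<lfloor>x\<rfloor>) \<le> x" using 1 by linarith
  have "real_of_int \<lfloor>x\<rfloor> \<ge> 1" using 1 by linarith
  then show "x / 2 \<le> real (nat \<lfloor>x\<rfloor>)" using 1 by linarith
qed

context riesz_regression
begin

text \<open>The sparsity is chosen to balance the squared approximation error, of order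
  \<open>s powr (- 2 * \<xi>)\<close>, against the penalty
  \<open>(eps p n)\<^sup>2 * s\<close>.\<close>

lemma approx_rate_sparse:
  fixes p :: "nat \<Rightarrow> nat"
  assumes p: "\<And>n. p n \<ge> 2" and pC: "\<exists>C>0. \<forall>\<^sub>F n in sequentially. real (p n) \<le> C * real n powr C"
    and \<xi>: "\<xi> > 0" and C: "C > 1" and c: "c > 0"
    and A2: "\<forall>\<^sub>F n in sequentially. \<forall>s::nat. s > 0 \<and> real s \<le> C * eps p n powr (- 2 / (2 * \<xi> + 1)) \<longrightarrow>
         (\<exists>\<rho>. card {j. j < p n \<and> \<rho> j \<noteq> 0} = s \<and>
            ms_norm F (\<lambda>w. \<alpha> (X w) - lin_comb b (p n) \<rho> (X w)) \<le> ennreal (C * real s powr (- \<xi>)))"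
  shows "\<exists>\<rho>0 D. D > 0 \<and> (\<forall>\<^sub>F n in sequentially. approx_err (p n) (\<rho>0 n)
      + (eps p n)\<^sup>2 * real (card {j. j < p n \<and> \<rho>0 n j \<noteq> 0}) + (eps p n)\<^sup>2
      \<le> D * real n powr (2 * c - 2 * (\<xi> / (2 * \<xi> + 1))))"
proof -
  \<comment> \<open>In terms of \<open>\<beta>\<close> the balancing sparsity is the power
    \<open>4 * \<beta> - 2\<close> of \<epsilon>, and squared error and penalty are both of order
    \<epsilon> to the power \<open>4 * \<beta>\<close>.\<close>
  define \<beta> where "\<beta> = \<xi> / (2 * \<xi> + 1)"
  have \<beta>: "\<beta> > 0" "2 * \<beta> < 1" using \<xi> by (auto simp: \<beta>_def field_simps)
  have e4: "- 2 / (2 * \<xi> + 1) = 4 * \<beta> - 2" using \<xi> by (simp add: \<beta>_def field_simps)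
  have x4: "(4 * \<beta> - 2) * (- 2 * \<xi>) = 4 * \<beta>" using \<xi> by (simp add: \<beta>_def field_simps)
  define s where "s n = nat \<lfloor>eps p n powr (4 * \<beta> - 2)\<rfloor>" for n
  define P where "P n \<rho> \<longleftrightarrow> card {j. j < p n \<and> \<rho> j \<noteq> 0} = s n \<and>
            ms_norm F (\<lambda>w. \<alpha> (X w) - lin_comb b (p n) \<rho> (X w)) \<le> ennreal (C * real (s n) powr (- \<xi>))" for n \<rho>
  \<comment> \<open>Approximations exist only for large \<open>n\<close>; the choice is arbitrary
    elsewhere.\<close>
  define \<rho>0 where "\<rho>0 n = (SOME \<rho>. P n \<rho>)" for n
  define D where "D = C\<^sup>2 * 2 powr (2 * \<xi>) + 2"
  have Dp: "D > 0" unfolding D_def by (intro add_nonneg_pos) auto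
  have ev1: "\<forall>\<^sub>F n in sequentially. eps p n < 1" using order_tendstoD(2)[OF eps_tendsto_0[OF p pC], of 1] by simp
  have "\<forall>\<^sub>F n in sequentially. approx_err (p n) (\<rho>0 n)
      + (eps p n)\<^sup>2 * real (card {j. j < p n \<and> \<rho>0 n j \<noteq> 0}) + (eps p n)\<^sup>2
      \<le> D * real n powr (2 * c - 2 * \<beta>)"
    using A2 ev1 eps_le_powr[OF p pC c] eventually_ge_at_top[of 1]
  proof eventually_elim
    case (elim n)
    define e where "e = eps p n"
    have e: "e > 0" "e < 1" using eps_pos[of p n] p elim by (auto simp: e_def)
    have x1: "e powr (4 * \<beta> - 2) \<ge> 1"
    proof -
      have "e powr (4 * \<beta> - 2) \<ge> e powr 0" using e \<beta> by (intro powr_mono') auto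
      then show ?thesis using e by simp
    qed
    note fl = floor_ge_half[OF x1]
    have s: "s n \<ge> 1" "real (s n) \<le> e powr (4 * \<beta> - 2)" "e powr (4 * \<beta> - 2) / 2 \<le> real (s n)"
      using fl by (auto simp: s_def e_def)
    \<comment> \<open>The chosen sparsity has leading constant 1, so \<open>C > 1\<close> keeps it
      in the admissible range.\<close>
    have "real (s n) \<le> C * eps p n powr (- 2 / (2 * \<xi> + 1))"
    proof -
      have "1 * e powr (4 * \<beta> - 2) \<le> C * e powr (4 * \<beta> - 2)" using C by (intro mult_right_mono) auto
      then show ?thesis using s(2) unfolding e4 e_def[symmetric] by linarith
    qed
    then have "\<exists>\<rho>. P n \<rho>" using elim(1) s(1) unfolding P_def by auto
    then have P: "P n (\<rho>0 n)" unfolding \<rho>0_def by (rule someI_ex)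
    have "approx_err (p n) (\<rho>0 n) \<le> (C * real (s n) powr (- \<xi>))\<^sup>2"
    proof -
      have "(\<integral>\<^sup>+ w. ennreal ((\<alpha> (X w) - lin_comb b (p n) (\<rho>0 n) (X w))\<^sup>2) \<partial>F) \<le> ennreal ((C * real (s n) powr (- \<xi>))\<^sup>2)"
        by (rule nn_integral_sq_le_of_ms_norm) (use P C in \<open>auto simp: P_def\<close>)
      then show ?thesis unfolding approx_err_def
        using integrable_sq_of_nn_integral[of "\<lambda>w. \<alpha> (X w) - lin_comb b (p n) (\<rho>0 n) (X w)" F] by simp
    qed
    also have "\<dots> = C\<^sup>2 * real (s n) powr (- 2 * \<xi>)"
      by (simp add: power_mult_distrib power2_eq_square powr_add[symmetric])
    also have "\<dots> \<le> C\<^sup>2 * (e powr (4 * \<beta> - 2) / 2) powr (- 2 * \<xi>)"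
      using s(3) x1 \<xi> by (intro mult_left_mono powr_mono2') auto
    also have "(e powr (4 * \<beta> - 2) / 2) powr (- 2 * \<xi>) = e powr (4 * \<beta>) * 2 powr (2 * \<xi>)"
      using e by (simp only: powr_divide powr_powr x4) (simp add: powr_minus divide_inverse)
    finally have 1: "approx_err (p n) (\<rho>0 n) \<le> C\<^sup>2 * 2 powr (2 * \<xi>) * e powr (4 * \<beta>)" by (simp add: mult_ac)
    have e2: "e\<^sup>2 = e powr 2" using e by (simp add: powr_numeral)
    have "e\<^sup>2 * real (card {j. j < p n \<and> \<rho>0 n j \<noteq> 0}) = e\<^sup>2 * real (s n)" using P by (simp add: P_def)
    also have "\<dots> \<le> e powr 2 * e powr (4 * \<beta> - 2)" unfolding e2 using s(2) by (intro mult_left_mono) auto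
    also have "\<dots> = e powr (4 * \<beta>)" by (simp add: powr_add[symmetric])
    finally have 2: "e\<^sup>2 * real (card {j. j < p n \<and> \<rho>0 n j \<noteq> 0}) \<le> e powr (4 * \<beta>)" .
    have 3: "e\<^sup>2 \<le> e powr (4 * \<beta>)" unfolding e2 using e \<beta> by (intro powr_mono') auto
    have "e powr (4 * \<beta>) \<le> (real n powr (c - 1/2)) powr (4 * \<beta>)"
      using elim(3) e \<beta> by (intro powr_mono2) (auto simp: e_def)
    also have "\<dots> = real n powr ((c - 1/2) * (4 * \<beta>))" by (simp add: powr_powr)
    also have "\<dots> \<le> real n powr (2 * c - 2 * \<beta>)"
    proof (rule powr_mono)
      have "c * (2 * \<beta>) \<le> c * 1" using c \<beta> by (intro mult_left_mono) auto
      then show "(c - 1/2) * (4 * \<beta>) \<le> 2 * c - 2 * \<beta>" by (simp add: algebra_simps)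
    qed (use elim in simp)
    finally have 4: "e powr (4 * \<beta>) \<le> real n powr (2 * c - 2 * \<beta>)" .
    have "approx_err (p n) (\<rho>0 n) + e\<^sup>2 * real (card {j. j < p n \<and> \<rho>0 n j \<noteq> 0}) + e\<^sup>2 \<le> D * e powr (4 * \<beta>)"
      using 1 2 3 by (simp add: D_def algebra_simps)
    also have "\<dots> \<le> D * real n powr (2 * c - 2 * \<beta>)" using 4 Dp by (intro mult_left_mono) auto
    finally show ?case by (simp only: e_def)
  qed
  then show ?thesis using Dp unfolding \<beta>_def by blast
qed

text \<open>A dropped coefficient is no larger than each of the \<open>card J\<close> kept ones,
  hence at most their absolute sum divided by \<open>card J\<close>. The dropped squares therefore
  sum to at most the squared total over \<open>card J\<close>, and the eigenvalue bound turns this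
  into mean square. Fatou's lemma passes from finite tails to the series, whose convergence is only
  pointwise.\<close>

lemma approx_err_truncation:
  assumes eig: "\<And>q \<rho>. quad_form q gram_entry \<rho> \<le> \<Lambda> * (\<Sum>j<q. (\<rho> j)\<^sup>2)" "\<Lambda> \<ge> 0"
    and sums: "AE w in F. (\<lambda>j. \<rho>0 j * b j (X w)) sums \<alpha> (X w)" and summ: "summable (\<lambda>j. \<bar>\<rho>0 j\<bar>)"
    and J: "J \<subseteq> {..<q}" "card J > 0" "\<And>j k. j \<in> J \<Longrightarrow> k \<notin> J \<Longrightarrow> \<bar>\<rho>0 k\<bar> \<le> \<bar>\<rho>0 j\<bar>"
  shows "approx_err q (\<lambda>j. if j \<in> J then \<rho>0 j else 0) \<le> \<Lambda> * (\<Sum>j. \<bar>\<rho>0 j\<bar>)\<^sup>2 / real (card J)"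
proof -
  define R where "R = (\<Sum>j. \<bar>\<rho>0 j\<bar>)"
  have fJ: "finite J" using J finite_subset by blast
  have R: "(\<Sum>j\<in>A. \<bar>\<rho>0 j\<bar>) \<le> R" if "finite A" for A
    unfolding R_def using summ that by (intro sum_le_suminf) auto
  have R0: "R \<ge> 0" using R[of "{}"] by simp
  let ?\<rho>J = "\<lambda>j. if j \<in> J then \<rho>0 j else 0" and ?t = "\<lambda>j. if j \<in> J then 0 else \<rho>0 j"
  have small: "\<bar>\<rho>0 k\<bar> \<le> R / real (card J)" if "k \<notin> J" for k
  proof -
    have "real (card J) * \<bar>\<rho>0 k\<bar> \<le> (\<Sum>j\<in>J. \<bar>\<rho>0 j\<bar>)"
      using sum_mono[of J "\<lambda>_. \<bar>\<rho>0 k\<bar>" "\<lambda>j. \<bar>\<rho>0 j\<bar>"] J(3) that by simp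
    also have "\<dots> \<le> R" by (rule R[OF fJ])
    finally show ?thesis using J(2) by (simp add: pos_le_divide_eq mult.commute)
  qed
  define c where "c = \<Lambda> * R\<^sup>2 / real (card J)"
  have c0: "c \<ge> 0" using eig(2) by (simp add: c_def)
  have tail: "(LINT w|F. (lin_comb b N ?t (X w))\<^sup>2) \<le> c" for N
  proof -
    have "(\<Sum>j<N. (?t j)\<^sup>2) \<le> (\<Sum>j<N. R / real (card J) * \<bar>\<rho>0 j\<bar>)"
    proof (rule sum_mono)
      fix j
      show "(?t j)\<^sup>2 \<le> R / real (card J) * \<bar>\<rho>0 j\<bar>"
        using mult_right_mono[OF small[of j], of "\<bar>\<rho>0 j\<bar>"] R0 by (auto simp: power2_eq_square)
    qed
    also have "\<dots> = R / real (card J) * (\<Sum>j<N. \<bar>\<rho>0 j\<bar>)" by (simp add: sum_distrib_left)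
    also have "\<dots> \<le> R / real (card J) * R" using R0 R[of "{..<N}"] by (intro mult_left_mono) auto
    finally have "\<Lambda> * (\<Sum>j<N. (?t j)\<^sup>2) \<le> \<Lambda> * (R / real (card J) * R)" using eig(2) by (rule mult_left_mono)
    moreover have "\<Lambda> * (R / real (card J) * R) = c" by (simp add: c_def power2_eq_square)
    ultimately show ?thesis using eig(1)[of N ?t] unfolding integral_lin_comb_sq by linarith
  qed
  have lim: "AE w in F. (\<lambda>N. ennreal ((lin_comb b N ?t (X w))\<^sup>2)) \<longlonglongrightarrow> ennreal ((\<alpha> (X w) - lin_comb b q ?\<rho>J (X w))\<^sup>2)"
    using sums
  proof eventually_elim
    case (elim w)
    have "(\<lambda>N. \<Sum>j<N. \<rho>0 j * b j (X w)) \<longlonglongrightarrow> \<alpha> (X w)" using elim by (simp add: sums_def)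
    then have "(\<lambda>N. (\<Sum>j<N. \<rho>0 j * b j (X w)) - lin_comb b q ?\<rho>J (X w)) \<longlonglongrightarrow> \<alpha> (X w) - lin_comb b q ?\<rho>J (X w)"
      by (intro tendsto_intros)
    \<comment> \<open>Once \<open>N \<ge> q\<close> the kept terms all occur in the partial sum, and
      removing them leaves a finite combination of dropped terms.\<close>
    moreover have "\<forall>\<^sub>F N in sequentially. (\<Sum>j<N. \<rho>0 j * b j (X w)) - lin_comb b q ?\<rho>J (X w) = lin_comb b N ?t (X w)"
      using eventually_ge_at_top[of q]
    proof eventually_elim
      case (elim N)
      have "lin_comb b q ?\<rho>J (X w) = lin_comb b N ?\<rho>J (X w)"
        unfolding lin_comb_def using elim J(1) by (intro sum.mono_neutral_left) auto
      then show ?case unfolding lin_comb_def[of b N] sum_subtractf[symmetric]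
        by (simp only: lin_comb_def sum_subtractf[symmetric]) (intro sum.cong refl, auto)
    qed
    ultimately have "(\<lambda>N. lin_comb b N ?t (X w)) \<longlonglongrightarrow> \<alpha> (X w) - lin_comb b q ?\<rho>J (X w)"
      by (rule Lim_transform_eventually)
    then show ?case by (intro tendsto_ennrealI tendsto_power)
  qed
  have "(\<integral>\<^sup>+ w. ennreal ((\<alpha> (X w) - lin_comb b q ?\<rho>J (X w))\<^sup>2) \<partial>F) =
    (\<integral>\<^sup>+ w. liminf (\<lambda>N. ennreal ((lin_comb b N ?t (X w))\<^sup>2)) \<partial>F)"
  proof (rule nn_integral_cong_AE)
    show "AE w in F. ennreal ((\<alpha> (X w) - lin_comb b q ?\<rho>J (X w))\<^sup>2) = liminf (\<lambda>N. ennreal ((lin_comb b N ?t (X w))\<^sup>2))"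
      using lim by eventually_elim (rule lim_imp_Liminf[OF trivial_limit_sequentially, symmetric])
  qed
  also have "\<dots> \<le> liminf (\<lambda>N. \<integral>\<^sup>+ w. ennreal ((lin_comb b N ?t (X w))\<^sup>2) \<partial>F)"
    by (rule nn_integral_liminf) measurable
  also have "\<dots> \<le> ennreal c"
  proof -
    have "(\<integral>\<^sup>+ w. ennreal ((lin_comb b N ?t (X w))\<^sup>2) \<partial>F) \<le> ennreal c" for N
      by (subst nn_integral_eq_integral[OF lin_comb_sq]) (use tail[of N] in \<open>auto intro: ennreal_leI\<close>)
    then have "liminf (\<lambda>N. \<integral>\<^sup>+ w. ennreal ((lin_comb b N ?t (X w))\<^sup>2) \<partial>F) \<le> liminf (\<lambda>N. ennreal c)"
      by (intro Liminf_mono) auto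
    then show ?thesis by (simp add: Liminf_const)
  qed
  finally show ?thesis unfolding approx_err_def c_def R_def
    using integrable_sq_of_nn_integral[of "\<lambda>w. \<alpha> (X w) - lin_comb b q ?\<rho>J (X w)" F c] c0 by (simp add: c_def R_def)
qed

text \<open>Keeping about \<open>sqrt n\<close> terms gives squared error of order
  \<open>1 / sqrt n\<close>, and the penalty is of the same order up to small powers. This is the
  rate exponent 1/4.\<close>

lemma approx_rate_summable:
  fixes p :: "nat \<Rightarrow> nat"
  assumes p: "\<And>n. p n \<ge> 2" and pC: "\<exists>C>0. \<forall>\<^sub>F n in sequentially. real (p n) \<le> C * real n powr C"
    and c: "c > 0"
    and eig: "\<And>q \<rho>. quad_form q gram_entry \<rho> \<le> \<Lambda> * (\<Sum>j<q. (\<rho> j)\<^sup>2)" "\<Lambda> \<ge> 0"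
    and sums: "AE w in F. (\<lambda>j. \<rho>0 j * b j (X w)) sums \<alpha> (X w)" and summ: "summable (\<lambda>j. \<bar>\<rho>0 j\<bar>)"
    and C: "C > 0" and J: "\<forall>\<^sub>F n in sequentially. \<exists>J\<subseteq>{..<p n}.
                card J = nat \<lfloor>C * sqrt (real n)\<rfloor> \<and> (\<forall>j\<in>J. \<forall>k. k \<notin> J \<longrightarrow> \<bar>\<rho>0 k\<bar> \<le> \<bar>\<rho>0 j\<bar>)"
  shows "\<exists>\<rho>n D. D > 0 \<and> (\<forall>\<^sub>F n in sequentially. approx_err (p n) (\<rho>n n)
      + (eps p n)\<^sup>2 * real (card {j. j < p n \<and> \<rho>n n j \<noteq> 0}) + (eps p n)\<^sup>2
      \<le> D * real n powr (2 * c - 2 * (1/4)))"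
proof -
  define P where "P n J \<longleftrightarrow> J\<subseteq>{..<p n} \<and>
                card J = nat \<lfloor>C * sqrt (real n)\<rfloor> \<and> (\<forall>j\<in>J. \<forall>k. k \<notin> J \<longrightarrow> \<bar>\<rho>0 k\<bar> \<le> \<bar>\<rho>0 j\<bar>)" for n J
  define Jn where "Jn n = (SOME J. P n J)" for n
  define \<rho>n where "\<rho>n n = (\<lambda>j. if j \<in> Jn n then \<rho>0 j else 0)" for n
  define R where "R = (\<Sum>j. \<bar>\<rho>0 j\<bar>)"
  define D where "D = \<Lambda> * R\<^sup>2 * 2 / C + C + 1"
  have Dp: "D > 0" using eig(2) C by (simp add: D_def add_nonneg_pos)
  have ev1: "\<forall>\<^sub>F n::nat in sequentially. C * sqrt (real n) \<ge> 1" using C by real_asymp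
  have "\<forall>\<^sub>F n in sequentially. approx_err (p n) (\<rho>n n)
      + (eps p n)\<^sup>2 * real (card {j. j < p n \<and> \<rho>n n j \<noteq> 0}) + (eps p n)\<^sup>2
      \<le> D * real n powr (2 * c - 2 * (1/4))"
    using J ev1 eps_le_powr[OF p pC c] eventually_ge_at_top[of 1]
  proof eventually_elim
    case (elim n)
    have n: "real n > 0" "real n \<ge> 1" using elim by auto
    have "\<exists>J. P n J" using elim(1) unfolding P_def by auto
    then have P: "P n (Jn n)" unfolding Jn_def by (rule someI_ex)
    note fl = floor_ge_half[OF elim(2)]
    have cJ: "card (Jn n) \<ge> 1" "real (card (Jn n)) \<le> C * sqrt (real n)" "C * sqrt (real n) / 2 \<le> real (card (Jn n))"
      using fl P by (auto simp: P_def)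
    define e where "e = eps p n"
    have e0: "e \<ge> 0" using eps_nonneg[of p n] p[of n] by (simp add: e_def)
    have e2: "e\<^sup>2 \<le> real n powr (2 * c - 1)"
    proof -
      have "e\<^sup>2 \<le> (real n powr (c - 1/2))\<^sup>2" using elim(3) e0 by (intro power_mono) (auto simp: e_def)
      then show ?thesis by (simp add: power2_eq_square powr_add[symmetric])
    qed
    have sq: "sqrt (real n) = real n powr (1/2)" by (simp add: powr_half_sqrt)
    have 1: "approx_err (p n) (\<rho>n n) \<le> \<Lambda> * R\<^sup>2 * 2 / C * real n powr (2 * c - 1/2)"
    proof -
      have "approx_err (p n) (\<rho>n n) \<le> \<Lambda> * R\<^sup>2 / real (card (Jn n))"
        unfolding \<rho>n_def R_def by (rule approx_err_truncation[OF eig sums summ]) (use P cJ in \<open>auto simp: P_def\<close>)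
      also have "\<dots> \<le> \<Lambda> * R\<^sup>2 / (C * sqrt (real n) / 2)"
        using cJ C n eig(2) by (intro divide_left_mono mult_pos_pos) auto
      also have "\<dots> = \<Lambda> * R\<^sup>2 * 2 / C * real n powr (- 1/2)" using n C by (simp add: sq powr_minus field_simps)
      also have "\<dots> \<le> \<Lambda> * R\<^sup>2 * 2 / C * real n powr (2 * c - 1/2)"
        using n c C eig(2) by (intro mult_left_mono powr_mono) auto
      finally show ?thesis .
    qed
    have "{j. j < p n \<and> \<rho>n n j \<noteq> 0} \<subseteq> Jn n" by (auto simp: \<rho>n_def)
    moreover have "finite (Jn n)" using P finite_subset by (auto simp: P_def)
    ultimately have "card {j. j < p n \<and> \<rho>n n j \<noteq> 0} \<le> card (Jn n)" by (intro card_mono) auto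
    then have "real (card {j. j < p n \<and> \<rho>n n j \<noteq> 0}) \<le> C * real n powr (1/2)" using cJ(2) unfolding sq by linarith
    then have "e\<^sup>2 * real (card {j. j < p n \<and> \<rho>n n j \<noteq> 0}) \<le> real n powr (2 * c - 1) * (C * real n powr (1/2))"
      using e2 by (intro mult_mono) auto
    also have "\<dots> = C * real n powr (2 * c - 1/2)" by (simp add: powr_add[symmetric] mult.left_commute)
    finally have 2: "e\<^sup>2 * real (card {j. j < p n \<and> \<rho>n n j \<noteq> 0}) \<le> C * real n powr (2 * c - 1/2)" .
    have "real n powr (2 * c - 1) \<le> real n powr (2 * c - 1/2)" using n by (intro powr_mono) auto
    then have 3: "e\<^sup>2 \<le> real n powr (2 * c - 1/2)" using e2 by linarith
    have "approx_err (p n) (\<rho>n n) + e\<^sup>2 * real (card {j. j < p n \<and> \<rho>n n j \<noteq> 0}) + e\<^sup>2 \<le> D * real n powr (2 * c - 1/2)"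
      using 1 2 3 by (simp add: D_def algebra_simps)
    then show ?case by (simp add: e_def)
  qed
  then show ?thesis using Dp by blast
qed

text \<open>Truncation of a series needs the eigenvalue bound at every size, but it is given only at
  the sizes \<open>p n\<close>. Vectors with ever more nonzero entries are supplied in dimension
  \<open>p n\<close>, so \<open>p n\<close> eventually exceeds any \<open>q\<close>, and padding by
  zeros transfers the bound.\<close>

lemma gram_bound_all_sizes:
  assumes p: "\<And>n. p n \<ge> 2" and pC: "\<exists>C>0. \<forall>\<^sub>F n in sequentially. real (p n) \<le> C * real n powr C"
    and \<xi>: "\<xi> > 0" and C: "C > 1"
    and A2: "\<forall>\<^sub>F n in sequentially. \<forall>s::nat. s > 0 \<and> real s \<le> C * eps p n powr (- 2 / (2 * \<xi> + 1)) \<longrightarrow>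
         (\<exists>\<rho>::nat \<Rightarrow> real. card {j. j < p n \<and> \<rho> j \<noteq> 0} = s)"
    and eig: "\<And>n \<rho>. quad_form (p n) gram_entry \<rho> \<le> \<Lambda> * (\<Sum>j<p n. (\<rho> j)\<^sup>2)"
  shows "quad_form q gram_entry \<rho> \<le> \<Lambda> * (\<Sum>j<q. (\<rho> j)\<^sup>2)"
proof -
  have k: "2 / (2 * \<xi> + 1) > 0" using \<xi> by simp
  \<comment> \<open>The threshold at which sparsity \<open>q + 1\<close> becomes admissible.\<close>
  have "\<forall>\<^sub>F n in sequentially. eps p n < (1 / real (q + 1)) powr ((2 * \<xi> + 1) / 2)"
    by (rule order_tendstoD(2)[OF eps_tendsto_0[OF p pC]]) simp
  then have "\<forall>\<^sub>F n in sequentially. q \<le> p n" using A2 eventually_ge_at_top[of 1]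
  proof eventually_elim
    case (elim n)
    have e: "eps p n > 0" using eps_pos[of p n] p elim by auto
    have "eps p n powr (2 / (2 * \<xi> + 1)) \<le> ((1 / real (q + 1)) powr ((2 * \<xi> + 1) / 2)) powr (2 / (2 * \<xi> + 1))"
      using elim(1) e k by (intro powr_mono2) auto
    also have "\<dots> = 1 / real (q + 1)" using \<xi> by (simp add: powr_powr)
    finally have "real (q + 1) \<le> 1 / eps p n powr (2 / (2 * \<xi> + 1))" using e by (simp add: field_simps)
    also have "\<dots> = 1 * eps p n powr (- 2 / (2 * \<xi> + 1))" by (simp add: powr_minus_divide)
    also have "\<dots> \<le> C * eps p n powr (- 2 / (2 * \<xi> + 1))" using C by (intro mult_right_mono) auto
    finally have "real (q + 1) \<le> C * eps p n powr (- 2 / (2 * \<xi> + 1))" .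
    then obtain \<rho> :: "nat \<Rightarrow> real" where "card {j. j < p n \<and> \<rho> j \<noteq> 0} = q + 1" using elim(2)[rule_format, of "q + 1"] by auto
    moreover have "card {j. j < p n \<and> \<rho> j \<noteq> 0} \<le> card {..<p n}" by (rule card_mono) auto
    ultimately show ?case by simp
  qed
  then obtain n where n: "q \<le> p n" using eventually_happens'[OF sequentially_bot] by blast
  let ?\<rho> = "\<lambda>j. if j < q then \<rho> j else 0"
  have "lin_comb b (p n) ?\<rho> x = lin_comb b q \<rho> x" for x
    unfolding lin_comb_def by (rule sum.mono_neutral_cong_right) (use n in auto)
  then have "quad_form q gram_entry \<rho> = quad_form (p n) gram_entry ?\<rho>"
    by (simp add: integral_lin_comb_sq[symmetric])
  also have "\<dots> \<le> \<Lambda> * (\<Sum>j<p n. (?\<rho> j)\<^sup>2)" by (rule eig)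
  also have "(\<Sum>j<p n. (?\<rho> j)\<^sup>2) = (\<Sum>j<q. (\<rho> j)\<^sup>2)"
    by (rule sum.mono_neutral_cong_right) (use n in auto)
  finally show ?thesis .
qed

text \<open>One power \<open>c\<close> is spent on r/\<epsilon> and one on the approximation rate,
  which gives \<open>2 * c - \<beta>\<close> for the root of the error. \<open>max 1 n\<close> keeps
  the bound positive at \<open>n = 0\<close>, where a power of 0 would be 0.\<close>

lemma lasso_rate_powr:
  fixes p :: "nat \<Rightarrow> nat" and r :: "nat \<Rightarrow> real" and N :: "nat \<Rightarrow> nat set" and \<rho>0 :: "nat \<Rightarrow> nat \<Rightarrow> real"
  assumes p: "\<And>n. p n \<ge> 2" and r: "\<And>n. r n > 0"
    and eps0: "eps p \<longlonglongrightarrow> 0" and epsr: "eps p \<in> o(r)" and r_le: "r \<in> o(\<lambda>n. real n powr c * eps p n)"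
    and fin: "\<And>n. finite (N n)" and card: "\<forall>\<^sub>F n in sequentially. real n / 4 \<le> real (card (N n))"
    and Cm: "\<And>n. AE w in F. \<forall>j<p n. \<bar>m w (b j)\<bar> \<le> Cm" "Cm > 0"
    and eig: "\<And>n \<rho>. quad_form (p n) gram_entry \<rho> \<le> \<Lambda> * (\<Sum>j<p n. (\<rho> j)\<^sup>2)" "\<Lambda> \<ge> 0"
    and Cr: "Cr > 0" and cr: "cr > 0"
    and RE: "\<And>s::nat\<Rightarrow>nat. (\<lambda>n. real (s n) * (eps p n)\<^sup>2) \<longlonglongrightarrow> Cr \<Longrightarrow>
        wpa1 M (\<lambda>n \<omega>. restricted_eigenvalue_ge (p n) (s n) cr (G_hat X b (N n) (obs (N n) \<omega>)))"
    and opt: "\<And>n d \<rho>. d \<in> space (PiM (N n) (\<lambda>_. F)) \<Longrightarrow>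
        is_arg_min (lasso_objective (p n) (r n) (M_hat m b (N n) d) (G_hat X b (N n) d)) (\<lambda>_. True) \<rho> \<Longrightarrow>
        is_arg_min (lasso_objective (p n) (r n) (M_hat m b (N n) d) (G_hat X b (N n) d)) (\<lambda>_. True) (rh n d)"
    and approx: "\<forall>\<^sub>F n in sequentially. approx_err (p n) (\<rho>0 n)
      + (eps p n)\<^sup>2 * real (card {j. j < p n \<and> \<rho>0 n j \<noteq> 0}) + (eps p n)\<^sup>2 \<le> D * real n powr (2 * c - 2 * \<beta>)"
    and D: "D > 0" and c: "c < \<beta>"
  shows "\<exists>K>0. wpa1 M (\<lambda>n \<omega>. approx_err (p n) (rh n (obs (N n) \<omega>))
            \<le> (K * real (max 1 n) powr (2 * c - \<beta>))\<^sup>2)"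
proof -
  define val where "val n = approx_err (p n) (\<rho>0 n) + (eps p n)\<^sup>2 * real (card {j. j < p n \<and> \<rho>0 n j \<noteq> 0})" for n
  have v0: "val n \<ge> 0" for n unfolding val_def using approx_err_nonneg by (simp add: add_nonneg_nonneg)
  have "val \<longlonglongrightarrow> 0"
  proof (rule tendsto_sandwich[where f="\<lambda>_. 0" and h="\<lambda>n. D * real n powr (2 * c - 2 * \<beta>)"])
    show "\<forall>\<^sub>F n in sequentially. val n \<le> D * real n powr (2 * c - 2 * \<beta>)"
      using approx by (rule eventually_mono) (erule order_trans[rotated], simp add: val_def)
    show "(\<lambda>n. D * real n powr (2 * c - 2 * \<beta>)) \<longlonglongrightarrow> 0"
      using c by (intro tendsto_mult_right_zero powr_neg_tendsto_0) auto
  qed (use v0 in auto)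
  note val0 = this
  have val: "approx_err (p n) (\<rho>0 n) + (eps p n)\<^sup>2 * real (card {j. j < p n \<and> \<rho>0 n j \<noteq> 0}) \<le> val n" for n
    by (simp add: val_def)
  have "\<exists>K>0. wpa1 M (\<lambda>n \<omega>. approx_err (p n) (rh n (obs (N n) \<omega>))
            \<le> K * (r n / eps p n)\<^sup>2 * (val n + (eps p n)\<^sup>2))"
    by (rule lasso_rate[where Cm=Cm and \<Lambda>=\<Lambda> and Cr=Cr and c=cr])
      (fact p r eps0 epsr fin card Cm eig Cr cr RE opt val val0)+
  then obtain K0 where K0: "K0 > 0" and w: "wpa1 M (\<lambda>n \<omega>. approx_err (p n) (rh n (obs (N n) \<omega>))
            \<le> K0 * (r n / eps p n)\<^sup>2 * (val n + (eps p n)\<^sup>2))"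
    by blast
  have rb: "\<forall>\<^sub>F n in sequentially. norm (r n) \<le> 1 * norm (real n powr c * eps p n)"
    by (rule landau_o.smallD[OF r_le]) simp
  define K where "K = sqrt (K0 * D)"
  have K: "K > 0" "K\<^sup>2 = K0 * D" using K0 D by (auto simp: K_def)
  have "wpa1 M (\<lambda>n \<omega>. approx_err (p n) (rh n (obs (N n) \<omega>)) \<le> (K * real (max 1 n) powr (2 * c - \<beta>))\<^sup>2)"
  \<comment> \<open>A single event is involved; it is combined with itself to replace its bound by
    one that holds for large \<open>n\<close>.\<close>
  proof (rule wpa1_combine[OF w w])
    show "\<forall>\<^sub>F n in sequentially. \<forall>\<omega>\<in>space M.
       approx_err (p n) (rh n (obs (N n) \<omega>)) \<le> K0 * (r n / eps p n)\<^sup>2 * (val n + (eps p n)\<^sup>2) \<longrightarrow>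
       approx_err (p n) (rh n (obs (N n) \<omega>)) \<le> K0 * (r n / eps p n)\<^sup>2 * (val n + (eps p n)\<^sup>2) \<longrightarrow>
       approx_err (p n) (rh n (obs (N n) \<omega>)) \<le> (K * real (max 1 n) powr (2 * c - \<beta>))\<^sup>2"
      using approx rb eventually_ge_at_top[of 1]
    proof eventually_elim
      case (elim n)
      have e: "eps p n > 0" using eps_pos[of p n] p elim by auto
      have "r n \<le> real n powr c * eps p n" using elim(2) e r[of n] by simp
      then have "r n / eps p n \<le> real n powr c" using e by (simp add: pos_divide_le_eq)
      then have "(r n / eps p n)\<^sup>2 \<le> (real n powr c)\<^sup>2" using e r[of n] by (intro power_mono) auto
      then have "K0 * (r n / eps p n)\<^sup>2 * (val n + (eps p n)\<^sup>2) \<le> K0 * (real n powr c)\<^sup>2 * (D * real n powr (2 * c - 2 * \<beta>))"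
        using elim(1) K0 v0[of n] by (intro mult_mono) (auto simp: val_def)
      also have "\<dots> = (K0 * D) * (real n powr (2 * c - \<beta>))\<^sup>2"
        by (simp add: power2_eq_square powr_add[symmetric] mult_ac)
      also have "\<dots> = (K * real (max 1 n) powr (2 * c - \<beta>))\<^sup>2"
        using elim(3) by (simp add: power_mult_distrib K(2) max_def)
      finally show ?case by auto
    qed
  qed
  then show ?thesis using K(1) by blast
qed

end

section \<open>Asymptotic normality\<close>

lemma lin_comb_in_subspace:
  assumes "closed_linear_subspace F MX X \<Gamma>" "\<And>j. b j \<in> \<Gamma>"
  shows "lin_comb b p \<rho> \<in> \<Gamma>"
proof (induction p)
  case 0
  then show ?case using assms(1) by (simp add: closed_linear_subspace_def lin_comb_def[abs_def])
next
  case (Suc p)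
  have "(\<lambda>x. 1 * lin_comb b p \<rho> x + \<rho> p * b p x) \<in> \<Gamma>"
    using assms Suc unfolding closed_linear_subspace_def by blast
  moreover have "lin_comb b (Suc p) \<rho> = (\<lambda>x. 1 * lin_comb b p \<rho> x + \<rho> p * b p x)" by (auto simp: lin_comb_def)
  ultimately show ?case by simp
qed

lemma ms_norm_eq:
  assumes "integrable F (\<lambda>w. (f w)\<^sup>2)"
  shows "(ms_norm F f)\<^sup>2 = ennreal (LINT w|F. (f w)\<^sup>2)"
proof -
  have I: "(\<integral>\<^sup>+ w. ennreal ((f w)\<^sup>2) \<partial>F) = ennreal (LINT w|F. (f w)\<^sup>2)"
    by (rule nn_integral_eq_integral) (use assms in auto)
  have n: "(LINT w|F. (f w)\<^sup>2) \<ge> 0" by simp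
  have "ms_norm F f = ennreal (sqrt (LINT w|F. (f w)\<^sup>2))"
    unfolding ms_norm_def I Let_def using n by simp
  then show ?thesis using n by (simp add: ennreal_power)
qed

text \<open>The criterion along the line from the minimizer in direction \<open>g\<close> is a
  quadratic polynomial minimal at 0. Applied with \<open>U\<close> the Riesz representer and with
  \<open>U\<close> the outcome.\<close>

lemma projection_orthogonal:
  assumes F: "prob_space F" and X [measurable]: "X \<in> measurable F MX"
    and \<Gamma>: "closed_linear_subspace F MX X \<Gamma>"
    and U [measurable]: "U \<in> borel_measurable F" and U2: "integrable F (\<lambda>w. (U w)\<^sup>2)"
    and min: "is_arg_min (\<lambda>\<alpha>. LINT w|F. (U w - \<alpha> (X w))\<^sup>2) (\<lambda>\<alpha>. \<alpha> \<in> \<Gamma>) a"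
    and g: "g \<in> \<Gamma>"
  shows "(LINT w|F. (U w - a (X w)) * g (X w)) = 0"
proof -
  interpret F: prob_space F by (rule F)
  have a: "a \<in> \<Gamma>" using min by (simp add: is_arg_min_def)
  have sub: "\<Gamma> \<subseteq> sq_integrable_funs F MX X" using \<Gamma> by (simp add: closed_linear_subspace_def)
  have [measurable]: "a \<in> borel_measurable MX" "g \<in> borel_measurable MX"
    and a2: "integrable F (\<lambda>w. (a (X w))\<^sup>2)" and g2: "integrable F (\<lambda>w. (g (X w))\<^sup>2)"
    using a g sub by (auto simp: sq_integrable_funs_def)
  have r2: "integrable F (\<lambda>w. (U w - a (X w))\<^sup>2)"
    using F.integrable_sq_add(1)[of U "\<lambda>w. - a (X w)"] U2 a2 by simp
  have rg: "integrable F (\<lambda>w. (U w - a (X w)) * g (X w))"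
    by (rule F.integrable_mult_of_sq) (use r2 g2 in auto)
  have "- (LINT w|F. (U w - a (X w)) * g (X w)) = 0"
  proof (rule linear_coeff_zero_of_nonneg[where b="LINT w|F. (g (X w))\<^sup>2"])
    fix t :: real
    have "(\<lambda>x. 1 * a x + t * g x) \<in> \<Gamma>" using \<Gamma> a g unfolding closed_linear_subspace_def by blast
    then have "(LINT w|F. (U w - a (X w))\<^sup>2) \<le> (LINT w|F. (U w - (1 * a (X w) + t * g (X w)))\<^sup>2)"
      using min by (auto simp: is_arg_min_def not_less)
    also have "\<dots> = (LINT w|F. (U w - a (X w))\<^sup>2 + (t\<^sup>2 * (g (X w))\<^sup>2 - 2 * t * ((U w - a (X w)) * g (X w))))"
      by (intro Bochner_Integration.integral_cong refl) (simp add: power2_eq_square algebra_simps)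
    also have "\<dots> = (LINT w|F. (U w - a (X w))\<^sup>2) + (t\<^sup>2 * (LINT w|F. (g (X w))\<^sup>2) - 2 * t * (LINT w|F. (U w - a (X w)) * g (X w)))"
      using r2 g2 rg by simp
    finally show "0 \<le> 2 * t * - (LINT w|F. (U w - a (X w)) * g (X w)) + t\<^sup>2 * (LINT w|F. (g (X w))\<^sup>2)" by simp
  qed
  then show ?thesis by simp
qed

text \<open>A function of \<open>X\<close> is measurable for the sub-sigma-algebra generated by
  \<open>X\<close>, so the conditional second moment can be inserted under the integral. The bound
  \<open>B\<close> gives integrability and does not enter the estimate.\<close>

lemma conditional_variance_bound:
  fixes a :: "'x \<Rightarrow> real" and R :: "'w \<Rightarrow> real"
  assumes F: "prob_space F" and X [measurable]: "X \<in> measurable F MX"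
    and R [measurable]: "R \<in> borel_measurable F" and R2: "integrable F (\<lambda>w. (R w)\<^sup>2)"
    and cond: "AE w in F. \<bar>real_cond_exp F (vimage_algebra (space F) X MX) (\<lambda>w. (R w)\<^sup>2) w\<bar> \<le> C"
    and a [measurable]: "a \<in> borel_measurable MX" and bd: "AE w in F. \<bar>a (X w)\<bar> \<le> B"
  shows "integrable F (\<lambda>w. (a (X w) * R w)\<^sup>2)"
    and "(LINT w|F. (a (X w) * R w)\<^sup>2) \<le> C * (LINT w|F. (a (X w))\<^sup>2)"
proof -
  interpret F: prob_space F by (rule F)
  let ?Fs = "vimage_algebra (space F) X MX"
  have sub: "subalgebra F ?Fs"
    unfolding subalgebra_def by (auto simp: sets_vimage_algebra2[OF measurable_space[OF X, THEN funcsetI]] intro: measurable_sets[OF X])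
  interpret finite_measure_subalgebra F ?Fs by unfold_locales (rule sub)
  have bd2: "AE w in F. (a (X w))\<^sup>2 \<le> B\<^sup>2"
    using bd
  proof eventually_elim
    case (elim w)
    have "\<bar>a (X w)\<bar>\<^sup>2 \<le> B\<^sup>2" by (rule power_mono[OF elim]) simp
    then show ?case by simp
  qed
  have i: "integrable F (\<lambda>w. (a (X w))\<^sup>2 * (R w)\<^sup>2)"
  proof (rule Bochner_Integration.integrable_bound[where f="\<lambda>w. B\<^sup>2 * (R w)\<^sup>2"])
    show "AE w in F. norm ((a (X w))\<^sup>2 * (R w)\<^sup>2) \<le> norm (B\<^sup>2 * (R w)\<^sup>2)"
      using bd2 by eventually_elim (auto intro: mult_right_mono)
  qed (use R2 in auto)
  then show "integrable F (\<lambda>w. (a (X w) * R w)\<^sup>2)" by (simp add: power_mult_distrib)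
  have ia: "integrable F (\<lambda>w. (a (X w))\<^sup>2)"
    by (rule F.integrable_const_bound[where B="B\<^sup>2"]) (use bd2 in auto)
  have "X \<in> measurable ?Fs MX" by (rule measurable_vimage_algebra1) (use measurable_space[OF X] in auto)
  from measurable_compose[OF this a] have am: "(\<lambda>w. (a (X w))\<^sup>2) \<in> borel_measurable ?Fs" by measurable
  note ci = real_cond_exp_intg[OF i am]
  have "(LINT w|F. (a (X w))\<^sup>2 * (R w)\<^sup>2) = (LINT w|F. (a (X w))\<^sup>2 * real_cond_exp F ?Fs (\<lambda>w. (R w)\<^sup>2) w)"
    using ci(2) by simp
  also have "\<dots> \<le> (LINT w|F. (a (X w))\<^sup>2 * C)"
  proof (rule integral_mono_AE)
    show "AE w in F. (a (X w))\<^sup>2 * real_cond_exp F ?Fs (\<lambda>w. (R w)\<^sup>2) w \<le> (a (X w))\<^sup>2 * C"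
      using cond by eventually_elim (auto intro: mult_left_mono)
  qed (use ci(1) ia in auto)
  finally show "(LINT w|F. (a (X w) * R w)\<^sup>2) \<le> C * (LINT w|F. (a (X w))\<^sup>2)"
    using ia by (simp add: power_mult_distrib mult.commute)
qed

theorem corollary4:
  fixes M :: "'a measure" and F :: "'w measure" and MX :: "'x measure"
    and W :: "nat \<Rightarrow> 'a \<Rightarrow> 'w" and X :: "'w \<Rightarrow> 'x" and Y :: "'w \<Rightarrow> real"
    and \<Gamma> :: "('x \<Rightarrow> real) set" and m :: "'w \<Rightarrow> ('x \<Rightarrow> real) \<Rightarrow> real"
    and \<alpha>0 \<alpha>bar \<gamma>bar :: "'x \<Rightarrow> real" and \<theta>bar V :: real and \<psi> :: "'w \<Rightarrow> real"
    and b :: "nat \<Rightarrow> 'x \<Rightarrow> real" and p :: "nat \<Rightarrow> nat" and r :: "nat \<Rightarrow> real"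
    and L :: nat and I :: "nat \<Rightarrow> nat \<Rightarrow> nat set"
    and gh :: "nat \<Rightarrow> nat \<Rightarrow> (nat \<Rightarrow> 'w) \<Rightarrow> 'x \<Rightarrow> real"
    and rh :: "nat \<Rightarrow> nat \<Rightarrow> (nat \<Rightarrow> 'w) \<Rightarrow> nat \<Rightarrow> real"
    and train :: "nat \<Rightarrow> nat \<Rightarrow> 'a \<Rightarrow> nat \<Rightarrow> 'w"
    and \<xi> :: real
  assumes M: "prob_space M"
    and indep: "prob_space.indep_vars M (\<lambda>_. F) W UNIV"
    and ident: "\<And>i. distr M F (W i) = F"
    and X: "X \<in> measurable F MX"
    and Y: "Y \<in> borel_measurable F" "integrable F (\<lambda>w. (Y w)\<^sup>2)"
    and \<Gamma>: "closed_linear_subspace F MX X \<Gamma>"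
    and m_linear: "\<And>w. w \<in> space F \<Longrightarrow> linear_functional_on (sq_integrable_funs F MX X) (m w)"
    and \<alpha>0: "\<alpha>0 \<in> sq_integrable_funs F MX X"
    and riesz: "\<And>\<gamma>. \<gamma> \<in> sq_integrable_funs F MX X \<Longrightarrow>
          integrable F (\<lambda>w. m w \<gamma>) \<and> (LINT w|F. m w \<gamma>) = (LINT w|F. \<alpha>0 (X w) * \<gamma> (X w))"
    and \<alpha>bar: "is_arg_min (\<lambda>\<alpha>. LINT w|F. (\<alpha>0 (X w) - \<alpha> (X w))\<^sup>2) (\<lambda>\<alpha>. \<alpha> \<in> \<Gamma>) \<alpha>bar"
    and \<gamma>bar: "is_arg_min (\<lambda>\<gamma>. LINT w|F. (Y w - \<gamma> (X w))\<^sup>2) (\<lambda>\<gamma>. \<gamma> \<in> \<Gamma>) \<gamma>bar"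
    and \<theta>bar: "\<theta>bar = (LINT w|F. m w \<gamma>bar)"
    and \<psi>: "\<psi> = (\<lambda>w. m w \<gamma>bar - \<theta>bar + \<alpha>bar (X w) * (Y w - \<gamma>bar (X w)))"
    and V: "V = (LINT w|F. (\<psi> w)\<^sup>2)"
    and p: "\<And>n. p n \<ge> 2"
    and r: "\<And>n. r n > 0"
    and L: "L \<ge> 2"
    and folds: "\<And>n. (\<Union>l<L. I n l) = {..<n}" "\<And>n. disjoint_family_on (I n) {..<L}"
    and equal_folds: "\<And>l. l < L \<Longrightarrow> (\<lambda>n. real (card (I n l)) / real n) \<longlonglongrightarrow> 1 / real L"
    and train: "train = (\<lambda>n l \<omega>. restrict (\<lambda>i. W i \<omega>) (out_fold I n l))"
    and gh_measurable: "\<And>n l. l < L \<Longrightarrow>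
          (\<lambda>(d, x). gh n l d x) \<in> borel_measurable (PiM (out_fold I n l) (\<lambda>_. F) \<Otimes>\<^sub>M MX)"
    and m_gh_measurable: "\<And>n l. l < L \<Longrightarrow>
          (\<lambda>(d, w). m w (gh n l d)) \<in> borel_measurable (PiM (out_fold I n l) (\<lambda>_. F) \<Otimes>\<^sub>M F)"
    and rh_measurable: "\<And>n l j. l < L \<Longrightarrow> j < p n \<Longrightarrow>
          (\<lambda>d. rh n l d j) \<in> borel_measurable (PiM (out_fold I n l) (\<lambda>_. F))"
  (* a lasso minimizer, in every sample in which there is one *)
    and rh: "\<And>n l d \<rho>. l < L \<Longrightarrow> d \<in> space (PiM (out_fold I n l) (\<lambda>_. F)) \<Longrightarrow>
          is_arg_min (lasso_objective (p n) (r n) (M_hat m b (out_fold I n l) d)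
            (G_hat X b (out_fold I n l) d)) (\<lambda>_. True) \<rho> \<Longrightarrow>
          is_arg_min (lasso_objective (p n) (r n) (M_hat m b (out_fold I n l) d)
            (G_hat X b (out_fold I n l) d)) (\<lambda>_. True) (rh n l d)"
    and theta_tilde_measurable: "\<And>n.
          (\<lambda>\<omega>. theta_tilde m X Y b p L I gh rh n (\<lambda>i. W i \<omega>)) \<in> borel_measurable M"
    and A1: "\<And>j. b j \<in> \<Gamma>"
      "\<And>\<alpha> e. \<alpha> \<in> \<Gamma> \<Longrightarrow> e > 0 \<Longrightarrow>
         \<exists>q \<rho>. (LINT w|F. (\<alpha> (X w) - lin_comb b q \<rho> (X w))\<^sup>2) < e"
    and \<xi>: "\<xi> > 0"
    and A2: "\<exists>C>1. \<forall>\<^sub>F n in sequentially. \<forall>s::nat.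
         s > 0 \<and> real s \<le> C * eps p n powr (- 2 / (2 * \<xi> + 1)) \<longrightarrow>
         (\<exists>\<rho>. card {j. j < p n \<and> \<rho> j \<noteq> 0} = s \<and>
            ms_norm F (\<lambda>w. \<alpha>bar (X w) - lin_comb b (p n) \<rho> (X w)) \<le> ennreal (C * real s powr (- \<xi>)))"
    and A3: "\<exists>C. \<forall>n. \<forall>k\<in>spectrum (gram F X b (p n)). k \<le> C"
      "\<exists>C>0. \<exists>c>0. \<forall>l<L. \<forall>s :: nat \<Rightarrow> nat.
         (\<lambda>n. real (s n) * (eps p n)\<^sup>2) \<longlonglongrightarrow> C \<longrightarrow>
         wpa1 M (\<lambda>n \<omega>. restricted_eigenvalue_ge (p n) (s n) c
                         (G_hat X b (out_fold I n l) (train n l \<omega>)))"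
    and A4: "\<exists>C>0. AE w in F. \<forall>j. \<bar>b j (X w)\<bar> \<le> C"
    and A5: "eps p \<in> o(r)"
      "\<And>c. c > 0 \<Longrightarrow> r \<in> o(\<lambda>n. real n powr c * eps p n)"
      "\<exists>C>0. \<forall>\<^sub>F n in sequentially. real (p n) \<le> C * real n powr C"
    and A6: "\<exists>C>0. \<forall>n. AE w in F. \<forall>j<p n. \<bar>m w (b j)\<bar> \<le> C"
    and A7: "\<exists>C. AE w in F. \<bar>real_cond_exp F (vimage_algebra (space F) X MX)
                                (\<lambda>w. (Y w - \<gamma>bar (X w))\<^sup>2) w\<bar> \<le> C"
      "\<exists>C. AE w in F. \<bar>\<alpha>bar (X w)\<bar> \<le> C"
    and A8: "integrable F (\<lambda>w. (m w \<gamma>bar)\<^sup>2)"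
      "\<And>l. l < L \<Longrightarrow> tendsto_0_in_prob M
         (\<lambda>n \<omega>. \<integral>\<^sup>+ w. ennreal ((m w (gh n l (train n l \<omega>)) - m w \<gamma>bar)\<^sup>2) \<partial>F)"
    and A9: "\<And>l. l < L \<Longrightarrow> wpa1 M (\<lambda>n \<omega>. gh n l (train n l \<omega>) \<in> \<Gamma>)"
      "\<exists>d\<gamma>>0.
         (\<forall>l<L. bigO_in_prob M (\<lambda>n \<omega>. ms_norm F (\<lambda>w. gh n l (train n l \<omega>) (X w) - \<gamma>bar (X w)))
                  (\<lambda>n. real n powr (- d\<gamma>))) \<and>
         (\<xi> / (2 * \<xi> + 1) + d\<gamma> > 1 / 2 \<or>
          d\<gamma> > 1 / 4 \<and>
          (\<exists>\<rho>0 :: nat \<Rightarrow> real.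
             (AE w in F. (\<lambda>j. \<rho>0 j * b j (X w)) sums \<alpha>bar (X w)) \<and>
             summable (\<lambda>j. \<bar>\<rho>0 j\<bar>) \<and>
             (\<exists>C>0. \<forall>\<^sub>F n in sequentially. \<exists>J\<subseteq>{..<p n}.
                card J = nat \<lfloor>C * sqrt (real n)\<rfloor> \<and> (\<forall>j\<in>J. \<forall>k. k \<notin> J \<longrightarrow> \<bar>\<rho>0 k\<bar> \<le> \<bar>\<rho>0 j\<bar>))))"
    and A10: "\<exists>C>0. \<forall>\<gamma>\<in>\<Gamma>. (\<integral>\<^sup>+ w. ennreal ((m w \<gamma>)\<^sup>2) \<partial>F) \<le> ennreal C * (ms_norm F (\<lambda>w. \<gamma> (X w)))\<^sup>2"
      "\<not> (AE w in F. \<alpha>bar (X w) = 0)"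
  shows "weak_conv_m
           (\<lambda>n. distr M borel (\<lambda>\<omega>.
              sqrt (real n) * (theta_tilde m X Y b p L I gh rh n (\<lambda>i. W i \<omega>) - \<theta>bar)))
           (centered_normal V)"
proof -
  interpret iid_sample M F W
    using M indep ident by (simp add: iid_sample_def iid_sample_axioms_def)
  interpret F: prob_space F by (rule prob_space_F)
  note [measurable] = X Y(1)
  have sub: "\<Gamma> \<subseteq> sq_integrable_funs F MX X" using \<Gamma> by (simp add: closed_linear_subspace_def)
  have ab\<Gamma>: "\<alpha>bar \<in> \<Gamma>" and gb\<Gamma>: "\<gamma>bar \<in> \<Gamma>" using \<alpha>bar \<gamma>bar by (auto simp: is_arg_min_def)
  have ab [measurable]: "\<alpha>bar \<in> borel_measurable MX" and ab2: "integrable F (\<lambda>w. (\<alpha>bar (X w))\<^sup>2)"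
    and gb [measurable]: "\<gamma>bar \<in> borel_measurable MX" and gb2: "integrable F (\<lambda>w. (\<gamma>bar (X w))\<^sup>2)"
    using ab\<Gamma> gb\<Gamma> sub by (auto simp: sq_integrable_funs_def)
  have a0 [measurable]: "\<alpha>0 \<in> borel_measurable MX" and a02: "integrable F (\<lambda>w. (\<alpha>0 (X w))\<^sup>2)"
    using \<alpha>0 by (auto simp: sq_integrable_funs_def)
  have a0X: "(\<lambda>w. \<alpha>0 (X w)) \<in> borel_measurable F" by measurable
  have b_m: "b j \<in> borel_measurable MX" for j using A1(1)[of j] sub by (auto simp: sq_integrable_funs_def)
  \<comment> \<open>On \<open>\<Gamma>\<close> the projection represents the functional as well as
    \<open>\<alpha>0\<close> does, because their difference is orthogonal to
    \<open>\<Gamma>\<close>.\<close>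
  have orth\<alpha>: "(LINT w|F. \<alpha>0 (X w) * g (X w)) = (LINT w|F. \<alpha>bar (X w) * g (X w))" if g: "g \<in> \<Gamma>" for g
  proof -
    have [measurable]: "g \<in> borel_measurable MX" and g2: "integrable F (\<lambda>w. (g (X w))\<^sup>2)"
      using g sub by (auto simp: sq_integrable_funs_def)
    have "integrable F (\<lambda>w. \<alpha>0 (X w) * g (X w))" "integrable F (\<lambda>w. \<alpha>bar (X w) * g (X w))"
      by (rule F.integrable_mult_of_sq; use g2 a02 ab2 in simp)+
    moreover have "(LINT w|F. (\<alpha>0 (X w) - \<alpha>bar (X w)) * g (X w)) = 0"
      by (rule projection_orthogonal[OF F.prob_space_axioms X \<Gamma> a0X a02 \<alpha>bar g])
    ultimately show ?thesis by (simp add: left_diff_distrib)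
  qed
  have m_riesz: "integrable F (\<lambda>w. m w g)" "(LINT w|F. m w g) = (LINT w|F. \<alpha>bar (X w) * g (X w))" if g: "g \<in> \<Gamma>" for g
    using riesz[of g] orth\<alpha>[OF g] g sub by auto
  have orthY: "(LINT w|F. g (X w) * (Y w - \<gamma>bar (X w))) = 0" if g: "g \<in> \<Gamma>" for g
    using projection_orthogonal[OF F.prob_space_axioms X \<Gamma> Y \<gamma>bar g] by (simp add: mult.commute)
  have lc\<Gamma>: "lin_comb b q \<rho> \<in> \<Gamma>" for q \<rho> by (rule lin_comb_in_subspace[OF \<Gamma> A1(1)])
  obtain Cb where Cb: "Cb > 0" "AE w in F. \<forall>j. \<bar>b j (X w)\<bar> \<le> Cb" using A4 by blast
  obtain Cm where Cm: "Cm > 0" "\<And>n. AE w in F. \<forall>j<p n. \<bar>m w (b j)\<bar> \<le> Cm" using A6 by blast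
  obtain Cv0 where Cv0: "AE w in F. \<bar>real_cond_exp F (vimage_algebra (space F) X MX) (\<lambda>w. (Y w - \<gamma>bar (X w))\<^sup>2) w\<bar> \<le> Cv0"
    using A7(1) by blast
  \<comment> \<open>Enlarging the constant makes it positive, as the locale requires; the same is
    done for the bound of \<open>\<alpha>bar\<close>.\<close>
  define Cv where "Cv = \<bar>Cv0\<bar> + 1"
  have Cv: "Cv > 0" "AE w in F. \<bar>real_cond_exp F (vimage_algebra (space F) X MX) (\<lambda>w. (Y w - \<gamma>bar (X w))\<^sup>2) w\<bar> \<le> Cv"
    using Cv0 by (auto simp: Cv_def elim!: eventually_mono)
  obtain C\<alpha>0 where C\<alpha>0: "AE w in F. \<bar>\<alpha>bar (X w)\<bar> \<le> C\<alpha>0" using A7(2) by blast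
  define C\<alpha> where "C\<alpha> = \<bar>C\<alpha>0\<bar> + 1"
  have C\<alpha>: "C\<alpha> > 0" "AE w in F. \<bar>\<alpha>bar (X w)\<bar> \<le> C\<alpha>" using C\<alpha>0 by (auto simp: C\<alpha>_def elim!: eventually_mono)
  obtain C2 where C2: "C2 > 0" "\<And>\<gamma>. \<gamma> \<in> \<Gamma> \<Longrightarrow> (\<integral>\<^sup>+ w. ennreal ((m w \<gamma>)\<^sup>2) \<partial>F) \<le> ennreal C2 * (ms_norm F (\<lambda>w. \<gamma> (X w)))\<^sup>2"
    using A10(1) by blast
  have m_lin: "m w (lin_comb b q \<rho>) = (\<Sum>j<q. \<rho> j * m w (b j))" if "w \<in> space F" for w q \<rho>
    by (rule linear_functional_lin_comb[OF m_linear[OF that]]) (use A1(1) lc\<Gamma> sub in auto)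
  have m_b_meas [measurable]: "(\<lambda>w. m w (b j)) \<in> borel_measurable F" for j using m_riesz(1)[OF A1(1)] by auto
  have m_lin_sq: "integrable F (\<lambda>w. (\<Sum>j<q. \<rho> j * m w (b j))\<^sup>2) \<and>
        (LINT w|F. (\<Sum>j<q. \<rho> j * m w (b j))\<^sup>2) \<le> C2 * (LINT w|F. (lin_comb b q \<rho> (X w))\<^sup>2)" for q \<rho>
  proof -
    have "integrable F (\<lambda>w. (lin_comb b q \<rho> (X w))\<^sup>2)" using lc\<Gamma> sub by (auto simp: sq_integrable_funs_def)
    note ms = ms_norm_eq[OF this]
    have "(\<integral>\<^sup>+ w. ennreal ((\<Sum>j<q. \<rho> j * m w (b j))\<^sup>2) \<partial>F) = (\<integral>\<^sup>+ w. ennreal ((m w (lin_comb b q \<rho>))\<^sup>2) \<partial>F)"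
      by (rule nn_integral_cong) (simp add: m_lin)
    also have "\<dots> \<le> ennreal C2 * ennreal (LINT w|F. (lin_comb b q \<rho> (X w))\<^sup>2)"
      using C2(2)[OF lc\<Gamma>, of q \<rho>] unfolding ms .
    also have "\<dots> = ennreal (C2 * (LINT w|F. (lin_comb b q \<rho> (X w))\<^sup>2))" using C2(1) by (simp add: ennreal_mult)
    finally show ?thesis using C2(1) by (intro integrable_sq_of_nn_integral) auto
  qed
  have r2: "integrable F (\<lambda>w. (Y w - \<gamma>bar (X w))\<^sup>2)"
    using F.integrable_sq_add(1)[of Y "\<lambda>w. - \<gamma>bar (X w)"] Y(2) gb2 by simp
  have resid_var: "integrable F (\<lambda>w. (a (X w) * (Y w - \<gamma>bar (X w)))\<^sup>2) \<and>
        (LINT w|F. (a (X w) * (Y w - \<gamma>bar (X w)))\<^sup>2) \<le> Cv * (LINT w|F. (a (X w))\<^sup>2)"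
    if "a \<in> borel_measurable MX" "AE w in F. \<bar>a (X w)\<bar> \<le> B" for a B
    using conditional_variance_bound[OF F.prob_space_axioms X _ r2 Cv(2) that] by auto
  have nz: "(LINT w|F. (\<alpha>bar (X w))\<^sup>2) > 0"
  proof -
    have "(LINT w|F. (\<alpha>bar (X w))\<^sup>2) \<noteq> 0"
    proof
      assume "(LINT w|F. (\<alpha>bar (X w))\<^sup>2) = 0"
      then have "AE w in F. (\<alpha>bar (X w))\<^sup>2 = 0" using integral_nonneg_eq_0_iff_AE[OF ab2] by auto
      then show False using A10(2) by auto
    qed
    then show ?thesis by (simp add: less_le)
  qed
  have m_g_meas: "(\<lambda>w. m w \<gamma>bar) \<in> borel_measurable F" using m_riesz(1)[OF gb\<Gamma>] by auto
  interpret debiased_regression M F W MX X m b \<alpha>bar Cb Y \<gamma>bar C\<alpha> Cv C2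
    by unfold_locales
      (fact X b_m Cb m_b_meas m_riesz(2)[OF A1(1)] ab ab2 Y gb gb2 m_linear m_g_meas A8(1) m_riesz(2)[OF gb\<Gamma>]
        orthY[OF A1(1)] orthY[OF ab\<Gamma>] C\<alpha> resid_var Cv(1) m_lin_sq C2(1) nz)+

  have eps0: "eps p \<longlonglongrightarrow> 0" by (rule eps_tendsto_0[OF p A5(3)])
  obtain \<Lambda>0 where \<Lambda>0: "\<And>n k. k \<in> spectrum (gram F X b (p n)) \<Longrightarrow> k \<le> \<Lambda>0" using A3(1) by blast
  \<comment> \<open>Taking the maximum with 0 allows multiplication of inequalities by
    \<open>\<Lambda>\<close>.\<close>
  define \<Lambda> where "\<Lambda> = max \<Lambda>0 0"
  have \<Lambda>: "\<Lambda> \<ge> 0" by (simp add: \<Lambda>_def)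
  have eig: "quad_form (p n) gram_entry \<rho> \<le> \<Lambda> * (\<Sum>j<p n. (\<rho> j)\<^sup>2)" for n \<rho>
  proof (rule quad_form_le_of_spectrum[OF _ _ \<Lambda>])
    show "gram_entry j k = gram_entry k j" for j k by (simp add: gram_entry_def mult.commute)
    fix k assume "k \<in> spectrum (mat (p n) (p n) (\<lambda>(j, k). gram_entry j k))"
    then show "k \<le> \<Lambda>" using \<Lambda>0[of k n] by (simp add: gram_def gram_entry_def \<Lambda>_def)
  qed
  obtain CA where CA: "CA > 1" and A2': "\<forall>\<^sub>F n in sequentially. \<forall>s::nat.
         s > 0 \<and> real s \<le> CA * eps p n powr (- 2 / (2 * \<xi> + 1)) \<longrightarrow>
         (\<exists>\<rho>. card {j. j < p n \<and> \<rho> j \<noteq> 0} = s \<and>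
            ms_norm F (\<lambda>w. \<alpha>bar (X w) - lin_comb b (p n) \<rho> (X w)) \<le> ennreal (CA * real s powr (- \<xi>)))"
    using A2 by blast
  have eig_all: "quad_form q gram_entry \<rho> \<le> \<Lambda> * (\<Sum>j<q. (\<rho> j)\<^sup>2)" for q \<rho>
  proof (rule gram_bound_all_sizes[OF p A5(3) \<xi> CA _ eig])
    show "\<forall>\<^sub>F n in sequentially. \<forall>s::nat. s > 0 \<and> real s \<le> CA * eps p n powr (- 2 / (2 * \<xi> + 1)) \<longrightarrow>
         (\<exists>\<rho>::nat \<Rightarrow> real. card {j. j < p n \<and> \<rho> j \<noteq> 0} = s)"
      using A2' by eventually_elim blast
  qed
  obtain d\<gamma> where d\<gamma>: "d\<gamma> > 0"
    and g_rate: "\<And>l. l < L \<Longrightarrow> bigO_in_prob M (\<lambda>n \<omega>. ms_norm F (\<lambda>w. gh n l (train n l \<omega>) (X w) - \<gamma>bar (X w))) (\<lambda>n. real n powr (- d\<gamma>))"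
    and br: "\<xi> / (2 * \<xi> + 1) + d\<gamma> > 1 / 2 \<or>
          d\<gamma> > 1 / 4 \<and>
          (\<exists>\<rho>0 :: nat \<Rightarrow> real.
             (AE w in F. (\<lambda>j. \<rho>0 j * b j (X w)) sums \<alpha>bar (X w)) \<and>
             summable (\<lambda>j. \<bar>\<rho>0 j\<bar>) \<and>
             (\<exists>C>0. \<forall>\<^sub>F n in sequentially. \<exists>J\<subseteq>{..<p n}.
                card J = nat \<lfloor>C * sqrt (real n)\<rfloor> \<and> (\<forall>j\<in>J. \<forall>k. k \<notin> J \<longrightarrow> \<bar>\<rho>0 k\<bar> \<le> \<bar>\<rho>0 j\<bar>)))"
    using A9(2) by blast
  \<comment> \<open>Both alternatives reduce to one statement: an exponent \<open>\<beta>\<close>,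
    either \<open>\<xi> / (2 * \<xi> + 1)\<close> or 1/4, attained up to arbitrarily small powers
    and exceeding 1/2 together with \<open>d\<gamma>\<close>.\<close>
  have "\<exists>\<beta>>0. \<beta> + d\<gamma> > 1/2 \<and> (\<forall>c>0. \<exists>\<rho>0 D. D > 0 \<and> (\<forall>\<^sub>F n in sequentially. approx_err (p n) (\<rho>0 n)
      + (eps p n)\<^sup>2 * real (card {j. j < p n \<and> \<rho>0 n j \<noteq> 0}) + (eps p n)\<^sup>2 \<le> D * real n powr (2 * c - 2 * \<beta>)))"
    using br
  proof
    assume 1: "\<xi> / (2 * \<xi> + 1) + d\<gamma> > 1 / 2"
    show ?thesis
      using 1 \<xi> approx_rate_sparse[OF p A5(3) \<xi> CA _ A2'] by (intro exI[of _ "\<xi> / (2 * \<xi> + 1)"]) auto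
  next
    assume 2: "d\<gamma> > 1 / 4 \<and>
          (\<exists>\<rho>0 :: nat \<Rightarrow> real.
             (AE w in F. (\<lambda>j. \<rho>0 j * b j (X w)) sums \<alpha>bar (X w)) \<and>
             summable (\<lambda>j. \<bar>\<rho>0 j\<bar>) \<and>
             (\<exists>C>0. \<forall>\<^sub>F n in sequentially. \<exists>J\<subseteq>{..<p n}.
                card J = nat \<lfloor>C * sqrt (real n)\<rfloor> \<and> (\<forall>j\<in>J. \<forall>k. k \<notin> J \<longrightarrow> \<bar>\<rho>0 k\<bar> \<le> \<bar>\<rho>0 j\<bar>)))"
    then obtain \<rho>0 :: "nat \<Rightarrow> real" and C where s: "AE w in F. (\<lambda>j. \<rho>0 j * b j (X w)) sums \<alpha>bar (X w)" "summable (\<lambda>j. \<bar>\<rho>0 j\<bar>)"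
      and C: "C > 0" and J: "\<forall>\<^sub>F n in sequentially. \<exists>J\<subseteq>{..<p n}.
                card J = nat \<lfloor>C * sqrt (real n)\<rfloor> \<and> (\<forall>j\<in>J. \<forall>k. k \<notin> J \<longrightarrow> \<bar>\<rho>0 k\<bar> \<le> \<bar>\<rho>0 j\<bar>)" by blast
    have "\<exists>\<rho>n D. D > 0 \<and> (\<forall>\<^sub>F n in sequentially. approx_err (p n) (\<rho>n n)
      + (eps p n)\<^sup>2 * real (card {j. j < p n \<and> \<rho>n n j \<noteq> 0}) + (eps p n)\<^sup>2 \<le> D * real n powr (2 * c - 2 * (1/4)))" if "c > 0" for c
      by (rule approx_rate_summable[OF p A5(3) that eig_all \<Lambda> s C J])
    then show ?thesis using 2 by (intro exI[of _ "1/4"]) auto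
  qed
  then obtain \<beta> where \<beta>: "\<beta> > 0" "\<beta> + d\<gamma> > 1/2" and approx: "\<And>c. c > 0 \<Longrightarrow> \<exists>\<rho>0 D. D > 0 \<and> (\<forall>\<^sub>F n in sequentially. approx_err (p n) (\<rho>0 n)
      + (eps p n)\<^sup>2 * real (card {j. j < p n \<and> \<rho>0 n j \<noteq> 0}) + (eps p n)\<^sup>2 \<le> D * real n powr (2 * c - 2 * \<beta>))"
    by blast
  \<comment> \<open>The loss \<open>2 * c\<close> is then at most half of \<open>\<beta>\<close> and
    half of the excess of \<open>\<beta> + d\<gamma>\<close> over 1/2, so the lasso error and its
    product with the learner's error still have the required rates.\<close>
  define c where "c = min \<beta> (\<beta> + d\<gamma> - 1/2) / 4"
  have cmin: "c \<le> \<beta> / 4" "c \<le> (\<beta> + d\<gamma> - 1/2) / 4" "c > 0" using \<beta> by (auto simp: c_def)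
  have c: "c > 0" "c < \<beta>" "2 * c - \<beta> < 0" "1/2 + (2 * c - \<beta>) - d\<gamma> < 0" using cmin \<beta> by (auto simp: field_simps)
  obtain \<rho>0 D where D: "D > 0" and approx_c: "\<forall>\<^sub>F n in sequentially. approx_err (p n) (\<rho>0 n)
      + (eps p n)\<^sup>2 * real (card {j. j < p n \<and> \<rho>0 n j \<noteq> 0}) + (eps p n)\<^sup>2 \<le> D * real n powr (2 * c - 2 * \<beta>)"
    using approx[OF c(1)] by blast
  obtain Cr cr where Cr: "Cr > 0" and cr: "cr > 0" and RE: "\<And>l (s :: nat \<Rightarrow> nat). l < L \<Longrightarrow>
         (\<lambda>n. real (s n) * (eps p n)\<^sup>2) \<longlonglongrightarrow> Cr \<Longrightarrow>
         wpa1 M (\<lambda>n \<omega>. restricted_eigenvalue_ge (p n) (s n) cr (G_hat X b (out_fold I n l) (train n l \<omega>)))"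
    using A3(2) by blast
  have I_sub: "I n l \<subseteq> {..<n}" if "l < L" for n l using folds(1)[of n] that by blast
  have I_fin: "finite (I n l)" if "l < L" for n l using I_sub[OF that] finite_subset by blast
  have I_card: "card (I n l) \<le> n" if "l < L" for n l using card_mono[OF _ I_sub[OF that, of n]] by simp
  have Lr: "real L \<ge> 2" using L by simp
  have card_out: "\<forall>\<^sub>F n in sequentially. real n / 4 \<le> real (card (out_fold I n l))" if l: "l < L" for l
  proof -
    \<comment> \<open>A fold holds asymptotically at most half of the sample, so at least a quarter
      eventually remains for training.\<close>
    have "1 / real L < 3 / 4" using Lr by (simp add: field_simps)
    from order_tendstoD(2)[OF equal_folds[OF l] this] eventually_ge_at_top[of 1] show ?thesis
    proof eventually_elim
      case (elim n)
      have "real (card (I n l)) \<le> 3 / 4 * real n" using elim by (simp add: pos_divide_less_eq)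
      moreover have "card (out_fold I n l) = n - card (I n l)"
        unfolding out_fold_def using card_Diff_subset[OF I_fin[OF l] I_sub[OF l]] by simp
      ultimately show ?case using I_card[OF l, of n] by (simp add: of_nat_diff)
    qed
  qed
  have card_in: "\<forall>\<^sub>F n in sequentially. 1 / (2 * real L) * real n \<le> real (card (I n l))" if l: "l < L" for l
  proof -
    have "1 / (2 * real L) < 1 / real L" using Lr by (simp add: field_simps)
    from order_tendstoD(1)[OF equal_folds[OF l] this] eventually_ge_at_top[of 1] show ?thesis
      by eventually_elim (simp add: pos_less_divide_eq less_imp_le)
  qed
  have tr: "train n l \<omega> = obs (out_fold I n l) \<omega>" for n l \<omega> by (simp add: train)

  define R where "R n l \<omega> = fold_remainder (I n l) (gh n l (obs (out_fold I n l) \<omega>))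
      (lin_comb b (p n) (rh n l (obs (out_fold I n l) \<omega>))) \<omega>" for n l \<omega>
  have fold: "\<forall>\<^sub>F n in sequentially. whp \<delta> (\<lambda>\<omega>. \<bar>R n l \<omega>\<bar> < e * sqrt (real n))"
    if l: "l < L" and e: "e > 0" and \<delta>: "\<delta> > 0" for l e \<delta>
  proof -
    have "\<exists>K>0. wpa1 M (\<lambda>n \<omega>. approx_err (p n) (rh n l (obs (out_fold I n l) \<omega>))
            \<le> (K * real (max 1 n) powr (2 * c - \<beta>))\<^sup>2)"
    proof (rule lasso_rate_powr[where rh="\<lambda>n. rh n l" and N="\<lambda>n. out_fold I n l" and Cm=Cm and \<Lambda>=\<Lambda> and Cr=Cr and cr=cr and r=r and D=D])
      show "wpa1 M (\<lambda>n \<omega>. restricted_eigenvalue_ge (p n) (s n) cr (G_hat X b (out_fold I n l) (obs (out_fold I n l) \<omega>)))"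
        if "(\<lambda>n. real (s n) * (eps p n)\<^sup>2) \<longlonglongrightarrow> Cr" for s :: "nat \<Rightarrow> nat"
        using RE[OF l that] by (simp add: tr)
      show "r \<in> o(\<lambda>n. real n powr c * eps p n)" by (rule A5(2)[OF c(1)])
      show "finite (out_fold I n l)" for n by (simp add: out_fold_def)
    qed (fact p r eps0 A5(1) card_out[OF l] Cm eig \<Lambda> Cr cr rh[OF l] approx_c D c(2))+
    then obtain K where K: "K > 0" and a_err: "wpa1 M (\<lambda>n \<omega>. approx_err (p n) (rh n l (obs (out_fold I n l) \<omega>))
            \<le> (K * real (max 1 n) powr (2 * c - \<beta>))\<^sup>2)" by blast
    define A where "A n = K * real (max 1 n) powr (2 * c - \<beta>)" for n
    have A_ev: "\<forall>\<^sub>F n in sequentially. K * real n powr (2 * c - \<beta>) = A n"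
      using eventually_ge_at_top[of 1] by eventually_elim (simp add: A_def max_def)
    have "(\<lambda>n. K * real n powr (2 * c - \<beta>)) \<longlonglongrightarrow> 0"
      by (intro tendsto_mult_right_zero powr_neg_tendsto_0 c(3))
    then have A0: "A \<longlonglongrightarrow> 0" by (rule Lim_transform_eventually[OF _ A_ev])
    have "(\<lambda>n. K * real n powr (1/2 + (2 * c - \<beta>) - d\<gamma>)) \<longlonglongrightarrow> 0"
      by (intro tendsto_mult_right_zero powr_neg_tendsto_0 c(4))
    moreover have "\<forall>\<^sub>F n in sequentially. K * real n powr (1/2 + (2 * c - \<beta>) - d\<gamma>) = sqrt (real n) * A n * real n powr (- d\<gamma>)"
      using A_ev
    proof eventually_elim
      case (elim n)
      have sq: "sqrt (real n) = real n powr (1/2)" by (simp add: powr_half_sqrt)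
      have "real n powr (1/2 + (2 * c - \<beta>) - d\<gamma>) = real n powr (1/2) * real n powr (2 * c - \<beta>) * real n powr (- d\<gamma>)"
        by (simp add: powr_add[symmetric])
      then show ?case unfolding elim[symmetric] sq by (simp only: mult_ac)
    qed
    ultimately have AG: "(\<lambda>n. sqrt (real n) * A n * real n powr (- d\<gamma>)) \<longlonglongrightarrow> 0" by (rule Lim_transform_eventually)
    \<comment> \<open>Membership in \<open>\<Gamma>\<close> is passed on only through this identity
      between integrals.\<close>
    have g_riesz: "wpa1 M (\<lambda>n \<omega>. (LINT w|F. m w (gh n l (obs (out_fold I n l) \<omega>))) =
          (LINT w|F. \<alpha>bar (X w) * gh n l (obs (out_fold I n l) \<omega>) (X w)))"
      by (rule wpa1_combine[OF A9(1)[OF l] A9(1)[OF l]]) (use m_riesz(2) in \<open>auto simp: tr\<close>)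
    show ?thesis unfolding R_def
    proof (rule fold_remainder_in_prob[where g="\<lambda>n. gh n l" and \<rho>h="\<lambda>n. rh n l" and A=A and d\<gamma>=d\<gamma> and c="1 / (2 * real L)"])
      show "out_fold I n l \<inter> I n l = {}" for n by (auto simp: out_fold_def)
      show "wpa1 M (\<lambda>n \<omega>. approx_err (p n) (rh n l (obs (out_fold I n l) \<omega>)) \<le> (A n)\<^sup>2)"
        using a_err by (simp add: A_def)
      show "tendsto_0_in_prob M (\<lambda>n \<omega>. \<integral>\<^sup>+ w. ennreal ((m w (gh n l (obs (out_fold I n l) \<omega>)) - m w \<gamma>bar)\<^sup>2) \<partial>F)"
        using A8(2)[OF l] by (simp add: tr)
      show "bigO_in_prob M (\<lambda>n \<omega>. ms_norm F (\<lambda>w. gh n l (obs (out_fold I n l) \<omega>) (X w) - \<gamma>bar (X w))) (\<lambda>n. real n powr (- d\<gamma>))"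
        using g_rate[OF l] by (simp add: tr)
      show "1 / (2 * real L) > 0" using Lr by simp
      show "A n > 0" for n using K by (simp add: A_def)
    qed (fact I_fin[OF l] I_card[OF l] card_in[OF l] gh_measurable[OF l] m_gh_measurable[OF l] rh_measurable[OF l] A0 g_riesz d\<gamma> AG e \<delta>)+
  qed

  define T where "T n \<omega> = sqrt (real n) * (theta_tilde m X Y b p L I gh rh n (\<lambda>i. W i \<omega>) - \<theta>bar)" for n \<omega>
  have \<psi>m: "\<psi> \<in> borel_measurable F" unfolding \<psi> using m_g_meas by measurable
  have ar2: "integrable F (\<lambda>w. (\<alpha>bar (X w) * (Y w - \<gamma>bar (X w)))\<^sup>2)" using resid_var[OF ab \<alpha>_bounded] by simp
  have mc2: "integrable F (\<lambda>w. (m w \<gamma>bar + (- \<theta>bar))\<^sup>2)"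
    by (rule F.integrable_sq_add(1)) (use m_g_meas A8(1) in auto)
  have \<psi>2: "integrable F (\<lambda>w. (\<psi> w)\<^sup>2)"
    using F.integrable_sq_add(1)[OF _ _ mc2 ar2] m_g_meas by (simp add: \<psi>)
  have \<psi>0: "(LINT w|F. \<psi> w) = 0"
  proof -
    have "integrable F (\<lambda>w. \<alpha>bar (X w) * (Y w - \<gamma>bar (X w)))"
      by (rule F.integrable_mult_of_sq) (use ab2 r2 in auto)
    then show ?thesis using m_riesz(1)[OF gb\<Gamma>] orthY[OF ab\<Gamma>] by (simp add: \<psi> \<theta>bar F.prob_space)
  qed
  \<comment> \<open>The folds partition the sample, so the fold sums of the leading term add up to
    the full sum, and centring by \<open>\<theta>bar\<close> cancels.\<close>
  have diff: "T n \<omega> - (\<Sum>i<n. \<psi> (W i \<omega>)) / sqrt (real n) = (\<Sum>l<L. R n l \<omega>) / sqrt (real n)"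
    if n: "n \<ge> 1" for n \<omega>
  proof -
    define Q where "Q = (\<Sum>l<L. \<Sum>i\<in>I n l. m (W i \<omega>) (gamma_tilde X Y (I n l) (gh n l (obs (out_fold I n l) \<omega>))
             (lin_comb b (p n) (rh n l (obs (out_fold I n l) \<omega>))) (\<lambda>i. W i \<omega>)))"
    have "(\<Sum>i<n. m (W i \<omega>) \<gamma>bar + \<alpha>bar (X (W i \<omega>)) * (Y (W i \<omega>) - \<gamma>bar (X (W i \<omega>)))) =
      (\<Sum>l<L. \<Sum>i\<in>I n l. m (W i \<omega>) \<gamma>bar + \<alpha>bar (X (W i \<omega>)) * (Y (W i \<omega>) - \<gamma>bar (X (W i \<omega>))))"
      unfolding folds(1)[of n, symmetric]
      by (rule sum.UNION_disjoint) (use I_fin folds(2)[of n] in \<open>auto simp: disjoint_family_on_def\<close>)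
    moreover have "(\<Sum>i<n. \<psi> (W i \<omega>)) = (\<Sum>i<n. m (W i \<omega>) \<gamma>bar + \<alpha>bar (X (W i \<omega>)) * (Y (W i \<omega>) - \<gamma>bar (X (W i \<omega>)))) - real n * \<theta>bar"
      by (simp add: \<psi> sum.distrib sum_subtractf)
    moreover have "T n \<omega> = sqrt (real n) * (Q / real n - \<theta>bar)" by (simp add: T_def theta_tilde_def Q_def sum_divide_distrib)
    moreover have "sqrt (real n) * (Q / real n - \<theta>bar) = (Q - real n * \<theta>bar) / sqrt (real n)"
    proof -
      define q where "q = sqrt (real n)"
      have "q > 0" and "real n = q * q" using n by (auto simp: q_def)
      then show ?thesis unfolding q_def[symmetric] by (simp add: field_simps)
    qed
    ultimately show ?thesis
      by (simp add: R_def fold_remainder_def sum_subtractf Q_def[symmetric] diff_divide_distrib)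
  qed
  have "weak_conv_m (\<lambda>n. distr M borel (T n)) (centered_normal V)"
  proof (rule clt_perturbed[OF \<psi>m \<psi>2 \<psi>0 V])
    show Tm: "T n \<in> borel_measurable M" for n unfolding T_def using theta_tilde_measurable[of n] by measurable
    fix e :: real assume e: "e > 0"
    let ?Z = "\<lambda>n. {\<omega>\<in>space M. \<bar>T n \<omega> - (\<Sum>i<n. \<psi> (W i \<omega>)) / sqrt (real n)\<bar> > e}"
    have L0: "real L > 0" using Lr by simp
    show "(\<lambda>n. prob (?Z n)) \<longlonglongrightarrow> 0"
    proof (rule tendstoI)
      fix \<delta> :: real assume \<delta>: "\<delta> > 0"
      \<comment> \<open>The tolerance is divided among the \<open>L\<close> folds; the failure
        probabilities add up to \<open>\<delta> / 2\<close>, which leaves the strict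
        inequality.\<close>
      have eL: "e / real L > 0" and dL: "\<delta> / (2 * real L) > 0" using e \<delta> L0 by auto
      have "\<forall>\<^sub>F n in sequentially. \<forall>l\<in>{..<L}. whp (\<delta> / (2 * real L)) (\<lambda>\<omega>. \<bar>R n l \<omega>\<bar> < e / real L * sqrt (real n))"
        using fold[OF _ eL dL] by (intro eventually_ball_finite) auto
      then show "\<forall>\<^sub>F n in sequentially. dist (prob (?Z n)) 0 < \<delta>"
        using eventually_ge_at_top[of 1]
      proof eventually_elim
        case (elim n)
        have all: "whp (real (card {..<L}) * (\<delta> / (2 * real L))) (\<lambda>\<omega>. \<forall>l\<in>{..<L}. \<bar>R n l \<omega>\<bar> < e / real L * sqrt (real n))"
          by (rule whp_ball) (use elim(1) in auto)
        have sn: "sqrt (real n) > 0" using elim(2) by simp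
        have "?Z n \<subseteq> {\<omega>\<in>space M. \<not> (\<forall>l\<in>{..<L}. \<bar>R n l \<omega>\<bar> < e / real L * sqrt (real n))}"
        proof
          fix \<omega> assume z: "\<omega> \<in> ?Z n"
          have False if Rb: "\<forall>l\<in>{..<L}. \<bar>R n l \<omega>\<bar> < e / real L * sqrt (real n)"
          proof -
            have "\<bar>\<Sum>l<L. R n l \<omega>\<bar> \<le> (\<Sum>l<L. \<bar>R n l \<omega>\<bar>)" by (rule sum_abs)
            also have "\<dots> \<le> (\<Sum>l<L. e / real L * sqrt (real n))" using Rb by (intro sum_mono) (simp add: less_imp_le)
            also have "\<dots> = e * sqrt (real n)" using L0 by simp
            finally have "\<bar>(\<Sum>l<L. R n l \<omega>) / sqrt (real n)\<bar> \<le> e" using sn by (simp add: pos_divide_le_eq)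
            then show False using z diff[OF elim(2), of \<omega>] by simp
          qed
          then show "\<omega> \<in> {\<omega>\<in>space M. \<not> (\<forall>l\<in>{..<L}. \<bar>R n l \<omega>\<bar> < e / real L * sqrt (real n))}" using z by blast
        qed
        then have "prob (?Z n) \<le> real (card {..<L}) * (\<delta> / (2 * real L))" by (rule prob_le_of_whp[OF all])
        also have "\<dots> = \<delta> / 2" using L0 by simp
        finally show ?case using \<delta> by simp
      qed
    qed
  qed
  then show ?thesis by (simp only: T_def[abs_def])
qed

end
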